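(* Let $A$ and $M$ be compact smooth manifolds, possibly with boundary, let $\rho\colon A\to M$ be a smooth map, and let $\Lambda$ be a proper subring of $\mathbb{R}$. The following sequence is exact: $$\cdots\to\widehat{H}^{k-1}(A)\xrightarrow{\ l\ }\check{H}^k(\rho)\xrightarrow{\ q\ }\widehat{H}^k(M)\xrightarrow{\ \rho\ }\widehat{H}^k(A)\to\cdots$$ (the terms being those of degree at least $1$), where $\rho\colon\widehat{H}^k(M)\to\widehat{H}^k(A)$ is the natural pullback map $f\mapsto f\circ\rho_*$ from differential characters on $M$ to those on $A$, and $l$, $q$ are induced by the inclusion $\check{C}^{*-1}(A)\to\check{C}^*(M)\times\check{C}^{*-1}(A)$ and the projection $\check{C}^*(M)\times\check{C}^{*-1}(A)\to\check{C}^*(M)$ respectively. That is, for every $k\ge1$ the sequence is exact at $\widehat{H}^k(M)$ and at $\widehat{H}^k(A)$, and for every $k\ge2$ it is exact at $\check{H}^k(\rho)$.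
   Context: For $X=M$ or $A$: $C_kX$ and $Z_kX$ are the groups of smooth singular $k$-chains and $k$-cycles, $\Omega^kX$ is the group of smooth $k$-forms, viewed as real cochains by integration, and $\Omega^k_\Lambda X$ is the subgroup of $k$-forms with $\Lambda$-periods, i.e. whose integrals over all smooth $k$-cycles lie in $\Lambda$ (such forms are closed). Groups in negative degree are zero. Cheeger-Simons differential characters of degree $k\ge1$: $$\widehat{H}^k(X)=\{f\in\operatorname{Hom}(Z_{k-1}X,\mathbb{R}/\Lambda)\mid f\circ\partial\in\Omega^kX\},$$ where $f\circ\partial\in\Omega^kX$ means that $f\circ\partial$ is the reduction mod $\Lambda$ of integration against a $k$-form. The complex $\check{C}^*(X)$: $\check{C}^k(X)=C^k(X;\Lambda)\times C^{k-1}(X;\mathbb{R})\times\Omega^k_\Lambda X$ with differential $\Delta(c,h,\omega)=(\delta c,\omega-c-\delta h,0)$. For $k\ge1$ the map sending a cocycle $(c,h,\omega)$ to the restriction to $Z_{k-1}X$ of the mod $\Lambda$ reduction of $h$ induces an isomorphism $H_k(\check{C}^*(X))\cong\widehat{H}^k(X)$ (Hopkins-Singer), and through it the two groups are identified. The relative Hopkins-Singer groups are $\check{H}^k(\rho)=H_k(\check{C}^*(M)\times\check{C}^{*-1}(A))$, the $k$-th homology of the complex whose degree-$k$ group is $\check{C}^k(M)\times\check{C}^{k-1}(A)$, with differential $\delta(S,T)=(\Delta S,\rho^*S-\Delta T)$. *)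

theory Defs
  imports
    "HOL-Analysis.Analysis"
    "HOL-Algebra.Subrings"
    "HOL-Homology.Homology"
    "HOL-Library.Function_Algebras"
begin

section \<open>Smooth functions on subsets of coordinate space\<close>

text \<open>Dimensions vary inside a single statement (simplices of all degrees, manifolds of dimension 0),
  so, as in the Homology library, \<open>\<real>\<^sup>n\<close> is \<^const>\<open>Euclidean_space\<close> \<open>n\<close>: the points
  \<open>x :: nat \<Rightarrow> real\<close> with \<open>x i = 0\<close> for \<open>i \<ge> n\<close>.\<close>

abbreviation coord_space :: "nat \<Rightarrow> (nat \<Rightarrow> real) set" where
  "coord_space n \<equiv> topspace (Euclidean_space n)"

text \<open>The derivative is taken within \<open>S\<close>, hence one-sided at boundary points of a half-space.\<close>

definition partial_deriv ::
    "(nat \<Rightarrow> real) set \<Rightarrow> nat \<Rightarrow> ((nat \<Rightarrow> real) \<Rightarrow> real) \<Rightarrow> (nat \<Rightarrow> real) \<Rightarrow> real" where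
  "partial_deriv S i f x =
     vector_derivative (\<lambda>t. f (x(i := t))) (at (x i) within {t. x(i := t) \<in> S})"

text \<open>\<open>C\<^sup>\<infinity>\<close> on an open set: all iterated partial derivatives exist and are continuous.\<close>

definition smooth_on_open :: "nat \<Rightarrow> (nat \<Rightarrow> real) set \<Rightarrow> ((nat \<Rightarrow> real) \<Rightarrow> real) \<Rightarrow> bool" where
  "smooth_on_open n W f \<longleftrightarrow> openin (Euclidean_space n) W \<and>
     (\<forall>is. set is \<subseteq> {..<n} \<longrightarrow>
        (let g = foldr (partial_deriv W) is f in
          continuous_on W g \<and>
          (\<forall>x\<in>W. \<forall>i<n. (\<lambda>t. g (x(i := t))) differentiable (at (x i) within {t. x(i := t) \<in> W}))))"

text \<open>On an arbitrary subset of \<open>\<real>\<^sup>n\<close>, smooth means locally the restriction of a smooth function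
  on an open set.\<close>

definition smooth_on :: "nat \<Rightarrow> (nat \<Rightarrow> real) set \<Rightarrow> ((nat \<Rightarrow> real) \<Rightarrow> real) \<Rightarrow> bool" where
  "smooth_on n S f \<longleftrightarrow> S \<subseteq> coord_space n \<and>
     (\<forall>x\<in>S. \<exists>W g. x \<in> W \<and> smooth_on_open n W g \<and> (\<forall>y\<in>W \<inter> S. g y = f y))"


section \<open>Smooth manifolds with boundary\<close>

type_synonym 'a chart = "'a set \<times> ('a \<Rightarrow> nat \<Rightarrow> real)"

record 'a smooth_manifold =
  mtop :: "'a topology"
  mdim :: nat
  matlas :: "'a chart set"

text \<open>For \<open>n = 0\<close> this is the single point of \<open>\<real>\<^sup>0\<close>.\<close>

definition half_space :: "nat \<Rightarrow> (nat \<Rightarrow> real) set" where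
  "half_space n = {x \<in> coord_space n. 0 \<le> x 0}"

definition is_chart :: "'a topology \<Rightarrow> nat \<Rightarrow> 'a chart \<Rightarrow> bool" where
  "is_chart T n = (\<lambda>(U, \<phi>). openin T U \<and>
     openin (subtopology (Euclidean_space n) (half_space n)) (\<phi> ` U) \<and>
     homeomorphic_map (subtopology T U) (subtopology (Euclidean_space n) (\<phi> ` U)) \<phi>)"

definition transition :: "'a chart \<Rightarrow> 'a chart \<Rightarrow> (nat \<Rightarrow> real) \<Rightarrow> nat \<Rightarrow> real" where
  "transition c d x = snd d (inv_into (fst c) (snd c) x)"

text \<open>The atlas need not be maximal; everything below depends only on the smooth structure
  it generates.\<close>

definition compact_smooth_manifold :: "'a smooth_manifold \<Rightarrow> bool" where
  "compact_smooth_manifold X \<longleftrightarrow>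
     compact_space (mtop X) \<and> Hausdorff_space (mtop X) \<and> second_countable (mtop X) \<and>
     (\<forall>c\<in>matlas X. is_chart (mtop X) (mdim X) c) \<and>
     topspace (mtop X) = (\<Union>c\<in>matlas X. fst c) \<and>
     (\<forall>c\<in>matlas X. \<forall>d\<in>matlas X. \<forall>i<mdim X.
        smooth_on (mdim X) (snd c ` (fst c \<inter> fst d)) (\<lambda>x. transition c d x i))"

definition smooth_map :: "'a smooth_manifold \<Rightarrow> 'b smooth_manifold \<Rightarrow> ('a \<Rightarrow> 'b) \<Rightarrow> bool" where
  "smooth_map X Y f \<longleftrightarrow> continuous_map (mtop X) (mtop Y) f \<and>
     (\<forall>c\<in>matlas X. \<forall>d\<in>matlas Y. \<forall>i<mdim Y.
        smooth_on (mdim X) (snd c ` {p \<in> fst c. f p \<in> fst d})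
          (\<lambda>x. snd d (f (inv_into (fst c) (snd c) x)) i))"


section \<open>Smooth singular chains\<close>

text \<open>All degrees are integers, and the groups in negative degree are zero. The standard simplex of
  dimension \<open>p\<close> is the one of the Homology library, in barycentric coordinates \<open>0, \<dots>, p\<close>.\<close>

definition smooth_simplices :: "'a smooth_manifold \<Rightarrow> int \<Rightarrow> ((nat \<Rightarrow> real) \<Rightarrow> 'a) set" where
  "smooth_simplices X k = {\<sigma>. 0 \<le> k \<and> singular_simplex (nat k) (mtop X) \<sigma> \<and>
     (\<forall>d\<in>matlas X. \<forall>i<mdim X.
        smooth_on (Suc (nat k)) {t \<in> standard_simplex (nat k). \<sigma> t \<in> fst d}
          (\<lambda>t. snd d (\<sigma> t) i))}"

definition smooth_chain_group :: "'a smooth_manifold \<Rightarrow> int \<Rightarrow> 'a chain monoid" where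
  "smooth_chain_group X k = free_Abelian_group (smooth_simplices X k)"

abbreviation smooth_chains :: "'a smooth_manifold \<Rightarrow> int \<Rightarrow> 'a chain set" where
  "smooth_chains X k \<equiv> carrier (smooth_chain_group X k)"

text \<open>Note that \<^const>\<open>chain_boundary\<close> vanishes in degree \<open>0\<close>, and that \<open>nat k = 0\<close> for
  negative \<open>k\<close>.\<close>

definition smooth_cycles :: "'a smooth_manifold \<Rightarrow> int \<Rightarrow> 'a chain set" where
  "smooth_cycles X k = {z \<in> smooth_chains X k. chain_boundary (nat k) z = 0}"

definition smooth_cycle_group :: "'a smooth_manifold \<Rightarrow> int \<Rightarrow> 'a chain monoid" where
  "smooth_cycle_group X k = (smooth_chain_group X k)\<lparr>carrier := smooth_cycles X k\<rparr>"


section \<open>Differential forms as cochains\<close>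

text \<open>A tangent vector at \<open>p\<close> is given by its coordinate vectors in the charts around \<open>p\<close>, and these
  are related by the Jacobian matrices of the transition maps.\<close>

definition tangent_change ::
    "'a smooth_manifold \<Rightarrow> 'a chart \<Rightarrow> 'a chart \<Rightarrow> 'a \<Rightarrow> (nat \<Rightarrow> real) \<Rightarrow> nat \<Rightarrow> real" where
  "tangent_change X c d p v = (\<lambda>i. \<Sum>j<mdim X.
     v j * partial_deriv (snd c ` (fst c \<inter> fst d)) j (\<lambda>x. transition c d x i) (snd c p))"

definition alternating_form :: "nat \<Rightarrow> nat \<Rightarrow> ((nat \<Rightarrow> real) list \<Rightarrow> real) \<Rightarrow> bool" where
  "alternating_form n k T \<longleftrightarrow>
     (\<forall>vs. length vs = k \<and> set vs \<subseteq> coord_space n \<longrightarrow>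
        (\<forall>i<k. \<forall>v\<in>coord_space n. \<forall>w\<in>coord_space n. \<forall>a b.
           T (vs[i := (\<lambda>m. a * v m + b * w m)]) = a * T (vs[i := v]) + b * T (vs[i := w])) \<and>
        (\<forall>i j. i < j \<and> j < k \<and> vs ! i = vs ! j \<longrightarrow> T vs = 0))"

definition unit_vector :: "nat \<Rightarrow> nat \<Rightarrow> real" where
  "unit_vector i = (\<lambda>m. if m = i then 1 else 0)"

text \<open>\<open>\<omega> c p [v\<^sub>1, \<dots>, v\<^sub>k]\<close> is the value of the form at \<open>p\<close> on the tangent vectors whose
  coordinate vectors in the chart \<open>c\<close> are \<open>v\<^sub>1, \<dots>, v\<^sub>k\<close>. Only values with \<open>c\<close> in the atlas,
  \<open>p\<close> in the domain of \<open>c\<close>, and \<open>k\<close> vectors in \<open>\<real>\<^sup>n\<close> are meaningful.\<close>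

type_synonym 'a diff_form = "'a chart \<Rightarrow> 'a \<Rightarrow> (nat \<Rightarrow> real) list \<Rightarrow> real"

definition smooth_form :: "'a smooth_manifold \<Rightarrow> nat \<Rightarrow> 'a diff_form \<Rightarrow> bool" where
  "smooth_form X k \<omega> \<longleftrightarrow>
     (\<forall>c\<in>matlas X. \<forall>p\<in>fst c. alternating_form (mdim X) k (\<omega> c p)) \<and>
     (\<forall>c\<in>matlas X. \<forall>is. length is = k \<and> set is \<subseteq> {..<mdim X} \<longrightarrow>
        smooth_on (mdim X) (snd c ` fst c)
          (\<lambda>x. \<omega> c (inv_into (fst c) (snd c) x) (map unit_vector is))) \<and>
     (\<forall>c\<in>matlas X. \<forall>d\<in>matlas X. \<forall>p\<in>fst c \<inter> fst d. \<forall>vs.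
        length vs = k \<and> set vs \<subseteq> coord_space (mdim X) \<longrightarrow>
        \<omega> c p vs = \<omega> d p (map (tangent_change X c d p) vs))"

text \<open>The interior of the standard simplex is parametrised by the barycentric coordinates
  \<open>1, \<dots>, p\<close> (shifted to \<open>0, \<dots>, p - 1\<close>), which fixes the usual orientation. Points are extensional
  on \<open>{..<p}\<close> because they live in the product measure space.\<close>

definition open_simplex :: "nat \<Rightarrow> (nat \<Rightarrow> real) set" where
  "open_simplex p = {t \<in> extensional {..<p}. (\<forall>i<p. 0 < t i) \<and> (\<Sum>i<p. t i) < 1}"

definition barycentric :: "nat \<Rightarrow> (nat \<Rightarrow> real) \<Rightarrow> nat \<Rightarrow> real" where
  "barycentric p t =
     (\<lambda>i. if i = 0 then 1 - (\<Sum>j<p. t j) else if i \<le> p then t (i - 1) else 0)"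

text \<open>The integral of \<open>\<sigma>\<^sup>*\<omega>\<close>: at \<open>t\<close> the integrand is \<open>\<omega>(\<partial>\<sigma>/\<partial>t\<^sub>0, \<dots>, \<partial>\<sigma>/\<partial>t\<^bsub>p-1\<^esub>)\<close>,
  evaluated in some chart around \<open>\<sigma>(t)\<close>; the choice is immaterial for a form.\<close>

definition simplex_integral ::
    "'a smooth_manifold \<Rightarrow> nat \<Rightarrow> 'a diff_form \<Rightarrow> ((nat \<Rightarrow> real) \<Rightarrow> 'a) \<Rightarrow> real" where
  "simplex_integral X p \<omega> \<sigma> =
     set_lebesgue_integral (PiM {..<p} (\<lambda>_. lborel)) (open_simplex p)
       (\<lambda>t. let y = \<sigma> (barycentric p t);
                c = (SOME c. c \<in> matlas X \<and> y \<in> fst c)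
            in \<omega> c y (map (\<lambda>j i. partial_deriv {s \<in> open_simplex p. \<sigma> (barycentric p s) \<in> fst c} j
                                   (\<lambda>s. snd c (\<sigma> (barycentric p s)) i) t) [0..<p]))"

text \<open>A cochain is extended by \<open>0\<close> outside the chain group, so that addition of cochains is
  pointwise addition of functions.\<close>

type_synonym 'a cochain = "'a chain \<Rightarrow> real"

definition form_cochain :: "'a smooth_manifold \<Rightarrow> int \<Rightarrow> 'a diff_form \<Rightarrow> 'a cochain" where
  "form_cochain X k \<omega> = (\<lambda>c. if c \<in> smooth_chains X k
     then \<Sum>\<sigma>\<in>Poly_Mapping.keys c.
            of_int (Poly_Mapping.lookup c \<sigma>) * simplex_integral X (nat k) \<omega> \<sigma>
     else 0)"

definition forms :: "'a smooth_manifold \<Rightarrow> int \<Rightarrow> 'a cochain set" where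
  "forms X k = (if k < 0 then {0} else form_cochain X k ` {\<omega>. smooth_form X (nat k) \<omega>})"

definition period_forms :: "'a smooth_manifold \<Rightarrow> real set \<Rightarrow> int \<Rightarrow> 'a cochain set" where
  "period_forms X \<Lambda> k = {w \<in> forms X k. \<forall>z\<in>smooth_cycles X k. w z \<in> \<Lambda>}"


section \<open>Groups, homology and exactness\<close>

definition real_ring :: "real ring" where
  "real_ring = \<lparr>carrier = UNIV, monoid.mult = (*), one = 1, ring.zero = 0, add = (+)\<rparr>"

definition additive_group :: "'b::ab_group_add set \<Rightarrow> 'b monoid" where
  "additive_group S = \<lparr>carrier = S, monoid.mult = (+), one = 0\<rparr>"

definition cohomologous_to_zero :: "(int \<Rightarrow> 'b set) \<Rightarrow> (int \<Rightarrow> 'b \<Rightarrow> 'b) \<Rightarrow> int \<Rightarrow> 'b set" where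
  "cohomologous_to_zero C d k = d (k - 1) ` C (k - 1)"

definition cocycle_group ::
    "(int \<Rightarrow> 'b::ab_group_add set) \<Rightarrow> (int \<Rightarrow> 'b \<Rightarrow> 'b) \<Rightarrow> int \<Rightarrow> 'b monoid" where
  "cocycle_group C d k = additive_group {x \<in> C k. d k x = 0}"

definition homology ::
    "(int \<Rightarrow> 'b::ab_group_add set) \<Rightarrow> (int \<Rightarrow> 'b \<Rightarrow> 'b) \<Rightarrow> int \<Rightarrow> 'b set monoid" where
  "homology C d k = cocycle_group C d k Mod cohomologous_to_zero C d k"

definition homology_class ::
    "(int \<Rightarrow> 'b::ab_group_add set) \<Rightarrow> (int \<Rightarrow> 'b \<Rightarrow> 'b) \<Rightarrow> int \<Rightarrow> 'b \<Rightarrow> 'b set" where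
  "homology_class C d k x = cohomologous_to_zero C d k #>\<^bsub>cocycle_group C d k\<^esub> x"

text \<open>The map on classes induced by a map on cocycles, as in the library's homomorphism theorem
  for factor groups.\<close>

definition on_classes :: "('b \<Rightarrow> 'c) \<Rightarrow> 'b set \<Rightarrow> 'c" where
  "on_classes f K = the_elem (f ` K)"

definition exact_at ::
    "('b, 'r) monoid_scheme \<Rightarrow> ('b \<Rightarrow> 'c) \<Rightarrow> ('c, 's) monoid_scheme \<Rightarrow> ('c \<Rightarrow> 'd) \<Rightarrow>
     ('d, 't) monoid_scheme \<Rightarrow> bool" where
  "exact_at G f H g K \<longleftrightarrow>
     group_hom G H f \<and> group_hom H K g \<and> f ` carrier G = kernel H K g"

definition hom_group :: "('b, 'r) monoid_scheme \<Rightarrow> ('c, 's) monoid_scheme \<Rightarrow> ('b \<Rightarrow> 'c) monoid" where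
  "hom_group G H = \<lparr>carrier = hom G H \<inter> extensional (carrier G),
     monoid.mult = (\<lambda>f g. \<lambda>x\<in>carrier G. f x \<otimes>\<^bsub>H\<^esub> g x),
     one = (\<lambda>x\<in>carrier G. \<one>\<^bsub>H\<^esub>)\<rparr>"


section \<open>Differential characters\<close>

definition reduce :: "real set \<Rightarrow> real \<Rightarrow> real set" where
  "reduce \<Lambda> r = \<Lambda> #>\<^bsub>additive_group UNIV\<^esub> r"

definition differential_characters ::
    "'a smooth_manifold \<Rightarrow> real set \<Rightarrow> int \<Rightarrow> ('a chain \<Rightarrow> real set) monoid" where
  "differential_characters X \<Lambda> k =
     (let G = hom_group (smooth_cycle_group X (k - 1)) (additive_group UNIV Mod \<Lambda>)
      in G\<lparr>carrier := {f \<in> carrier G. \<exists>w\<in>forms X k. \<forall>c\<in>smooth_chains X k.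
                         f (chain_boundary (nat k) c) = reduce \<Lambda> (w c)}\<rparr>)"

definition character_pullback ::
    "'a smooth_manifold \<Rightarrow> ('a \<Rightarrow> 'm) \<Rightarrow> int \<Rightarrow> ('m chain \<Rightarrow> real set) \<Rightarrow> 'a chain \<Rightarrow> real set" where
  "character_pullback A \<rho> k f = (\<lambda>z\<in>smooth_cycles A (k - 1). f (chain_map (nat (k - 1)) \<rho> z))"


section \<open>Hopkins-Singer complexes\<close>

definition cochains :: "'a smooth_manifold \<Rightarrow> real set \<Rightarrow> int \<Rightarrow> 'a cochain set" where
  "cochains X G k = {f \<in> hom (smooth_chain_group X k) (additive_group G).
     \<forall>c. c \<notin> smooth_chains X k \<longrightarrow> f c = 0}"

definition coboundary :: "'a smooth_manifold \<Rightarrow> int \<Rightarrow> 'a cochain \<Rightarrow> 'a cochain" where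
  "coboundary X k f =
     (\<lambda>c. if c \<in> smooth_chains X (k + 1) then f (chain_boundary (nat (k + 1)) c) else 0)"

text \<open>Since forms are viewed as cochains, this is also the pullback of forms.\<close>

definition cochain_pullback ::
    "'a smooth_manifold \<Rightarrow> ('a \<Rightarrow> 'm) \<Rightarrow> int \<Rightarrow> 'm cochain \<Rightarrow> 'a cochain" where
  "cochain_pullback A \<rho> k f =
     (\<lambda>c. if c \<in> smooth_chains A k then f (chain_map (nat k) \<rho> c) else 0)"

type_synonym 'a hs_cochain = "'a cochain \<times> 'a cochain \<times> 'a cochain"

definition hs_cochains :: "'a smooth_manifold \<Rightarrow> real set \<Rightarrow> int \<Rightarrow> 'a hs_cochain set" where
  "hs_cochains X \<Lambda> k = cochains X \<Lambda> k \<times> cochains X UNIV (k - 1) \<times> period_forms X \<Lambda> k"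

definition hs_diff :: "'a smooth_manifold \<Rightarrow> int \<Rightarrow> 'a hs_cochain \<Rightarrow> 'a hs_cochain" where
  "hs_diff X k = (\<lambda>(c, h, w). (coboundary X k c, w - c - coboundary X (k - 1) h, 0))"

definition hs_homology ::
    "'a smooth_manifold \<Rightarrow> real set \<Rightarrow> int \<Rightarrow> 'a hs_cochain set monoid" where
  "hs_homology X \<Lambda> = homology (hs_cochains X \<Lambda>) (hs_diff X)"

definition cocycle_character ::
    "'a smooth_manifold \<Rightarrow> real set \<Rightarrow> int \<Rightarrow> 'a hs_cochain \<Rightarrow> 'a chain \<Rightarrow> real set" where
  "cocycle_character X \<Lambda> k = (\<lambda>(c, h, w). \<lambda>z\<in>smooth_cycles X (k - 1). reduce \<Lambda> (h z))"

text \<open>For \<open>k \<ge> 1\<close> this is the Hopkins-Singer isomorphism from the homology of the complex onto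
  \<^const>\<open>differential_characters\<close> \<open>X \<Lambda> k\<close>.\<close>

definition hs_iso ::
    "'a smooth_manifold \<Rightarrow> real set \<Rightarrow> int \<Rightarrow> 'a hs_cochain set \<Rightarrow> 'a chain \<Rightarrow> real set" where
  "hs_iso X \<Lambda> k = on_classes (cocycle_character X \<Lambda> k)"

definition hs_pullback ::
    "'a smooth_manifold \<Rightarrow> ('a \<Rightarrow> 'm) \<Rightarrow> int \<Rightarrow> 'm hs_cochain \<Rightarrow> 'a hs_cochain" where
  "hs_pullback A \<rho> k = (\<lambda>(c, h, w).
     (cochain_pullback A \<rho> k c, cochain_pullback A \<rho> (k - 1) h, cochain_pullback A \<rho> k w))"

definition rel_cochains ::
    "'m smooth_manifold \<Rightarrow> 'a smooth_manifold \<Rightarrow> real set \<Rightarrow> int \<Rightarrow>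
     ('m hs_cochain \<times> 'a hs_cochain) set" where
  "rel_cochains M A \<Lambda> k = hs_cochains M \<Lambda> k \<times> hs_cochains A \<Lambda> (k - 1)"

definition rel_diff ::
    "'m smooth_manifold \<Rightarrow> 'a smooth_manifold \<Rightarrow> ('a \<Rightarrow> 'm) \<Rightarrow> int \<Rightarrow>
     'm hs_cochain \<times> 'a hs_cochain \<Rightarrow> 'm hs_cochain \<times> 'a hs_cochain" where
  "rel_diff M A \<rho> k = (\<lambda>(S, T). (hs_diff M k S, hs_pullback A \<rho> k S - hs_diff A (k - 1) T))"

definition rel_hs_homology ::
    "'m smooth_manifold \<Rightarrow> 'a smooth_manifold \<Rightarrow> ('a \<Rightarrow> 'm) \<Rightarrow> real set \<Rightarrow> int \<Rightarrow>
     ('m hs_cochain \<times> 'a hs_cochain) set monoid" where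
  "rel_hs_homology M A \<rho> \<Lambda> = homology (rel_cochains M A \<Lambda>) (rel_diff M A \<rho>)"


section \<open>The maps of the exact sequence\<close>

text \<open>\<open>l\<close> from the characters of degree \<open>k - 1\<close> on \<open>A\<close> to the relative group of degree \<open>k\<close>:
  the map induced by the inclusion, preceded by the inverse of the identification.\<close>

definition l_map ::
    "'m smooth_manifold \<Rightarrow> 'a smooth_manifold \<Rightarrow> ('a \<Rightarrow> 'm) \<Rightarrow> real set \<Rightarrow> int \<Rightarrow>
     ('a chain \<Rightarrow> real set) \<Rightarrow> ('m hs_cochain \<times> 'a hs_cochain) set" where
  "l_map M A \<rho> \<Lambda> k =
     on_classes (\<lambda>T. homology_class (rel_cochains M A \<Lambda>) (rel_diff M A \<rho>) k (0, T)) \<circ>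
     inv_into (carrier (hs_homology A \<Lambda> (k - 1))) (hs_iso A \<Lambda> (k - 1))"

definition q_map ::
    "'m smooth_manifold \<Rightarrow> real set \<Rightarrow> int \<Rightarrow>
     ('m hs_cochain \<times> 'a hs_cochain) set \<Rightarrow> 'm chain \<Rightarrow> real set" where
  "q_map M \<Lambda> k =
     hs_iso M \<Lambda> k \<circ>
     on_classes (\<lambda>(S, T). homology_class (hs_cochains M \<Lambda>) (hs_diff M) k S)"

end

theory Submission
  imports Defs
begin

text \<open>The complex defining the relative groups is the mapping cone of the pullback between the
  Hopkins-Singer complexes of \<open>M\<close> and \<open>A\<close>, and the sequence is the long exact sequence of that cone
  with the absolute homology groups replaced by groups of differential characters. Every group in it
  is a quotient of cocycles by coboundaries (\<open>presents\<close>), so exactness becomes a statement about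
  cocycles (\<open>presents_exact\<close>), which for a cone is elementary (\<open>exact_at_base\<close>, \<open>exact_at_target\<close>,
  \<open>exact_at_cone\<close>). What has to be supplied is that the objects and maps are as claimed.

  The first ingredient is that forms are compatible with everything else. The chain rule
  (\<open>tangent_map_compose\<close>, \<open>simplex_gradient_map\<close>) makes the pullback of a form a form
  (\<open>smooth_form_pullback\<close>) whose integral over \<open>\<sigma>\<close> is the integral of the original one over
  \<open>\<rho> \<circ> \<sigma>\<close> (\<open>simplex_integral_pullback\<close>). The integrand along a smooth simplex is the restriction of a
  function that is smooth up to the boundary (\<open>form_along_smooth\<close>), hence bounded; so integrals
  exist, are additive in the form, and depend continuously on the simplex.

  The second ingredient is that the differential of the Hopkins-Singer complex squares to zero, that
  is, that forms with \<open>\<Lambda>\<close>-periods vanish on boundaries. Shrinking a \<open>(k + 1)\<close>-simplex to a vertex, the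
  integral over its boundary varies continuously and takes values in \<open>\<Lambda>\<close>; it ends at \<open>0\<close>. As a proper
  subgroup of the reals contains no interval, it is \<open>0\<close> throughout (\<open>period_form_closed\<close>). In the same
  way a form of positive degree with all its integrals in \<open>\<Lambda>\<close> is \<open>0\<close>
  (\<open>form_values_in_subgroup_zero\<close>).

  The third ingredient is the isomorphism of Hopkins and Singer (\<open>characters_presented\<close>). Both its
  injectivity and its surjectivity come from one extension principle: a homomorphism modulo \<open>\<Lambda>\<close> on a
  subgroup of the chains lifts to a real-valued homomorphism on all chains
  (\<open>lift_mod_subgroup\<close>), because the reals are divisible and chain groups are free.\<close>

section \<open>Calculus on open subsets of coordinate space\<close>

lemma coord_space_iff: "x \<in> coord_space n \<longleftrightarrow> (\<forall>i\<ge>n. x i = 0)"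
  by (simp add: topspace_Euclidean_space)

lemma openin_coord_space: "openin (Euclidean_space n) W \<longleftrightarrow> (\<exists>T. open T \<and> W = T \<inter> coord_space n)"
  unfolding Euclidean_space_def openin_subtopology
  by (simp add: euclidean_product_topology)

text \<open>The points of \<open>\<real>\<^sup>n\<close> vanish from index \<open>n\<close> on, so a neighbourhood in the product topology contains a
  box in the first \<open>n\<close> coordinates. All estimates below are made on such boxes.\<close>

lemma box_in_open:
  fixes x :: "nat \<Rightarrow> real"
  assumes "open T" "x \<in> T" "x \<in> coord_space n"
  obtains \<delta> where "\<delta> > 0" "\<And>y. y \<in> coord_space n \<Longrightarrow> (\<And>i. i < n \<Longrightarrow> \<bar>y i - x i\<bar> < \<delta>) \<Longrightarrow> y \<in> T"
proof -
  have "openin (product_topology (\<lambda>_. euclidean) UNIV) T"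
    using assms(1) by (simp add: euclidean_product_topology)
  from product_topology_open_contains_basis[OF this assms(2)]
  obtain X where X: "x \<in> Pi\<^sub>E UNIV X" "\<And>i. open (X i)" "Pi\<^sub>E UNIV X \<subseteq> T"
    by auto
  have "\<exists>d>0. \<forall>u. \<bar>u - x i\<bar> < d \<longrightarrow> u \<in> X i" for i
  proof -
    have "x i \<in> X i" using X(1) by auto
    with X(2)[of i] show ?thesis
      by (auto simp: open_dist dist_real_def)
  qed
  then obtain d where d: "\<And>i. d i > 0" "\<And>i u. \<bar>u - x i\<bar> < d i \<Longrightarrow> u \<in> X i"
    by metis
  define \<delta> where "\<delta> = Min (insert 1 (d ` {..<n}))"
  have "\<delta> > 0" unfolding \<delta>_def using d(1) by (subst Min_gr_iff) auto
  moreover have "y \<in> T" if y: "y \<in> coord_space n" "\<And>i. i < n \<Longrightarrow> \<bar>y i - x i\<bar> < \<delta>" for y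
  proof -
    have "y i \<in> X i" for i
    proof (cases "i < n")
      case True
      then have "\<delta> \<le> d i" unfolding \<delta>_def by (intro Min_le) auto
      then show ?thesis using y(2)[OF True] d(2) by force
    next
      case False
      then have "y i = x i" using y(1) assms(3) by (simp add: coord_space_iff)
      then show ?thesis using X(1) by auto
    qed
    then show ?thesis using X(3) by auto
  qed
  ultimately show ?thesis using that by blast
qed

lemma fun_upd_coord_space: "x \<in> coord_space n \<Longrightarrow> i < n \<Longrightarrow> x(i := t) \<in> coord_space n"
  by (auto simp: coord_space_iff)

lemma continuous_on_fun_upd_const:
  fixes x :: "nat \<Rightarrow> real"
  shows "continuous_on S (\<lambda>t. x(i := t))"
proof (rule continuous_on_coordinatewise_then_product)
  show "continuous_on S (\<lambda>t. (x(i := t)) j)" for j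
    by (cases "j = i") (simp_all add: continuous_intros)
qed

lemma open_slice:
  assumes "openin (Euclidean_space n) W" "i < n" and that: "x \<in> coord_space n"
  shows "open {t. x(i := t) \<in> W}"
proof -
  obtain T where T: "open T" "W = T \<inter> coord_space n" using assms openin_coord_space by blast
  have "{t. x(i := t) \<in> W} = (\<lambda>t. x(i := t)) -` T"
    using T fun_upd_coord_space[OF that assms(2)] by auto
  moreover have "open ((\<lambda>t. x(i := t)) -` T)"
    by (rule open_vimage[OF T(1) continuous_on_fun_upd_const])
  ultimately show ?thesis by simp
qed

text \<open>\<open>C\<^sup>r\<close> functions on \<open>W\<close>. The partial derivatives are existentially quantified rather than given by
  \<^const>\<open>partial_deriv\<close>, so that a closure property is proved by exhibiting the derivatives.\<close>

fun diff_class :: "nat \<Rightarrow> nat \<Rightarrow> (nat \<Rightarrow> real) set \<Rightarrow> ((nat \<Rightarrow> real) \<Rightarrow> real) \<Rightarrow> bool" where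
  "diff_class 0 n W f \<longleftrightarrow> continuous_on W f"
| "diff_class (Suc r) n W f \<longleftrightarrow> continuous_on W f \<and>
     (\<exists>f'. \<forall>i<n. diff_class r n W (f' i) \<and>
        (\<forall>x\<in>W. ((\<lambda>t. f (x(i := t))) has_real_derivative f' i x) (at (x i))))"

lemma diff_class_continuous: "diff_class r n W f \<Longrightarrow> continuous_on W f"
  by (cases r) auto

lemma diff_class_Suc_mono: "diff_class (Suc r) n W f \<Longrightarrow> diff_class r n W f"
proof (induction r arbitrary: f)
  case (Suc r)
  from Suc.prems obtain f' where f': "continuous_on W f" "\<forall>i<n. diff_class (Suc r) n W (f' i) \<and>
        (\<forall>x\<in>W. ((\<lambda>t. f (x(i := t))) has_real_derivative f' i x) (at (x i)))"
    by (subst (asm) diff_class.simps(2)) blast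
  then have "\<forall>i<n. diff_class r n W (f' i) \<and>
        (\<forall>x\<in>W. ((\<lambda>t. f (x(i := t))) has_real_derivative f' i x) (at (x i)))"
    using Suc.IH by blast
  with f'(1) show ?case by auto
qed auto

lemma diff_class_subset: "diff_class r n W f \<Longrightarrow> V \<subseteq> W \<Longrightarrow> diff_class r n V f"
proof (induction r arbitrary: f)
  case (Suc r)
  then show ?case by (auto intro: continuous_on_subset) (metis subset_eq)
qed (auto intro: continuous_on_subset)

lemma derivative_cong_slice:
  assumes "openin (Euclidean_space n) W" "x \<in> W" "i < n" "\<And>y. y \<in> W \<Longrightarrow> f y = g y"
    and "((\<lambda>t. f (x(i := t))) has_real_derivative D) (at (x i))"
  shows "((\<lambda>t. g (x(i := t))) has_real_derivative D) (at (x i))"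
proof (rule has_field_derivative_transform_within_open[OF assms(5)])
  have "x \<in> coord_space n" using assms(1,2) openin_subset by blast
  then show "open {t. x(i := t) \<in> W}" using open_slice assms by blast
qed (use assms in auto)

lemma diff_class_cong:
  assumes "openin (Euclidean_space n) W" "\<And>y. y \<in> W \<Longrightarrow> f y = g y" "diff_class r n W f"
  shows "diff_class r n W g"
proof (cases r)
  case 0
  then show ?thesis using assms continuous_on_cong by force
next
  case (Suc s)
  from assms(3) obtain f' where "continuous_on W f"
    "\<forall>i<n. diff_class s n W (f' i) \<and> (\<forall>x\<in>W. ((\<lambda>t. f (x(i := t))) has_real_derivative f' i x) (at (x i)))"
    unfolding Suc diff_class.simps by blast
  moreover from this have "continuous_on W g" using assms(2) continuous_on_cong by force
  moreover have "((\<lambda>t. g (x(i := t))) has_real_derivative f' i x) (at (x i))"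
    if "i < n" "x \<in> W" "((\<lambda>t. f (x(i := t))) has_real_derivative f' i x) (at (x i))" for i x
    using derivative_cong_slice[OF assms(1) that(2,1) assms(2) that(3)] .
  ultimately show ?thesis unfolding Suc diff_class.simps by blast
qed

lemma partial_deriv_open:
  assumes "openin (Euclidean_space n) W" "x \<in> W" "i < n"
    and "((\<lambda>t. f (x(i := t))) has_real_derivative D) (at (x i))"
  shows "partial_deriv W i f x = D"
proof -
  have "x \<in> coord_space n" using assms(1,2) openin_subset by blast
  then have o: "open {t. x(i := t) \<in> W}" using open_slice assms by blast
  have "at (x i) within {t. x(i := t) \<in> W} = at (x i)"
    using o assms(2) by (intro at_within_open) auto
  then show ?thesis unfolding partial_deriv_def
    using assms(4) by (simp add: has_real_derivative_iff_has_vector_derivative vector_derivative_at)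
qed

text \<open>A derivative of a \<open>C\<^sup>r\<close> function is unique and can be differentiated again, so the existential
  derivatives are the iterated \<^const>\<open>partial_deriv\<close>. The list of indices is taken apart at the end where
  differentiation starts.\<close>

lemma smooth_on_open_iff:
  "smooth_on_open n W f \<longleftrightarrow> openin (Euclidean_space n) W \<and> (\<forall>r. diff_class r n W f)"
proof
  assume L: "smooth_on_open n W f"
  then have W: "openin (Euclidean_space n) W" by (simp add: smooth_on_open_def)
  define P where "P g \<longleftrightarrow> (\<forall>is. set is \<subseteq> {..<n} \<longrightarrow>
        (let h = foldr (partial_deriv W) is g in
          continuous_on W h \<and>
          (\<forall>x\<in>W. \<forall>i<n. (\<lambda>t. h (x(i := t))) differentiable (at (x i) within {t. x(i := t) \<in> W}))))" for g
  have "diff_class r n W g" if "P g" for r g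
    using that
  proof (induction r arbitrary: g)
    case 0
    then show ?case unfolding P_def by (auto simp: Let_def dest!: spec[of _ "[]"])
  next
    case (Suc r)
    have c: "continuous_on W g" using Suc.prems unfolding P_def by (auto simp: Let_def dest!: spec[of _ "[]"])
    have "P (partial_deriv W i g)" if "i < n" for i
      unfolding P_def
    proof (intro allI impI)
      fix "is" assume "set is \<subseteq> {..<n}"
      then have "set (is @ [i]) \<subseteq> {..<n}" using that by auto
      from Suc.prems[unfolded P_def, rule_format, OF this]
      show "let h = foldr (partial_deriv W) is (partial_deriv W i g) in
          continuous_on W h \<and>
          (\<forall>x\<in>W. \<forall>i<n. (\<lambda>t. h (x(i := t))) differentiable (at (x i) within {t. x(i := t) \<in> W}))"
        by simp
    qed
    moreover have "((\<lambda>t. g (x(i := t))) has_real_derivative partial_deriv W i g x) (at (x i))"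
      if "i < n" "x \<in> W" for i x
    proof -
      have "x \<in> coord_space n" using W that(2) openin_subset by blast
      then have o: "open {t. x(i := t) \<in> W}" using open_slice W that by blast
      have a: "at (x i) within {t. x(i := t) \<in> W} = at (x i)"
        using o that(2) by (intro at_within_open) auto
      have "(\<lambda>t. g (x(i := t))) differentiable (at (x i) within {t. x(i := t) \<in> W})"
        using Suc.prems that unfolding P_def by (auto simp: Let_def dest!: spec[of _ "[]"])
      then show ?thesis unfolding a partial_deriv_def
        by (simp add: has_real_derivative_iff_has_vector_derivative vector_derivative_works)
    qed
    ultimately show ?case using c Suc.IH unfolding diff_class.simps
      by (intro conjI exI[where x="\<lambda>i. partial_deriv W i g"]) auto
  qed
  moreover have "P f" using L unfolding P_def smooth_on_open_def by blast
  ultimately show "openin (Euclidean_space n) W \<and> (\<forall>r. diff_class r n W f)" using W by blast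
next
  assume R: "openin (Euclidean_space n) W \<and> (\<forall>r. diff_class r n W f)"
  then have W: "openin (Euclidean_space n) W" by blast
  have step: "\<forall>r. diff_class r n W (partial_deriv W i g)" if "i < n" "\<forall>r. diff_class r n W g" for i g
  proof
    fix r
    from that(2) have "diff_class (Suc r) n W g" by blast
    then obtain g' where g': "\<forall>i<n. diff_class r n W (g' i) \<and>
        (\<forall>x\<in>W. ((\<lambda>t. g (x(i := t))) has_real_derivative g' i x) (at (x i)))" by auto
    have "partial_deriv W i g x = g' i x" if "x \<in> W" for x
      using partial_deriv_open[OF W that \<open>i < n\<close>] g' \<open>i < n\<close> that by blast
    then show "diff_class r n W (partial_deriv W i g)"
      using diff_class_cong[OF W, of "g' i"] g' \<open>i < n\<close> by force
  qed
  have all: "\<forall>r. diff_class r n W (foldr (partial_deriv W) is f)" if "set is \<subseteq> {..<n}" for "is"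
    using that
  proof (induction "is")
    case Nil
    then show ?case using R by simp
  next
    case (Cons i js)
    then show ?case using step[of i] by simp
  qed
  show "smooth_on_open n W f"
    unfolding smooth_on_open_def
  proof (intro conjI allI impI W)
    fix "is" assume "set is \<subseteq> {..<n}"
    note d = all[OF this]
    let ?g = "foldr (partial_deriv W) is f"
    have "diff_class (Suc 0) n W ?g" using d by blast
    then obtain g' where "continuous_on W ?g"  "\<forall>i<n. 
        (\<forall>x\<in>W. ((\<lambda>t. ?g (x(i := t))) has_real_derivative g' i x) (at (x i)))" by auto
    then show "let g = ?g in continuous_on W g \<and>
          (\<forall>x\<in>W. \<forall>i<n. (\<lambda>t. g (x(i := t))) differentiable (at (x i) within {t. x(i := t) \<in> W}))"
      unfolding Let_def
      by (meson DERIV_subset differentiableI has_field_derivative_imp_has_derivative subset_UNIV)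
  qed
qed

lemma diff_class_const: "diff_class r n W (\<lambda>_. c)"
proof (induction r arbitrary: c)
  case (Suc r)
  then show ?case by (auto intro!: exI[where x="\<lambda>_ _. 0"])
qed auto

lemma continuous_on_coord [continuous_intros]: "continuous_on S (\<lambda>x::nat \<Rightarrow> real. x j)"
  by (rule continuous_on_subset[OF continuous_on_product_coordinates]) auto

lemma diff_class_coord: "diff_class r n W (\<lambda>x. x j)"
proof (cases r)
  case (Suc s)
  have "((\<lambda>t. (x(i := t)) j) has_real_derivative (if i = j then 1 else 0)) (at (x i))" for x :: "nat \<Rightarrow> real" and i
    by (cases "i = j") auto
  then show ?thesis unfolding Suc diff_class.simps
    by (intro conjI continuous_intros exI[where x="\<lambda>i _. if i = j then 1 else 0"]) (simp add: diff_class_const)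
qed (auto intro: continuous_intros)

lemma diff_class_add:
  "diff_class r n W f \<Longrightarrow> diff_class r n W g \<Longrightarrow> diff_class r n W (\<lambda>x. f x + g x)"
proof (induction r arbitrary: f g)
  case (Suc r)
  from Suc.prems obtain f' g' where
    "continuous_on W f" "continuous_on W g"
    "\<forall>i<n. diff_class r n W (f' i) \<and> (\<forall>x\<in>W. ((\<lambda>t. f (x(i := t))) has_real_derivative f' i x) (at (x i)))"
    "\<forall>i<n. diff_class r n W (g' i) \<and> (\<forall>x\<in>W. ((\<lambda>t. g (x(i := t))) has_real_derivative g' i x) (at (x i)))"
    unfolding diff_class.simps by blast
  then show ?case unfolding diff_class.simps
    by (intro conjI continuous_on_add exI[where x="\<lambda>i x. f' i x + g' i x"]) (auto intro: Suc.IH DERIV_add)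
qed (auto intro: continuous_intros)

lemma diff_class_mult:
  "diff_class r n W f \<Longrightarrow> diff_class r n W g \<Longrightarrow> diff_class r n W (\<lambda>x. f x * g x)"
proof (induction r arbitrary: f g)
  case (Suc r)
  from Suc.prems obtain f' g' where *:
    "continuous_on W f" "continuous_on W g"
    "\<forall>i<n. diff_class r n W (f' i) \<and> (\<forall>x\<in>W. ((\<lambda>t. f (x(i := t))) has_real_derivative f' i x) (at (x i)))"
    "\<forall>i<n. diff_class r n W (g' i) \<and> (\<forall>x\<in>W. ((\<lambda>t. g (x(i := t))) has_real_derivative g' i x) (at (x i)))"
    unfolding diff_class.simps by blast
  have "diff_class r n W f" "diff_class r n W g" using Suc.prems diff_class_Suc_mono by auto
  with * have "diff_class r n W (\<lambda>x. f' i x * g x + g' i x * f x)" if "i < n" for i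
    using that by (intro diff_class_add Suc.IH) auto
  moreover have "((\<lambda>t. f (x(i := t)) * g (x(i := t))) has_real_derivative f' i x * g x + g' i x * f x) (at (x i))"
    if "i < n" "x \<in> W" for i x
    using DERIV_mult[of "\<lambda>t. f (x(i := t))" "f' i x" "x i" UNIV "\<lambda>t. g (x(i := t))" "g' i x"] * that
    by simp
  ultimately show ?case unfolding diff_class.simps using *
    by (intro conjI continuous_on_mult exI[where x="\<lambda>i x. f' i x * g x + g' i x * f x"]) auto
qed (auto intro: continuous_intros)

lemma diff_class_sum:
  "(\<And>j. j \<in> J \<Longrightarrow> diff_class r n W (f j)) \<Longrightarrow> diff_class r n W (\<lambda>x. \<Sum>j\<in>J. f j x)"
  by (induction J rule: infinite_finite_induct) (auto simp: diff_class_const diff_class_add)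

text \<open>\<open>L\<close> is a gradient of \<open>f\<close> at \<open>x\<close> relative to \<open>S\<close>. When \<open>S\<close> is thin, as a simplex in its
  barycentric coordinates is, \<open>L\<close> is determined only on the tangent directions of \<open>S\<close>.\<close>

definition has_grad ::
    "nat \<Rightarrow> (nat \<Rightarrow> real) set \<Rightarrow> ((nat \<Rightarrow> real) \<Rightarrow> real) \<Rightarrow> (nat \<Rightarrow> real) \<Rightarrow> (nat \<Rightarrow> real) \<Rightarrow> bool" where
  "has_grad n S f x L \<longleftrightarrow> (\<forall>e>0. \<exists>\<delta>>0. \<forall>y\<in>S. (\<forall>i<n. \<bar>y i - x i\<bar> < \<delta>) \<longrightarrow>
     \<bar>f y - f x - (\<Sum>i<n. L i * (y i - x i))\<bar> \<le> e * (\<Sum>i<n. \<bar>y i - x i\<bar>))"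

text \<open>The increment is split along the coordinate path from \<open>x\<close> to \<open>y\<close>; the mean value theorem
  on each leg turns it into a partial derivative near \<open>x\<close>.\<close>

lemma C1_has_grad:
  assumes W: "openin (Euclidean_space n) W" "x \<in> W"
    and c: "\<And>i. i < n \<Longrightarrow> continuous_on W (f' i)"
    and d: "\<And>i y. i < n \<Longrightarrow> y \<in> W \<Longrightarrow> ((\<lambda>t. f (y(i := t))) has_real_derivative f' i y) (at (y i))"
  shows "has_grad n W f x (\<lambda>i. f' i x)"
  unfolding has_grad_def
proof (intro allI impI)
  fix e :: real assume e: "e > 0"
  have xE: "x \<in> coord_space n" using W openin_subset by blast
  obtain T where T: "open T" "W = T \<inter> coord_space n" using W openin_coord_space by blast
  have "\<exists>\<delta>>0. \<forall>y\<in>coord_space n. (\<forall>j<n. \<bar>y j - x j\<bar> < \<delta>) \<longrightarrow> y \<in> W \<and> \<bar>f' i y - f' i x\<bar> < e" if "i < n" for i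
  proof -
    have "\<exists>A. open A \<and> A \<inter> W = f' i -` ball (f' i x) e \<inter> W"
      using c[OF that] open_ball unfolding continuous_on_open_invariant by blast
    then obtain A where A: "open A" "A \<inter> W = f' i -` ball (f' i x) e \<inter> W" by blast
    have "open (A \<inter> T)" "x \<in> A \<inter> T" using A T W e by auto
    from box_in_open[OF this xE] obtain \<delta> where "\<delta> > 0"
      "\<And>y. y \<in> coord_space n \<Longrightarrow> (\<And>i. i < n \<Longrightarrow> \<bar>y i - x i\<bar> < \<delta>) \<Longrightarrow> y \<in> A \<inter> T" by blast
    moreover have "y \<in> W \<and> \<bar>f' i y - f' i x\<bar> < e" if "y \<in> A \<inter> T" "y \<in> coord_space n" for y
    proof -
      have "y \<in> A \<inter> W" using that T by auto
      then have "y \<in> f' i -` ball (f' i x) e \<inter> W" using A(2) by simp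
      then show ?thesis by (auto simp: dist_real_def abs_minus_commute)
    qed
    ultimately show ?thesis by blast
  qed
  then obtain D where D: "\<And>i. i < n \<Longrightarrow> D i > 0"
    "\<And>i y. i < n \<Longrightarrow> y \<in> coord_space n \<Longrightarrow> (\<forall>j<n. \<bar>y j - x j\<bar> < D i) \<Longrightarrow> y \<in> W \<and> \<bar>f' i y - f' i x\<bar> < e"
    by metis
  define \<delta> where "\<delta> = Min (insert 1 (D ` {..<n}))"
  have "\<delta> > 0" unfolding \<delta>_def using D(1) by (subst Min_gr_iff) auto
  have \<delta>: "y \<in> W" "\<bar>f' i y - f' i x\<bar> < e"
    if "i < n" "y \<in> coord_space n" "\<forall>j<n. \<bar>y j - x j\<bar> < \<delta>" for i y
  proof -
    have "\<delta> \<le> D i" unfolding \<delta>_def using that by (intro Min_le) auto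
    then have "\<forall>j<n. \<bar>y j - x j\<bar> < D i" using that by force
    then show "y \<in> W" "\<bar>f' i y - f' i x\<bar> < e" using D(2)[OF that(1,2)] by auto
  qed
  have "\<bar>f y - f x - (\<Sum>i<n. f' i x * (y i - x i))\<bar> \<le> e * (\<Sum>i<n. \<bar>y i - x i\<bar>)"
    if y: "y \<in> W" "\<forall>i<n. \<bar>y i - x i\<bar> < \<delta>" for y
  proof -
    have yE: "y \<in> coord_space n" using W y openin_subset by blast
    define p where "p k = (\<lambda>i. if i < k then y i else x i)" for k
    have p0: "p 0 = x" and pn: "p n = y"
      using xE yE by (auto simp: p_def coord_space_iff fun_eq_iff)
    have tel: "f y - f x = (\<Sum>k<n. f (p (Suc k)) - f (p k))"
      using sum_lessThan_telescope[of "\<lambda>k. f (p k)" n] p0 pn by simp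
    have leg: "\<bar>f (p (Suc k)) - f (p k) - f' k x * (y k - x k)\<bar> \<le> e * \<bar>y k - x k\<bar>" if k: "k < n" for k
    proof -
      define g where "g t = f ((p k)(k := t))" for t
      have g1: "g (y k) = f (p (Suc k))" "g (x k) = f (p k)"
        unfolding g_def p_def by (rule arg_cong[of _ _ f], auto simp: fun_eq_iff)+
      have pE: "(p k)(k := t) \<in> coord_space n" for t
        using xE yE k by (auto simp: p_def coord_space_iff)
      have near: "\<forall>j<n. \<bar>((p k)(k := t)) j - x j\<bar> < \<delta>" if "\<bar>t - x k\<bar> < \<delta>" for t
        using y(2) that \<open>\<delta> > 0\<close> by (auto simp: p_def)
      have der: "(g has_real_derivative f' k ((p k)(k := t))) (at t)" if "\<bar>t - x k\<bar> < \<delta>" for t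
        using d[OF k \<delta>(1)[OF k pE near[OF that]]] unfolding g_def
        by (simp only: fun_upd_upd fun_upd_same)
      have est: "\<bar>f' k ((p k)(k := t)) - f' k x\<bar> \<le> e" if "\<bar>t - x k\<bar> < \<delta>" for t
        by (rule less_imp_le, rule \<delta>(2)[OF k pE near[OF that]])
      have "\<exists>z. \<bar>z - x k\<bar> < \<delta> \<and> g (y k) - g (x k) = (y k - x k) * f' k ((p k)(k := z))"
      proof (cases "y k" "x k" rule: linorder_cases)
        case less
        have "\<exists>z>y k. z < x k \<and> g (x k) - g (y k) = (x k - y k) * f' k ((p k)(k := z))"
          by (rule MVT2[OF less]) (use y(2) k in \<open>auto intro!: der\<close>)
        then obtain z where "z > y k" "z < x k" "g (x k) - g (y k) = (x k - y k) * f' k ((p k)(k := z))" by blast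
        then show ?thesis using y(2) k by (intro exI[where x=z]) (auto simp: algebra_simps)
      next
        case equal
        then show ?thesis using \<open>\<delta> > 0\<close> by (intro exI[where x="x k"]) auto
      next
        case greater
        have "\<exists>z>x k. z < y k \<and> g (y k) - g (x k) = (y k - x k) * f' k ((p k)(k := z))"
          by (rule MVT2[OF greater]) (use y(2) k in \<open>auto intro!: der\<close>)
        then obtain z where "z > x k" "z < y k" "g (y k) - g (x k) = (y k - x k) * f' k ((p k)(k := z))" by blast
        moreover have "\<bar>y k - x k\<bar> < \<delta>" using y(2) k by blast
        ultimately show ?thesis by (intro exI[where x=z]) auto
      qed
      then obtain z where z: "\<bar>z - x k\<bar> < \<delta>" "g (y k) - g (x k) = (y k - x k) * f' k ((p k)(k := z))" by blast
      then have "f (p (Suc k)) - f (p k) - f' k x * (y k - x k) = (f' k ((p k)(k := z)) - f' k x) * (y k - x k)"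
        unfolding g1 by (simp add: algebra_simps)
      also have "\<bar>\<dots>\<bar> \<le> e * \<bar>y k - x k\<bar>"
        unfolding abs_mult using est[OF z(1)] by (rule mult_right_mono) auto
      finally show ?thesis .
    qed
    have "f y - f x - (\<Sum>i<n. f' i x * (y i - x i)) = (\<Sum>k<n. f (p (Suc k)) - f (p k) - f' k x * (y k - x k))"
      unfolding tel by (simp add: sum_subtractf)
    also have "\<bar>\<dots>\<bar> \<le> (\<Sum>k<n. e * \<bar>y k - x k\<bar>)"
      by (rule order.trans[OF sum_abs]) (auto intro: sum_mono leg)
    finally show ?thesis by (simp add: sum_distrib_left)
  qed
  with \<open>\<delta> > 0\<close> show "\<exists>\<delta>>0. \<forall>y\<in>W. (\<forall>i<n. \<bar>y i - x i\<bar> < \<delta>) \<longrightarrow>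
     \<bar>f y - f x - (\<Sum>i<n. f' i x * (y i - x i))\<bar> \<le> e * (\<Sum>i<n. \<bar>y i - x i\<bar>)" by blast
qed

text \<open>The difference quotient of \<open>f \<circ> \<gamma>\<close> is the gradient applied to the quotients of the coordinates, plus a
  remainder that is small compared with their bounded sum. The curve has to stay in \<open>S\<close> only near \<open>t0\<close>,
  possibly on one side.\<close>

lemma has_grad_curve:
  assumes g: "has_grad n S f (\<gamma> t0) L"
    and ev: "\<forall>\<^sub>F t in at t0 within T. \<gamma> t \<in> S"
    and v: "\<And>i. i < n \<Longrightarrow> ((\<lambda>t. \<gamma> t i) has_real_derivative v i) (at t0 within T)"
  shows "((\<lambda>t. f (\<gamma> t)) has_real_derivative (\<Sum>i<n. L i * v i)) (at t0 within T)"
proof -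
  let ?F = "at t0 within T"
  define q where "q i t = (\<gamma> t i - \<gamma> t0 i) / (t - t0)" for i t
  have q: "(q i \<longlongrightarrow> v i) ?F" if "i < n" for i
    using v[OF that] unfolding has_field_derivative_iff q_def .
  define R where "R t = (f (\<gamma> t) - f (\<gamma> t0) - (\<Sum>i<n. L i * (\<gamma> t i - \<gamma> t0 i))) / (t - t0)" for t
  have R: "(R \<longlongrightarrow> 0) ?F"
  proof (rule tendstoI)
    fix e :: real assume "e > 0"
    define B where "B = (\<Sum>i<n. \<bar>v i\<bar>) + 1"
    have "B > 0" unfolding B_def by (smt (verit) sum_nonneg abs_ge_zero)
    have "((\<lambda>t. \<Sum>i<n. \<bar>q i t\<bar>) \<longlongrightarrow> (\<Sum>i<n. \<bar>v i\<bar>)) ?F"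
      by (intro tendsto_sum tendsto_rabs q) auto
    then have evB: "\<forall>\<^sub>F t in ?F. (\<Sum>i<n. \<bar>q i t\<bar>) < B"
      by (rule order_tendstoD) (simp add: B_def)
    define e' where "e' = e / (2 * B)"
    have "e' > 0" using \<open>e > 0\<close> \<open>B > 0\<close> by (simp add: e'_def)
    then obtain \<delta> where \<delta>: "\<delta> > 0" "\<And>y. y \<in> S \<Longrightarrow> (\<forall>i<n. \<bar>y i - \<gamma> t0 i\<bar> < \<delta>) \<Longrightarrow>
       \<bar>f y - f (\<gamma> t0) - (\<Sum>i<n. L i * (y i - \<gamma> t0 i))\<bar> \<le> e' * (\<Sum>i<n. \<bar>y i - \<gamma> t0 i\<bar>)"
      using g unfolding has_grad_def by meson
    have "\<forall>\<^sub>F t in ?F. \<forall>i\<in>{..<n}. \<bar>\<gamma> t i - \<gamma> t0 i\<bar> < \<delta>"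
    proof (rule eventually_ball_finite)
      show "\<forall>i\<in>{..<n}. \<forall>\<^sub>F t in ?F. \<bar>\<gamma> t i - \<gamma> t0 i\<bar> < \<delta>"
      proof
        fix i assume "i \<in> {..<n}"
        then have "((\<lambda>t. \<gamma> t i) \<longlongrightarrow> \<gamma> t0 i) ?F"
          using DERIV_continuous[OF v] by (simp add: continuous_within)
        from tendstoD[OF this \<delta>(1)] show "\<forall>\<^sub>F t in ?F. \<bar>\<gamma> t i - \<gamma> t0 i\<bar> < \<delta>"
          by (simp add: dist_real_def)
      qed
    qed auto
    moreover have "\<forall>\<^sub>F t in ?F. t \<noteq> t0" by (simp add: eventually_at_filter)
    ultimately show "\<forall>\<^sub>F t in ?F. dist (R t) 0 < e"
      using ev evB
    proof eventually_elim
      case (elim t)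
      have "\<bar>R t\<bar> = \<bar>f (\<gamma> t) - f (\<gamma> t0) - (\<Sum>i<n. L i * (\<gamma> t i - \<gamma> t0 i))\<bar> / \<bar>t - t0\<bar>"
        unfolding R_def by (rule abs_divide)
      also have "\<dots> \<le> e' * (\<Sum>i<n. \<bar>\<gamma> t i - \<gamma> t0 i\<bar>) / \<bar>t - t0\<bar>"
        using \<delta>(2)[OF elim(3)] elim(1) by (intro divide_right_mono) auto
      also have "\<dots> = e' * (\<Sum>i<n. \<bar>q i t\<bar>)"
        by (simp only: q_def abs_divide sum_divide_distrib times_divide_eq_right sum_distrib_left)
      also have "\<dots> \<le> e' * B" using elim(4) \<open>e' > 0\<close> by (intro mult_left_mono) auto
      also have "\<dots> = e / 2" using \<open>B > 0\<close> by (simp add: e'_def)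
      finally show ?case using \<open>e > 0\<close> by simp
    qed
  qed
  have "((\<lambda>t. R t + (\<Sum>i<n. L i * q i t)) \<longlongrightarrow> 0 + (\<Sum>i<n. L i * v i)) ?F"
    by (intro tendsto_add R tendsto_sum tendsto_mult tendsto_const q) auto
  moreover have "R t + (\<Sum>i<n. L i * q i t) = (f (\<gamma> t) - f (\<gamma> t0)) / (t - t0)" for t
    unfolding R_def q_def by (simp add: sum_divide_distrib diff_divide_distrib right_diff_distrib)
  ultimately show ?thesis unfolding has_field_derivative_iff by simp
qed

lemma has_grad_subset: "has_grad n S f x L \<Longrightarrow> T \<subseteq> S \<Longrightarrow> has_grad n T f x L"
  unfolding has_grad_def by (meson subsetD)

lemma has_grad_cong_on:
  assumes "has_grad n S g x L" "x \<in> T" "T \<subseteq> S" "\<And>y. y \<in> T \<Longrightarrow> g y = f y"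
  shows "has_grad n T f x L"
proof -
  have "has_grad n T g x L" using assms has_grad_subset by blast
  then show ?thesis unfolding has_grad_def using assms(2,4) by simp
qed


lemma has_grad_local:
  assumes "has_grad n (S \<inter> U) f x L" "openin (Euclidean_space n) U" "x \<in> U" "S \<subseteq> coord_space n"
  shows "has_grad n S f x L"
  unfolding has_grad_def
proof (intro allI impI)
  fix e :: real assume "e > 0"
  then obtain \<delta> where \<delta>: "\<delta> > 0" "\<forall>y\<in>S \<inter> U. (\<forall>i<n. \<bar>y i - x i\<bar> < \<delta>) \<longrightarrow>
     \<bar>f y - f x - (\<Sum>i<n. L i * (y i - x i))\<bar> \<le> e * (\<Sum>i<n. \<bar>y i - x i\<bar>)"
    using assms(1) unfolding has_grad_def by blast
  obtain T where T: "open T" "U = T \<inter> coord_space n" using assms openin_coord_space by blast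
  have "x \<in> T" "x \<in> coord_space n" using T assms by auto
  from box_in_open[OF T(1) this] obtain \<eta> where \<eta>: "\<eta> > 0"
     "\<And>y. y \<in> coord_space n \<Longrightarrow> (\<And>i. i < n \<Longrightarrow> \<bar>y i - x i\<bar> < \<eta>) \<Longrightarrow> y \<in> T" by blast
  show "\<exists>\<delta>>0. \<forall>y\<in>S. (\<forall>i<n. \<bar>y i - x i\<bar> < \<delta>) \<longrightarrow>
     \<bar>f y - f x - (\<Sum>i<n. L i * (y i - x i))\<bar> \<le> e * (\<Sum>i<n. \<bar>y i - x i\<bar>)"
  proof (intro exI[where x="min \<delta> \<eta>"] conjI ballI impI)
    fix y assume "y \<in> S" "\<forall>i<n. \<bar>y i - x i\<bar> < min \<delta> \<eta>"
    moreover from this have "y \<in> U" using \<eta>(2)[of y] T assms(4) by auto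
    ultimately show "\<bar>f y - f x - (\<Sum>i<n. L i * (y i - x i))\<bar> \<le> e * (\<Sum>i<n. \<bar>y i - x i\<bar>)"
      using \<delta>(2) by auto
  qed (use \<delta> \<eta> in auto)
qed

lemma continuous_on_tuple:
  fixes G :: "'a::topological_space \<Rightarrow> nat \<Rightarrow> real"
  assumes "\<And>j. j < m \<Longrightarrow> continuous_on W (\<lambda>x. G x j)" "G ` W \<subseteq> coord_space m"
  shows "continuous_on W G"
proof (rule continuous_on_coordinatewise_then_product)
  fix j
  show "continuous_on W (\<lambda>x. G x j)"
  proof (cases "j < m")
    case False
    then have "G x j = 0" if "x \<in> W" for x
      using assms(2) that by (auto simp: coord_space_iff)
    then show ?thesis by (simp cong: continuous_on_cong)
  qed (use assms in auto)
qed

text \<open>The partial derivatives of the composite are sums of products of a \<open>C\<^sup>r\<close> function composed with \<open>G\<close> and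
  of derivatives of \<open>G\<close>, so induction on \<open>r\<close> applies.\<close>

lemma diff_class_compose:
  assumes V: "openin (Euclidean_space m) V" and W: "openin (Euclidean_space n) W"
  shows "diff_class r m V f \<Longrightarrow> (\<And>j. j < m \<Longrightarrow> diff_class r n W (\<lambda>x. G x j)) \<Longrightarrow> G ` W \<subseteq> V \<Longrightarrow>
    diff_class r n W (\<lambda>x. f (G x))"
proof (induction r arbitrary: f)
  case 0
  have "continuous_on W G"
    using 0 V by (intro continuous_on_tuple[of m]) (auto dest: openin_subset)
  with 0 show ?case using continuous_on_compose2 by fastforce
next
  case (Suc r)
  have cG: "continuous_on W G"
    using Suc.prems V diff_class_continuous
    by (intro continuous_on_tuple[of m]) (blast dest: openin_subset)+
  obtain f' where f': "continuous_on V f" "\<And>j. j < m \<Longrightarrow> diff_class r m V (f' j)"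
    "\<And>j y. j < m \<Longrightarrow> y \<in> V \<Longrightarrow> ((\<lambda>t. f (y(j := t))) has_real_derivative f' j y) (at (y j))"
    using Suc.prems(1) unfolding diff_class.simps by blast
  have "\<forall>j. \<exists>g'. j < m \<longrightarrow> (\<forall>i<n. diff_class r n W (g' i) \<and>
        (\<forall>x\<in>W. ((\<lambda>t. G (x(i := t)) j) has_real_derivative g' i x) (at (x i))))"
    using Suc.prems(2) unfolding diff_class.simps by blast
  from choice[OF this] obtain G' where "\<forall>j. j < m \<longrightarrow> (\<forall>i<n. diff_class r n W (G' j i) \<and>
        (\<forall>x\<in>W. ((\<lambda>t. G (x(i := t)) j) has_real_derivative G' j i x) (at (x i))))"
    by blast
  then have G': "\<And>j i. j < m \<Longrightarrow> i < n \<Longrightarrow> diff_class r n W (G' j i)"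
    "\<And>j i x. j < m \<Longrightarrow> i < n \<Longrightarrow> x \<in> W \<Longrightarrow> ((\<lambda>t. G (x(i := t)) j) has_real_derivative G' j i x) (at (x i))"
    by blast+
  have "diff_class r n W (\<lambda>x. \<Sum>j<m. f' j (G x) * G' j i x)" if "i < n" for i
  proof (intro diff_class_sum diff_class_mult)
    fix j assume "j \<in> {..<m}"
    then have j: "j < m" by simp
    show "diff_class r n W (\<lambda>x. f' j (G x))"
      by (rule Suc.IH[OF f'(2)[OF j] diff_class_Suc_mono[OF Suc.prems(2)] Suc.prems(3)])
    show "diff_class r n W (\<lambda>x. G' j i x)" by (rule G'(1)[OF j that])
  qed
  moreover have "((\<lambda>t. f (G (x(i := t)))) has_real_derivative (\<Sum>j<m. f' j (G x) * G' j i x)) (at (x i))"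
    if i: "i < n" and x: "x \<in> W" for i x
  proof -
    have "has_grad m V f (G x) (\<lambda>j. f' j (G x))"
      using Suc.prems(3) x by (intro C1_has_grad[OF V _ diff_class_continuous[OF f'(2)] f'(3)]) auto
    moreover have "\<forall>\<^sub>F t in at (x i). G (x(i := t)) \<in> V"
    proof -
      have "x \<in> coord_space n" using W x openin_subset by blast
      then have "open {t. x(i := t) \<in> W}" using open_slice[OF W i] by blast
      then have "\<forall>\<^sub>F t in at (x i). t \<in> {t. x(i := t) \<in> W}"
        by (rule eventually_at_in_open') (use x in auto)
      then show ?thesis by eventually_elim (use Suc.prems(3) in auto)
    qed
    ultimately show ?thesis
      using has_grad_curve[of m V f "\<lambda>t. G (x(i := t))" "x i" "\<lambda>j. f' j (G x)" UNIV "\<lambda>j. G' j i x"] G'(2)[OF _ i x]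
      by simp
  qed
  moreover have "continuous_on W (\<lambda>x. f (G x))"
    by (rule continuous_on_compose2[OF f'(1) cG Suc.prems(3)])
  ultimately show ?case unfolding diff_class.simps
    by (intro conjI exI[where x="\<lambda>i x. \<Sum>j<m. f' j (G x) * G' j i x"]) auto
qed

section \<open>Smooth functions on arbitrary subsets\<close>

lemma smooth_on_open_subset:
  "smooth_on_open n W f \<Longrightarrow> openin (Euclidean_space n) V \<Longrightarrow> V \<subseteq> W \<Longrightarrow> smooth_on_open n V f"
  unfolding smooth_on_open_iff using diff_class_subset by blast

lemma smooth_onE:
  assumes "smooth_on n S f" "x \<in> S"
  obtains W g where "x \<in> W" "smooth_on_open n W g" "\<And>y. y \<in> W \<inter> S \<Longrightarrow> g y = f y"
  using assms unfolding smooth_on_def by blast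

lemma smooth_onI:
  assumes "S \<subseteq> coord_space n"
    and "\<And>x. x \<in> S \<Longrightarrow> \<exists>W g. x \<in> W \<and> smooth_on_open n W g \<and> (\<forall>y\<in>W \<inter> S. g y = f y)"
  shows "smooth_on n S f"
  using assms unfolding smooth_on_def by blast

lemma smooth_on_imp_subset: "smooth_on n S f \<Longrightarrow> S \<subseteq> coord_space n"
  by (simp add: smooth_on_def)

lemma smooth_on_subset: "smooth_on n S f \<Longrightarrow> T \<subseteq> S \<Longrightarrow> smooth_on n T f"
  unfolding smooth_on_def by (meson IntD1 IntD2 IntI subset_iff)

lemma smooth_on_cong: "smooth_on n S f \<Longrightarrow> (\<And>x. x \<in> S \<Longrightarrow> f x = g x) \<Longrightarrow> smooth_on n S g"
  unfolding smooth_on_def by (metis IntD2)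

lemma smooth_on_local:
  assumes "S \<subseteq> coord_space n"
    and "\<And>x. x \<in> S \<Longrightarrow> \<exists>U. openin (Euclidean_space n) U \<and> x \<in> U \<and> smooth_on n (S \<inter> U) f"
  shows "smooth_on n S f"
proof (rule smooth_onI[OF assms(1)])
  fix x assume "x \<in> S"
  then obtain U where U: "openin (Euclidean_space n) U" "x \<in> U" "smooth_on n (S \<inter> U) f" using assms(2) by blast
  obtain W g where W: "x \<in> W" "smooth_on_open n W g" "\<And>y. y \<in> W \<inter> (S \<inter> U) \<Longrightarrow> g y = f y"
    by (rule smooth_onE[OF U(3)]) (use \<open>x \<in> S\<close> U in auto)
  have "openin (Euclidean_space n) (W \<inter> U)" using W(2) U(1) by (simp add: smooth_on_open_iff openin_Int)
  then have "smooth_on_open n (W \<inter> U) g" using W(2) smooth_on_open_subset by blast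
  then show "\<exists>W g. x \<in> W \<and> smooth_on_open n W g \<and> (\<forall>y\<in>W \<inter> S. g y = f y)"
    using W U by (intro exI[where x="W \<inter> U"] exI[where x=g]) auto
qed

lemma smooth_on_const: "S \<subseteq> coord_space n \<Longrightarrow> smooth_on n S (\<lambda>_. c)"
  by (rule smooth_onI)
    (auto simp: smooth_on_open_iff intro!: exI[where x="coord_space n"] exI[where x="\<lambda>_. c"] diff_class_const)

lemma smooth_on_coord: "S \<subseteq> coord_space n \<Longrightarrow> smooth_on n S (\<lambda>x. x j)"
  by (rule smooth_onI)
    (auto simp: smooth_on_open_iff intro!: exI[where x="coord_space n"] exI[where x="\<lambda>x. x j"] diff_class_coord)

lemma smooth_on_binop:
  assumes op: "\<And>W F G. (\<forall>r. diff_class r n W F) \<Longrightarrow> (\<forall>r. diff_class r n W G) \<Longrightarrow>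
      (\<forall>r. diff_class r n W (\<lambda>x. h (F x) (G x)))"
    and f: "smooth_on n S f" and g: "smooth_on n S g"
  shows "smooth_on n S (\<lambda>x. h (f x) (g x))"
proof (rule smooth_onI)
  fix x assume x: "x \<in> S"
  obtain W F where W: "x \<in> W" "smooth_on_open n W F" "\<And>y. y \<in> W \<inter> S \<Longrightarrow> F y = f y"
    by (fact smooth_onE[OF f x])
  obtain V G where V: "x \<in> V" "smooth_on_open n V G" "\<And>y. y \<in> V \<inter> S \<Longrightarrow> G y = g y"
    by (fact smooth_onE[OF g x])
  have o: "openin (Euclidean_space n) (W \<inter> V)" using W(2) V(2) by (simp add: smooth_on_open_iff openin_Int)
  have "smooth_on_open n (W \<inter> V) F" "smooth_on_open n (W \<inter> V) G"
    using W(2) V(2) o smooth_on_open_subset by blast+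
  then have "smooth_on_open n (W \<inter> V) (\<lambda>x. h (F x) (G x))"
    using op unfolding smooth_on_open_iff by blast
  moreover have "\<forall>y\<in>(W \<inter> V) \<inter> S. h (F y) (G y) = h (f y) (g y)" using W V by auto
  ultimately show "\<exists>W ga. x \<in> W \<and> smooth_on_open n W ga \<and> (\<forall>y\<in>W \<inter> S. ga y = h (f y) (g y))"
    using W(1) V(1) by blast
qed (use smooth_on_imp_subset[OF f] in blast)

lemma smooth_on_add: "smooth_on n S f \<Longrightarrow> smooth_on n S g \<Longrightarrow> smooth_on n S (\<lambda>x. f x + g x)"
  by (rule smooth_on_binop) (auto intro: diff_class_add)

lemma smooth_on_mult: "smooth_on n S f \<Longrightarrow> smooth_on n S g \<Longrightarrow> smooth_on n S (\<lambda>x. f x * g x)"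
  by (rule smooth_on_binop) (auto intro: diff_class_mult)

lemma smooth_on_sum:
  assumes "S \<subseteq> coord_space n" "\<And>j. j \<in> J \<Longrightarrow> smooth_on n S (f j)"
  shows "smooth_on n S (\<lambda>x. \<Sum>j\<in>J. f j x)"
  using assms(2)
  by (induction J rule: infinite_finite_induct) (auto simp: assms(1) smooth_on_const smooth_on_add)

lemma smooth_on_prod:
  assumes "S \<subseteq> coord_space n" "\<And>j. j \<in> J \<Longrightarrow> smooth_on n S (f j)"
  shows "smooth_on n S (\<lambda>x. \<Prod>j\<in>J. f j x)"
  using assms(2)
  by (induction J rule: infinite_finite_induct) (auto simp: assms(1) smooth_on_const smooth_on_mult)

text \<open>The extension \<open>H\<close> of \<open>G\<close> may leave the domain of the extension of \<open>f\<close>, even close to \<open>S\<close>; this is why its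
  domain is cut down to a preimage.\<close>

lemma smooth_on_compose:
  assumes f: "smooth_on m T f" and G: "\<And>j. j < m \<Longrightarrow> smooth_on n S (\<lambda>x. G x j)"
    and GT: "G ` S \<subseteq> T" and S: "S \<subseteq> coord_space n"
  shows "smooth_on n S (\<lambda>x. f (G x))"
proof (rule smooth_onI[OF S])
  fix x assume x: "x \<in> S"
  then have "G x \<in> T" using GT by auto
  obtain V F where
    V: "G x \<in> V" "smooth_on_open m V F" "\<And>y. y \<in> V \<inter> T \<Longrightarrow> F y = f y"
    by (fact smooth_onE[OF f \<open>G x \<in> T\<close>])
  have "\<forall>j. \<exists>W g. j < m \<longrightarrow> x \<in> W \<and> smooth_on_open n W g \<and> (\<forall>y\<in>W \<inter> S. g y = G y j)"
    using G x unfolding smooth_on_def by blast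
  from choice[OF this] obtain W where "\<forall>j. \<exists>g. j < m \<longrightarrow> x \<in> W j \<and> smooth_on_open n (W j) g \<and> (\<forall>y\<in>W j \<inter> S. g y = G y j)"
    by blast
  from choice[OF this] obtain g where
    "\<forall>j. j < m \<longrightarrow> x \<in> W j \<and> smooth_on_open n (W j) (g j) \<and> (\<forall>y\<in>W j \<inter> S. g j y = G y j)" by blast
  then have W: "\<And>j. j < m \<Longrightarrow> x \<in> W j" "\<And>j. j < m \<Longrightarrow> smooth_on_open n (W j) (g j)"
    "\<And>j y. j < m \<Longrightarrow> y \<in> W j \<Longrightarrow> y \<in> S \<Longrightarrow> g j y = G y j" by auto
  define U where "U = coord_space n \<inter> (\<Inter>j\<in>{..<m}. W j)"
  have U: "openin (Euclidean_space n) U"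
  proof (cases "m = 0")
    case False
    have "openin (Euclidean_space n) (\<Inter>j\<in>{..<m}. W j)"
      using False W(2) by (intro openin_INT2) (auto simp: smooth_on_open_iff)
    then show ?thesis unfolding U_def by blast
  qed (simp add: U_def)
  have xU: "x \<in> U" using W(1) x S by (auto simp: U_def)
  define H where "H y = (\<lambda>j. if j < m then g j y else 0)" for y
  have gU: "diff_class r n U (\<lambda>y. H y j)" for r j
  proof (cases "j < m")
    case True
    have "smooth_on_open n U (g j)"
      by (rule smooth_on_open_subset[OF W(2)[OF True] U]) (use True in \<open>auto simp: U_def\<close>)
    with True show ?thesis by (simp add: smooth_on_open_iff H_def)
  qed (simp add: H_def diff_class_const)
  have cH: "continuous_on U H"
    by (rule continuous_on_coordinatewise_then_product) (use gU diff_class_continuous in blast)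
  have HG: "H y = G y" if "y \<in> U" "y \<in> S" for y
  proof -
    have "G y \<in> coord_space m" using that GT smooth_on_imp_subset[OF f] by blast
    then show ?thesis using that W(3) by (auto simp: H_def U_def coord_space_iff fun_eq_iff)
  qed
  obtain A where A: "open A" "V = A \<inter> coord_space m"
    using V(2) unfolding smooth_on_open_iff openin_coord_space by blast
  obtain B where B: "open B" "B \<inter> U = H -` A \<inter> U"
    using cH A(1) unfolding continuous_on_open_invariant by blast
  define U' where "U' = U \<inter> B"
  have U': "openin (Euclidean_space n) U'"
  proof -
    obtain C where C: "open C" "U = C \<inter> coord_space n" using U openin_coord_space by blast
    then show ?thesis unfolding U'_def openin_coord_space using B(1)
      by (intro exI[where x="C \<inter> B"]) auto
  qed
  have HV: "H ` U' \<subseteq> V"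
    unfolding U'_def A(2) using B(2) by (auto simp: H_def coord_space_iff)
  have "smooth_on_open n U' (\<lambda>y. F (H y))"
    unfolding smooth_on_open_iff
  proof (intro conjI U' allI)
    fix r
    show "diff_class r n U' (\<lambda>y. F (H y))"
    proof (rule diff_class_compose[OF _ U' _ _ HV])
      show "openin (Euclidean_space m) V" "diff_class r m V F" using V(2) by (auto simp: smooth_on_open_iff)
      show "diff_class r n U' (\<lambda>y. H y j)" for j
        by (rule diff_class_subset[OF gU]) (simp add: U'_def)
    qed
  qed
  moreover have "x \<in> U'"
  proof -
    have "x \<in> H -` A \<inter> U" using HG[OF xU x] V(1) A(2) xU by auto
    then show ?thesis using B(2) by (auto simp: U'_def)
  qed
  moreover have "F (H y) = f (G y)" if "y \<in> U' \<inter> S" for y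
  proof -
    have "H y = G y" using that HG by (auto simp: U'_def)
    moreover have "H y \<in> V" using that HV by auto
    moreover have "G y \<in> T" using that GT by auto
    ultimately show ?thesis using V(3) by auto
  qed
  ultimately show "\<exists>W g. x \<in> W \<and> smooth_on_open n W g \<and> (\<forall>y\<in>W \<inter> S. g y = f (G y))" by blast
qed

lemma smooth_on_continuous:
  assumes "smooth_on n S f"
  shows "continuous_on S f"
  unfolding continuous_on_eq_continuous_within
proof
  fix x assume x: "x \<in> S"
  obtain W F where W: "x \<in> W" "smooth_on_open n W F" "\<And>y. y \<in> W \<inter> S \<Longrightarrow> F y = f y"
    by (fact smooth_onE[OF assms x])
  obtain A where A: "open A" "W = A \<inter> coord_space n"
    using W(2) unfolding smooth_on_open_iff openin_coord_space by blast
  have SE: "S \<subseteq> coord_space n" using assms smooth_on_imp_subset by blast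
  have "continuous_on W F" using W(2) diff_class_continuous unfolding smooth_on_open_iff by blast
  then have "continuous_on (A \<inter> S) f"
    using continuous_on_subset[of W F "A \<inter> S"] W(3) A(2) SE
    by (subst continuous_on_cong[OF refl, of _ _ F]) auto
  then have "continuous (at x within A \<inter> S) f"
    using x W(1) A(2) by (auto simp: continuous_on_eq_continuous_within)
  then show "continuous (at x within S) f" (is ?thesis)
  proof -
    have "at x within A \<inter> S = at x within S"
      by (rule at_within_nhd[of x A]) (use A W(1) in auto)
    then show "continuous (at x within A \<inter> S) f \<Longrightarrow> ?thesis" by (simp add: continuous_within)
  qed
qed

text \<open>The gradient of a local smooth extension is again smooth, and it is a gradient relative to \<open>S\<close>.\<close>

lemma smooth_on_gradient:
  assumes f: "smooth_on n S f" and x: "x \<in> S"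
  obtains U L where "openin (Euclidean_space n) U" "x \<in> U"
    "\<And>i. i < n \<Longrightarrow> smooth_on n (S \<inter> U) (\<lambda>y. L y i)"
    "\<And>y. y \<in> S \<inter> U \<Longrightarrow> has_grad n S f y (L y)"
proof -
  obtain W F where W: "x \<in> W" "smooth_on_open n W F" "\<And>y. y \<in> W \<inter> S \<Longrightarrow> F y = f y"
    by (fact smooth_onE[OF f x])
  have SE: "S \<subseteq> coord_space n" using f smooth_on_imp_subset by blast
  have o: "openin (Euclidean_space n) W" and d: "\<And>r. diff_class r n W F" using W(2) unfolding smooth_on_open_iff by auto
  define L where "L y i = partial_deriv W i F y" for y i
  have der: "((\<lambda>t. F (y(i := t))) has_real_derivative L y i) (at (y i))" if yw: "y \<in> W" "i < n" for y i
  proof -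
    have "diff_class (Suc 0) n W F" using d by blast
    then obtain D where "((\<lambda>t. F (y(i := t))) has_real_derivative D) (at (y i))"
      unfolding diff_class.simps using yw by blast
    moreover from partial_deriv_open[OF o yw this] have "L y i = D" by (simp add: L_def)
    ultimately show ?thesis by simp
  qed
  have dL: "diff_class r n W (\<lambda>y. L y i)" if "i < n" for r i
  proof -
    have "diff_class (Suc r) n W F" using d by blast
    then obtain F' where F': "\<forall>i<n. diff_class r n W (F' i) \<and>
        (\<forall>x\<in>W. ((\<lambda>t. F (x(i := t))) has_real_derivative F' i x) (at (x i)))" by auto
    have "F' i y = L y i" if "y \<in> W" for y
      unfolding L_def by (rule partial_deriv_open[OF o that \<open>i < n\<close>, symmetric]) (use F' \<open>i < n\<close> that in blast)
    then show ?thesis using diff_class_cong[OF o, of "F' i" "\<lambda>y. L y i" r] F' \<open>i < n\<close> by blast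
  qed
  show ?thesis
  proof (rule that[OF o W(1)])
    fix i assume "i < n"
    then have "smooth_on_open n W (\<lambda>y. L y i)" using o dL by (simp add: smooth_on_open_iff)
    then show "smooth_on n (S \<inter> W) (\<lambda>y. L y i)"
      using SE by (intro smooth_onI) auto
  next
    fix y assume y: "y \<in> S \<inter> W"
    have "has_grad n W F y (L y)"
      using C1_has_grad[OF o, of y "\<lambda>i z. L z i" F] y dL diff_class_continuous der by blast
    then have "has_grad n (S \<inter> W) f y (L y)"
      by (rule has_grad_cong_on) (use y W(3) in auto)
    then show "has_grad n S f y (L y)"
      by (rule has_grad_local) (use o y SE in auto)
  qed
qed

lemma smooth_on_has_grad:
  assumes "smooth_on n S f" "x \<in> S"
  obtains L where "has_grad n S f x L"
  using smooth_on_gradient[OF assms] assms(2) by (metis IntI)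

section \<open>Relatively open subsets of the half-space\<close>

definition half_open :: "nat \<Rightarrow> (nat \<Rightarrow> real) set \<Rightarrow> bool" where
  "half_open n S \<longleftrightarrow> openin (subtopology (Euclidean_space n) (half_space n)) S"

lemma half_open_iff: "half_open n S \<longleftrightarrow> (\<exists>T. open T \<and> S = T \<inter> half_space n)"
  unfolding half_open_def openin_subtopology openin_coord_space half_space_def by blast

lemma half_open_subset: "half_open n S \<Longrightarrow> S \<subseteq> coord_space n"
  by (auto simp: half_open_iff half_space_def)

text \<open>At a boundary point of the half-space one can still move into the half-space along every
  coordinate line, which is what makes the one-sided partial derivatives well defined.\<close>

lemma half_open_slice_nontrivial:
  assumes "half_open n S" "x \<in> S" "j < n"
  shows "at (x j) within {t. x(j := t) \<in> S} \<noteq> bot"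
proof -
  obtain T where T: "open T" "S = T \<inter> half_space n" using assms half_open_iff by blast
  have xE: "x \<in> T" "x \<in> coord_space n" using assms T by (auto simp: half_space_def)
  from box_in_open[OF T(1) this] obtain \<delta> where \<delta>: "\<delta> > 0"
     "\<And>y. y \<in> coord_space n \<Longrightarrow> (\<And>i. i < n \<Longrightarrow> \<bar>y i - x i\<bar> < \<delta>) \<Longrightarrow> y \<in> T" by blast
  have sub: "{x j<..<x j + \<delta>} \<subseteq> {t. x(j := t) \<in> S}"
  proof
    fix t assume t: "t \<in> {x j<..<x j + \<delta>}"
    then have "x(j := t) \<in> T"
      using \<delta> xE assms(3) by (intro \<delta>(2) fun_upd_coord_space) auto
    moreover have "x(j := t) \<in> half_space n"
      using t xE(2) assms T fun_upd_coord_space[OF xE(2) assms(3)] by (auto simp: half_space_def)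
    ultimately show "t \<in> {t. x(j := t) \<in> S}" using T by auto
  qed
  have "x j islimpt {x j<..<x j + \<delta>}"
    using \<delta>(1) islimpt_greaterThanLessThan1[of "x j" "x j + \<delta>"] by simp
  then have "x j islimpt {t. x(j := t) \<in> S}" using sub islimpt_subset by blast
  then show ?thesis by (simp add: trivial_limit_within)
qed

lemma slice_derivative:
  assumes "has_grad n S f x L" "j < n"
  shows "((\<lambda>t. f (x(j := t))) has_real_derivative L j) (at (x j) within {t. x(j := t) \<in> S})"
proof -
  have "((\<lambda>t. f (x(j := t))) has_real_derivative (\<Sum>i<n. L i * (if i = j then 1 else 0)))
    (at (x j) within {t. x(j := t) \<in> S})"
  proof (rule has_grad_curve[where \<gamma>="\<lambda>t. x(j := t)" and S=S])
    show "has_grad n S f (x(j := x j)) L" using assms(1) by simp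
    show "\<forall>\<^sub>F t in at (x j) within {t. x(j := t) \<in> S}. x(j := t) \<in> S"
      by (simp add: eventually_at_filter)
    show "((\<lambda>t. (x(j := t)) i) has_real_derivative (if i = j then 1 else 0)) (at (x j) within {t. x(j := t) \<in> S})" for i
      by (cases "i = j") auto
  qed
  also have "(\<Sum>i<n. L i * (if i = j then 1 else 0)) = L j" using assms(2) by (simp add: if_distrib cong: if_cong)
  finally show ?thesis .
qed

lemma partial_deriv_grad:
  assumes "half_open n S" "x \<in> S" "j < n" "has_grad n S f x L"
  shows "partial_deriv S j f x = L j"
  unfolding partial_deriv_def
  by (rule vector_derivative_within[OF half_open_slice_nontrivial[OF assms(1-3)]])
     (use slice_derivative[OF assms(4,3)] in \<open>simp add: has_real_derivative_iff_has_vector_derivative\<close>)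

lemma has_grad_cong_grad:
  "has_grad n S f x L \<Longrightarrow> (\<And>i. i < n \<Longrightarrow> L i = L' i) \<Longrightarrow> has_grad n S f x L'"
  unfolding has_grad_def by (simp cong: sum.cong_simp)

lemma has_grad_partial_deriv:
  assumes "half_open n S" "x \<in> S" "smooth_on n S f"
  shows "has_grad n S f x (\<lambda>j. partial_deriv S j f x)"
proof -
  obtain L where "has_grad n S f x L" using smooth_on_has_grad assms by blast
  then show ?thesis by (rule has_grad_cong_grad) (simp add: partial_deriv_grad[OF assms(1,2) _ \<open>has_grad n S f x L\<close>])
qed

lemma smooth_on_partial_deriv:
  assumes "half_open n S" "smooth_on n S f" "j < n"
  shows "smooth_on n S (partial_deriv S j f)"
proof (rule smooth_on_local[OF half_open_subset[OF assms(1)]])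
  fix x assume "x \<in> S"
  from smooth_on_gradient[OF assms(2) this] obtain U L where U: "openin (Euclidean_space n) U" "x \<in> U"
    "\<And>i. i < n \<Longrightarrow> smooth_on n (S \<inter> U) (\<lambda>y. L y i)"
    "\<And>y. y \<in> S \<inter> U \<Longrightarrow> has_grad n S f y (L y)" by blast
  have "smooth_on n (S \<inter> U) (partial_deriv S j f)"
    by (rule smooth_on_cong[OF U(3)[OF assms(3)]])
       (use partial_deriv_grad[OF assms(1) _ assms(3) U(4)] in auto)
  with U show "\<exists>U. openin (Euclidean_space n) U \<and> x \<in> U \<and> smooth_on n (S \<inter> U) (partial_deriv S j f)" by blast
qed

section \<open>Charts and the tangent map\<close>

abbreviation chart_inv :: "'a chart \<Rightarrow> (nat \<Rightarrow> real) \<Rightarrow> 'a" where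
  "chart_inv c \<equiv> inv_into (fst c) (snd c)"

lemma is_chart_atlas:
  "compact_smooth_manifold X \<Longrightarrow> c \<in> matlas X \<Longrightarrow> is_chart (mtop X) (mdim X) c"
  by (simp add: compact_smooth_manifold_def)

lemma chart_open:
  "compact_smooth_manifold X \<Longrightarrow> c \<in> matlas X \<Longrightarrow> openin (mtop X) (fst c)"
  using is_chart_atlas by (fastforce simp: is_chart_def)

lemma chart_homeomorphic:
  assumes "compact_smooth_manifold X" "c \<in> matlas X"
  shows "homeomorphic_map (subtopology (mtop X) (fst c))
    (subtopology (Euclidean_space (mdim X)) (snd c ` fst c)) (snd c)"
  using is_chart_atlas[OF assms] by (auto simp: is_chart_def case_prod_beta)

lemma chart_image_half_open:
  assumes "compact_smooth_manifold X" "c \<in> matlas X"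
  shows "half_open (mdim X) (snd c ` fst c)"
  using is_chart_atlas[OF assms] by (auto simp: is_chart_def case_prod_beta half_open_def)

lemma chart_in_coord_space:
  "compact_smooth_manifold X \<Longrightarrow> c \<in> matlas X \<Longrightarrow> p \<in> fst c \<Longrightarrow> snd c p \<in> coord_space (mdim X)"
  using half_open_subset[OF chart_image_half_open] by blast

lemma chart_inj:
  assumes "compact_smooth_manifold X" "c \<in> matlas X"
  shows "inj_on (snd c) (fst c)"
proof -
  have "topspace (subtopology (mtop X) (fst c)) = fst c"
    using openin_subset[OF chart_open[OF assms]] by auto
  then show ?thesis
    using chart_homeomorphic[OF assms] by (metis homeomorphic_imp_injective_map)
qed

lemma chart_inv_left [simp]:
  "compact_smooth_manifold X \<Longrightarrow> c \<in> matlas X \<Longrightarrow> p \<in> fst c \<Longrightarrow> chart_inv c (snd c p) = p"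
  by (simp add: chart_inj)

lemma chart_cover:
  "compact_smooth_manifold X \<Longrightarrow> p \<in> topspace (mtop X) \<Longrightarrow> \<exists>c. c \<in> matlas X \<and> p \<in> fst c"
  unfolding compact_smooth_manifold_def by auto

lemma chart_open_image:
  assumes X: "compact_smooth_manifold X" "c \<in> matlas X" and V: "openin (mtop X) V" "V \<subseteq> fst c"
  shows "half_open (mdim X) (snd c ` V)"
proof -
  let ?E = "Euclidean_space (mdim X)"
  have "openin (subtopology (mtop X) (fst c)) V"
    using V chart_open[OF X] by (simp add: openin_open_subtopology)
  then have "openin (subtopology ?E (snd c ` fst c)) (snd c ` V)"
    using homeomorphic_imp_open_map[OF chart_homeomorphic[OF X]] by (simp add: open_map_def)
  then obtain W where "openin ?E W" "snd c ` V = W \<inter> snd c ` fst c"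
    by (auto simp: openin_subtopology)
  moreover obtain T where "open T" "snd c ` fst c = T \<inter> half_space (mdim X)"
    using chart_image_half_open[OF X] half_open_iff by blast
  moreover from \<open>openin ?E W\<close> obtain S where "open S" "W = S \<inter> coord_space (mdim X)"
    using openin_coord_space by blast
  ultimately have "open (S \<inter> T)" "snd c ` V = (S \<inter> T) \<inter> half_space (mdim X)"
    by (auto simp: half_space_def)
  then show ?thesis unfolding half_open_iff by blast
qed

lemma smooth_map_ident:
  assumes "compact_smooth_manifold X"
  shows "smooth_map X X (\<lambda>p. p)"
proof -
  have "{p \<in> U. p \<in> V} = U \<inter> V" for U V :: "'a set" by auto
  then show ?thesis using assms
    unfolding smooth_map_def compact_smooth_manifold_def transition_def by simp
qed

abbreviation rep_domain :: "('a \<Rightarrow> 'b) \<Rightarrow> 'a chart \<Rightarrow> 'b chart \<Rightarrow> (nat \<Rightarrow> real) set" where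
  "rep_domain f c d \<equiv> snd c ` {p \<in> fst c. f p \<in> fst d}"

abbreviation local_rep :: "('a \<Rightarrow> 'b) \<Rightarrow> 'a chart \<Rightarrow> 'b chart \<Rightarrow> (nat \<Rightarrow> real) \<Rightarrow> nat \<Rightarrow> real" where
  "local_rep f c d x \<equiv> snd d (f (chart_inv c x))"

definition tangent_map ::
    "'a smooth_manifold \<Rightarrow> ('a \<Rightarrow> 'b) \<Rightarrow> 'a chart \<Rightarrow> 'b chart \<Rightarrow> 'a \<Rightarrow> (nat \<Rightarrow> real) \<Rightarrow> nat \<Rightarrow> real" where
  "tangent_map X f c d p v = (\<lambda>i. \<Sum>j<mdim X.
     v j * partial_deriv (rep_domain f c d) j (\<lambda>x. local_rep f c d x i) (snd c p))"

lemma tangent_change_eq: "tangent_change X c d p = tangent_map X (\<lambda>p. p) c d p"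
proof -
  have "{p \<in> fst c. p \<in> fst d} = fst c \<inter> fst d" by auto
  then show ?thesis unfolding tangent_change_def tangent_map_def transition_def by simp
qed

lemma rep_domain_half_open:
  assumes X: "compact_smooth_manifold X" "c \<in> matlas X" and Y: "compact_smooth_manifold Y" "d \<in> matlas Y"
    and f: "continuous_map (mtop X) (mtop Y) f"
  shows "half_open (mdim X) (rep_domain f c d)"
proof (rule chart_open_image[OF X])
  have "{p \<in> fst c. f p \<in> fst d} = fst c \<inter> {p \<in> topspace (mtop X). f p \<in> fst d}"
    using openin_subset[OF chart_open[OF X]] by auto
  then show "openin (mtop X) {p \<in> fst c. f p \<in> fst d}"
    using chart_open[OF X] openin_continuous_map_preimage[OF f chart_open[OF Y]] by (simp add: openin_Int)
qed auto

lemma local_rep_coord_zero: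
  assumes X: "compact_smooth_manifold X" "c \<in> matlas X" and Y: "compact_smooth_manifold Y" "d \<in> matlas Y"
    and "x \<in> rep_domain f c d" "\<not> i < mdim Y"
  shows "local_rep f c d x i = 0"
  using assms chart_in_coord_space[OF Y] by (auto simp: coord_space_iff)

lemma local_rep_smooth:
  assumes X: "compact_smooth_manifold X" "c \<in> matlas X" and Y: "compact_smooth_manifold Y" "d \<in> matlas Y"
    and f: "smooth_map X Y f"
  shows "smooth_on (mdim X) (rep_domain f c d) (\<lambda>x. local_rep f c d x i)"
proof (cases "i < mdim Y")
  case True
  then show ?thesis using f X Y by (simp add: smooth_map_def)
next
  case False
  have "rep_domain f c d \<subseteq> coord_space (mdim X)" using chart_in_coord_space[OF X] by auto
  then show ?thesis
    by (rule smooth_on_cong[OF smooth_on_const[where c=0]])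
       (use local_rep_coord_zero[OF X Y _ False, of _ f] in auto)
qed

lemma local_rep_has_grad:
  assumes X: "compact_smooth_manifold X" "c \<in> matlas X" and Y: "compact_smooth_manifold Y" "d \<in> matlas Y"
    and f: "smooth_map X Y f" and p: "p \<in> fst c" "f p \<in> fst d"
  shows "has_grad (mdim X) (rep_domain f c d) (\<lambda>x. local_rep f c d x i) (snd c p)
    (\<lambda>j. partial_deriv (rep_domain f c d) j (\<lambda>x. local_rep f c d x i) (snd c p))"
  using f p
  by (intro has_grad_partial_deriv rep_domain_half_open[OF X Y] local_rep_smooth[OF X Y f])
     (auto simp: smooth_map_def)

text \<open>The chain rule and the behaviour of gradients on a simplex are both obtained by moving along
  curves and comparing velocities.\<close>

lemma tangent_map_curve:
  assumes X: "compact_smooth_manifold X" "c \<in> matlas X" and Y: "compact_smooth_manifold Y" "d \<in> matlas Y"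
    and f: "smooth_map X Y f"
    and p: "\<gamma> t0 \<in> fst c" "f (\<gamma> t0) \<in> fst d"
    and ev: "\<forall>\<^sub>F t in at t0 within T. \<gamma> t \<in> fst c \<and> f (\<gamma> t) \<in> fst d"
    and v: "\<And>j. j < mdim X \<Longrightarrow> ((\<lambda>t. snd c (\<gamma> t) j) has_real_derivative v j) (at t0 within T)"
  shows "((\<lambda>t. snd d (f (\<gamma> t)) i) has_real_derivative tangent_map X f c d (\<gamma> t0) v i) (at t0 within T)"
proof -
  let ?P = "\<lambda>j. partial_deriv (rep_domain f c d) j (\<lambda>x. local_rep f c d x i) (snd c (\<gamma> t0))"
  have "((\<lambda>t. local_rep f c d (snd c (\<gamma> t)) i) has_real_derivative (\<Sum>j<mdim X. ?P j * v j)) (at t0 within T)"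
  proof (rule has_grad_curve[where \<gamma>="\<lambda>t. snd c (\<gamma> t)" and f="\<lambda>x. local_rep f c d x i"])
    show "has_grad (mdim X) (rep_domain f c d) (\<lambda>x. local_rep f c d x i) (snd c (\<gamma> t0)) ?P"
      by (rule local_rep_has_grad[OF X Y f p])
    show "\<forall>\<^sub>F t in at t0 within T. snd c (\<gamma> t) \<in> rep_domain f c d"
      using ev by eventually_elim auto
  qed (use v in auto)
  also have "(\<Sum>j<mdim X. ?P j * v j) = tangent_map X f c d (\<gamma> t0) v i"
    unfolding tangent_map_def by (simp add: mult.commute)
  finally have D: "((\<lambda>t. local_rep f c d (snd c (\<gamma> t)) i) has_real_derivative
    tangent_map X f c d (\<gamma> t0) v i) (at t0 within T)" .
  have "\<forall>\<^sub>F t in at t0 within T. local_rep f c d (snd c (\<gamma> t)) i = snd d (f (\<gamma> t)) i"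
    using ev by eventually_elim (simp add: chart_inv_left[OF X])
  moreover have "local_rep f c d (snd c (\<gamma> t0)) i = snd d (f (\<gamma> t0)) i" using X p by simp
  ultimately show ?thesis using D by (simp add: has_field_derivative_cong_eventually)
qed

lemma tangent_map_unit:
  "j < mdim X \<Longrightarrow> tangent_map X f c d p (unit_vector j) i =
    partial_deriv (rep_domain f c d) j (\<lambda>x. local_rep f c d x i) (snd c p)"
  unfolding tangent_map_def unit_vector_def by (simp add: if_distrib[where f="\<lambda>x. x * _"] cong: if_cong)

lemma tangent_map_expand:
  "tangent_map X f c d p v i = (\<Sum>j<mdim X. v j * tangent_map X f c d p (unit_vector j) i)"
  by (simp add: tangent_map_unit) (simp add: tangent_map_def)

lemma tangent_map_linear:
  "tangent_map X f c d p (\<lambda>m. a * v m + b * w m) =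
    (\<lambda>m. a * tangent_map X f c d p v m + b * tangent_map X f c d p w m)"
  unfolding tangent_map_def by (simp add: distrib_right sum.distrib sum_distrib_left mult.assoc)

lemma tangent_map_in_coord_space:
  assumes X: "compact_smooth_manifold X" "c \<in> matlas X" and Y: "compact_smooth_manifold Y" "d \<in> matlas Y"
    and f: "continuous_map (mtop X) (mtop Y) f" and p: "p \<in> fst c" "f p \<in> fst d"
  shows "tangent_map X f c d p v \<in> coord_space (mdim Y)"
  unfolding coord_space_iff
proof (intro allI impI)
  fix i assume i: "mdim Y \<le> i"
  have "partial_deriv (rep_domain f c d) j (\<lambda>x. local_rep f c d x i) (snd c p) = 0" if "j < mdim X" for j
  proof (rule partial_deriv_grad[OF rep_domain_half_open[OF X Y f] _ that, where L="\<lambda>_. 0", simplified])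
    show "snd c p \<in> rep_domain f c d" using p by auto
    moreover have "local_rep f c d x i = 0" if "x \<in> rep_domain f c d" for x
      using local_rep_coord_zero[OF X Y that] i by simp
    ultimately show "has_grad (mdim X) (rep_domain f c d) (\<lambda>x. local_rep f c d x i) (snd c p) (\<lambda>_. 0)"
      unfolding has_grad_def by (intro allI impI exI[where x=1] conjI ballI) (auto simp: sum_nonneg)
  qed
  then show "tangent_map X f c d p v i = 0" by (simp add: tangent_map_def)
qed

text \<open>The chain rule: both sides are the velocity of the image of a coordinate line.\<close>

lemma tangent_map_compose:
  assumes X: "compact_smooth_manifold X" "c \<in> matlas X"
    and Y: "compact_smooth_manifold Y" "d \<in> matlas Y"
    and Z: "compact_smooth_manifold Z" "e \<in> matlas Z"
    and f: "smooth_map X Y f" and g: "smooth_map Y Z g"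
    and p: "p \<in> fst c" "f p \<in> fst d" "g (f p) \<in> fst e"
  shows "tangent_map Y g d e (f p) (tangent_map X f c d p v) = tangent_map X (\<lambda>p. g (f p)) c e p v"
proof
  fix i
  let ?h = "\<lambda>p. g (f p)"
  have cf: "continuous_map (mtop X) (mtop Y) f" and cg: "continuous_map (mtop Y) (mtop Z) g"
    using f g by (auto simp: smooth_map_def)
  have ch: "continuous_map (mtop X) (mtop Z) ?h"
    using continuous_map_compose[OF cf cg] by (simp add: comp_def)
  have hce: "half_open (mdim X) (rep_domain ?h c e)" and hcd: "half_open (mdim X) (rep_domain f c d)"
    using rep_domain_half_open[OF X Z ch] rep_domain_half_open[OF X Y cf] by auto
  define x where "x = snd c p"
  have unit: "tangent_map X ?h c e p (unit_vector j) i =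
      tangent_map Y g d e (f p) (tangent_map X f c d p (unit_vector j)) i" if j: "j < mdim X" for j
  proof -
    define T where "T = {t. x(j := t) \<in> rep_domain ?h c e}"
    define \<gamma> where "\<gamma> t = chart_inv c (x(j := t))" for t
    let ?F = "at (x j) within T"
    have g0: "\<gamma> (x j) = p" using X p by (simp add: \<gamma>_def x_def)
    have nt: "?F \<noteq> bot" unfolding T_def
      by (rule half_open_slice_nontrivial[OF hce _ j]) (use p in \<open>auto simp: x_def\<close>)
    have g1: "\<gamma> t \<in> fst c \<and> g (f (\<gamma> t)) \<in> fst e \<and> snd c (\<gamma> t) = x(j := t)" if t: "t \<in> T" for t
    proof -
      obtain q where "x(j := t) = snd c q" "q \<in> fst c" "g (f q) \<in> fst e" using t by (auto simp: T_def)
      then show ?thesis using X by (simp add: \<gamma>_def)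
    qed
    have evT: "\<forall>\<^sub>F t in ?F. t \<in> T" by (simp add: eventually_at_filter)
    have ev2: "\<forall>\<^sub>F t in ?F. f (\<gamma> t) \<in> fst d"
    proof -
      obtain A where A: "open A" "rep_domain f c d = A \<inter> half_space (mdim X)"
        using hcd half_open_iff by blast
      have "x \<in> A" using p A by (auto simp: x_def)
      have "open ((\<lambda>t. x(j := t)) -` A)" by (rule open_vimage[OF A(1) continuous_on_fun_upd_const])
      then have "\<forall>\<^sub>F t in at (x j). t \<in> (\<lambda>t. x(j := t)) -` A"
        by (rule eventually_at_in_open') (use \<open>x \<in> A\<close> in auto)
      then have "\<forall>\<^sub>F t in ?F. t \<in> (\<lambda>t. x(j := t)) -` A"
        using at_le[of T UNIV "x j"] filter_leD by blast
      with evT show ?thesis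
      proof eventually_elim
        case (elim t)
        have "x(j := t) \<in> half_space (mdim X)"
          using elim(1) hce unfolding T_def half_open_iff by auto
        then have "snd c (\<gamma> t) \<in> rep_domain f c d" using elim A g1[OF elim(1)] by simp
        then obtain q where "snd c (\<gamma> t) = snd c q" "q \<in> fst c" "f q \<in> fst d" by auto
        then show ?case using g1[OF elim(1)] inj_onD[OF chart_inj[OF X]] by metis
      qed
    qed
    have d1: "((\<lambda>t. snd c (\<gamma> t) l) has_real_derivative unit_vector j l) ?F" for l
    proof -
      have "((\<lambda>t. (x(j := t)) l) has_real_derivative unit_vector j l) ?F"
        by (cases "l = j") (auto simp: unit_vector_def)
      moreover have "\<forall>\<^sub>F t in ?F. snd c (\<gamma> t) l = (x(j := t)) l"
        using evT by eventually_elim (use g1 in simp)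
      moreover have "snd c (\<gamma> (x j)) l = (x(j := x j)) l" using g0 by (simp add: x_def)
      ultimately show ?thesis by (simp only: has_field_derivative_cong_eventually)
    qed
    have d2: "((\<lambda>t. snd d (f (\<gamma> t)) k) has_real_derivative
        tangent_map X f c d (\<gamma> (x j)) (unit_vector j) k) ?F" for k
      using evT ev2 g1 g0 p d1
      by (intro tangent_map_curve[OF X Y f]) (auto elim: eventually_elim2)
    have "((\<lambda>t. snd e (g (f (\<gamma> t))) i) has_real_derivative
        tangent_map Y g d e (f (\<gamma> (x j))) (tangent_map X f c d (\<gamma> (x j)) (unit_vector j)) i) ?F"
      using evT ev2 g1 g0 p d2
      by (intro tangent_map_curve[OF Y Z g, where \<gamma>="\<lambda>t. f (\<gamma> t)"]) (auto elim: eventually_elim2)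
    then have "((\<lambda>t. local_rep ?h c e (x(j := t)) i) has_real_derivative
        tangent_map Y g d e (f p) (tangent_map X f c d p (unit_vector j)) i) ?F"
      using g0 by (simp add: \<gamma>_def)
    then have "vector_derivative (\<lambda>t. local_rep ?h c e (x(j := t)) i) ?F =
        tangent_map Y g d e (f p) (tangent_map X f c d p (unit_vector j)) i"
      by (intro vector_derivative_within[OF nt]) (simp add: has_real_derivative_iff_has_vector_derivative)
    then show ?thesis
      unfolding tangent_map_unit[OF j] partial_deriv_def T_def x_def by simp
  qed
  have "tangent_map X ?h c e p v i =
      (\<Sum>j<mdim X. v j * tangent_map Y g d e (f p) (tangent_map X f c d p (unit_vector j)) i)"
    by (subst tangent_map_expand) (simp add: unit)
  also have "\<dots> = (\<Sum>j<mdim X. \<Sum>k<mdim Y. v j * (tangent_map X f c d p (unit_vector j) k *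
      tangent_map Y g d e (f p) (unit_vector k) i))"
    by (simp only: tangent_map_expand[of Y g d e "f p" "tangent_map X f c d p (unit_vector _)"] sum_distrib_left)
  also have "\<dots> = (\<Sum>k<mdim Y. (\<Sum>j<mdim X. v j * tangent_map X f c d p (unit_vector j) k) *
      tangent_map Y g d e (f p) (unit_vector k) i)"
    by (subst sum.swap) (simp add: sum_distrib_right mult.assoc)
  also have "\<dots> = tangent_map Y g d e (f p) (tangent_map X f c d p v) i"
    by (simp only: tangent_map_expand[of Y g d e "f p" "tangent_map X f c d p v"]
        tangent_map_expand[of X f c d p v, symmetric])
  finally show "tangent_map Y g d e (f p) (tangent_map X f c d p v) i = tangent_map X ?h c e p v i" ..
qed

lemma tangent_map_change_target:
  assumes "compact_smooth_manifold X" "c \<in> matlas X" "compact_smooth_manifold Y" "d \<in> matlas Y" "e \<in> matlas Y"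
    "smooth_map X Y f" "p \<in> fst c" "f p \<in> fst d" "f p \<in> fst e"
  shows "tangent_change Y d e (f p) (tangent_map X f c d p v) = tangent_map X f c e p v"
  unfolding tangent_change_eq using assms
  by (subst tangent_map_compose[of X c Y d Y e f "\<lambda>p. p"]) (auto intro: smooth_map_ident)

lemma tangent_map_change_source:
  assumes "compact_smooth_manifold X" "c \<in> matlas X" "d \<in> matlas X" "compact_smooth_manifold Y" "e \<in> matlas Y"
    "smooth_map X Y f" "p \<in> fst c" "p \<in> fst d" "f p \<in> fst e"
  shows "tangent_map X f d e p (tangent_change X c d p v) = tangent_map X f c e p v"
  unfolding tangent_change_eq using assms
  by (subst tangent_map_compose[of X c X d Y e "\<lambda>p. p" f]) (auto intro: smooth_map_ident)

section \<open>Alternating forms in coordinates\<close>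

definition index_lists :: "nat \<Rightarrow> nat \<Rightarrow> nat list set" where
  "index_lists n k = {is. length is = k \<and> set is \<subseteq> {..<n}}"

lemma sum_index_lists_Suc:
  "(\<Sum>js\<in>index_lists n (Suc m). F js) = (\<Sum>is\<in>index_lists n m. \<Sum>i<n. F (is @ [i]))"
proof -
  have "index_lists n (Suc m) = (\<lambda>(is, i). is @ [i]) ` (index_lists n m \<times> {..<n})"
  proof
    show "index_lists n (Suc m) \<subseteq> (\<lambda>(is, i). is @ [i]) ` (index_lists n m \<times> {..<n})"
    proof
      fix js assume js: "js \<in> index_lists n (Suc m)"
      then have "js \<noteq> []" by (auto simp: index_lists_def)
      then have e: "js = butlast js @ [last js]" by simp
      moreover have "last js \<in> {..<n}"
        using js last_in_set[OF \<open>js \<noteq> []\<close>] unfolding index_lists_def by blast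
      moreover have "butlast js \<in> index_lists n m"
        using js by (auto simp: index_lists_def dest: in_set_butlastD)
      ultimately show "js \<in> (\<lambda>(is, i). is @ [i]) ` (index_lists n m \<times> {..<n})"
        by (intro image_eqI[where x="(butlast js, last js)"]) auto
    qed
  qed (auto simp: index_lists_def)
  moreover have "inj_on (\<lambda>(is, i). is @ [i]) (index_lists n m \<times> {..<n})" by (auto simp: inj_on_def)
  ultimately have "(\<Sum>js\<in>index_lists n (Suc m). F js) = (\<Sum>x\<in>index_lists n m \<times> {..<n}. F (fst x @ [snd x]))"
    by (simp add: sum.reindex case_prod_beta' comp_def)
  then show ?thesis by (simp add: sum.cartesian_product case_prod_beta)
qed

lemma unit_vector_in_coord_space: "i < n \<Longrightarrow> unit_vector i \<in> coord_space n"
  by (auto simp: unit_vector_def coord_space_iff)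

lemma alternating_form_linear:
  assumes "alternating_form n k T" "length vs = k" "set vs \<subseteq> coord_space n" "i < k"
    "v \<in> coord_space n" "w \<in> coord_space n"
  shows "T (vs[i := (\<lambda>m. a * v m + b * w m)]) = a * T (vs[i := v]) + b * T (vs[i := w])"
  using assms unfolding alternating_form_def by blast

lemma alternating_form_expand_one:
  assumes T: "alternating_form n k T" and vs: "length vs = k" "set vs \<subseteq> coord_space n" and i: "i < k"
    and v: "v \<in> coord_space n"
  shows "T (vs[i := v]) = (\<Sum>j<n. v j * T (vs[i := unit_vector j]))"
proof -
  have "T (vs[i := (\<lambda>m. if m < N then v m else 0)]) = (\<Sum>j<N. v j * T (vs[i := unit_vector j]))" if "N \<le> n" for N
    using that
  proof (induction N)
    case 0
    have "T (vs[i := (\<lambda>m. 0 * v m + 0 * v m)]) = 0 * T (vs[i := v]) + 0 * T (vs[i := v])"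
      by (rule alternating_form_linear[OF T vs i v v])
    then show ?case by simp
  next
    case (Suc N)
    let ?w = "\<lambda>m. if m < N then v m else 0"
    have "(\<lambda>m. if m < Suc N then v m else 0) = (\<lambda>m. 1 * ?w m + v N * unit_vector N m)"
      by (auto simp: fun_eq_iff unit_vector_def less_Suc_eq)
    moreover have "?w \<in> coord_space n" using v by (auto simp: coord_space_iff)
    moreover have "unit_vector N \<in> coord_space n" using Suc.prems by (intro unit_vector_in_coord_space) auto
    ultimately show ?case
      using alternating_form_linear[OF T vs i, of ?w "unit_vector N" 1 "v N"] Suc by simp
  qed
  from this[of n] have "T (vs[i := (\<lambda>m. if m < n then v m else 0)]) = (\<Sum>j<n. v j * T (vs[i := unit_vector j]))" by simp
  moreover have "(\<lambda>m. if m < n then v m else 0) = v" using v by (auto simp: coord_space_iff fun_eq_iff)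
  ultimately show ?thesis by simp
qed

text \<open>The arguments are replaced by basis vectors one after the other, from the left. The formula
  reduces smoothness and scaling of a form on varying vectors to statements about its coefficients.\<close>

lemma alternating_form_expand:
  assumes T: "alternating_form n k T" and vs: "length vs = k" "set vs \<subseteq> coord_space n"
  shows "T vs = (\<Sum>is\<in>index_lists n k. (\<Prod>r<k. (vs ! r) (is ! r)) * T (map unit_vector is))"
proof -
  have "T vs = (\<Sum>is\<in>index_lists n m. (\<Prod>r<m. (vs ! r) (is ! r)) * T (map unit_vector is @ drop m vs))"
    if "m \<le> k" for m
    using that
  proof (induction m)
    case 0
    have "index_lists n 0 = {[]}" by (auto simp: index_lists_def)
    then show ?case by simp
  next
    case (Suc m)
    have m: "m < k" using Suc.prems by simp
    have one: "T (map unit_vector is @ drop m vs) =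
        (\<Sum>i<n. (vs ! m) i * T (map unit_vector (is @ [i]) @ drop (Suc m) vs))"
      if "is \<in> index_lists n m" for "is"
    proof -
      let ?us = "map unit_vector is @ drop m vs"
      have len: "length is = m" "set is \<subseteq> {..<n}" using that by (auto simp: index_lists_def)
      have us: "length ?us = k" "set ?us \<subseteq> coord_space n"
        using len m vs unit_vector_in_coord_space set_drop_subset[of m vs] by (auto simp del: topspace_Euclidean_space)
      have upd: "?us[m := u] = map unit_vector is @ u # drop (Suc m) vs" for u
        using len m vs by (simp add: list_update_append Cons_nth_drop_Suc[symmetric])
      have "?us[m := vs ! m] = ?us"
        unfolding upd using m vs by (simp add: Cons_nth_drop_Suc)
      moreover have "vs ! m \<in> coord_space n" using vs m nth_mem by blast
      ultimately have "T ?us = (\<Sum>i<n. (vs ! m) i * T (?us[m := unit_vector i]))"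
        using alternating_form_expand_one[OF T us m, of "vs ! m"] by simp
      then show ?thesis unfolding upd by simp
    qed
    have "T vs = (\<Sum>is\<in>index_lists n m. (\<Prod>r<m. (vs ! r) (is ! r)) * T (map unit_vector is @ drop m vs))"
      using Suc by simp
    also have "\<dots> = (\<Sum>is\<in>index_lists n m. \<Sum>i<n. (\<Prod>r<Suc m. (vs ! r) ((is @ [i]) ! r)) *
        T (map unit_vector (is @ [i]) @ drop (Suc m) vs))"
    proof (rule sum.cong[OF refl])
      fix "is" assume I: "is \<in> index_lists n m"
      then have len: "length is = m" by (auto simp: index_lists_def)
      have "(\<Prod>r<m. (vs ! r) ((is @ [i]) ! r)) = (\<Prod>r<m. (vs ! r) (is ! r))" for i
        by (rule prod.cong) (auto simp: nth_append len)
      then show "(\<Prod>r<m. (vs ! r) (is ! r)) * T (map unit_vector is @ drop m vs) =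
        (\<Sum>i<n. (\<Prod>r<Suc m. (vs ! r) ((is @ [i]) ! r)) * T (map unit_vector (is @ [i]) @ drop (Suc m) vs))"
        unfolding one[OF I] using len by (simp add: sum_distrib_left nth_append mult.assoc)
    qed
    finally show ?case unfolding sum_index_lists_Suc .
  qed
  from this[of k] show ?thesis using vs by simp
qed

section \<open>Pullback of forms\<close>

lemma smooth_form_alternating:
  "smooth_form X k \<omega> \<Longrightarrow> c \<in> matlas X \<Longrightarrow> p \<in> fst c \<Longrightarrow> alternating_form (mdim X) k (\<omega> c p)"
  by (simp add: smooth_form_def)

lemma smooth_form_coeff:
  "smooth_form X k \<omega> \<Longrightarrow> c \<in> matlas X \<Longrightarrow> is \<in> index_lists (mdim X) k \<Longrightarrow>
    smooth_on (mdim X) (snd c ` fst c) (\<lambda>x. \<omega> c (chart_inv c x) (map unit_vector is))"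
  by (simp add: smooth_form_def index_lists_def)

lemma smooth_form_change:
  "smooth_form X k \<omega> \<Longrightarrow> c \<in> matlas X \<Longrightarrow> d \<in> matlas X \<Longrightarrow> p \<in> fst c \<Longrightarrow> p \<in> fst d \<Longrightarrow>
    length vs = k \<Longrightarrow> set vs \<subseteq> coord_space (mdim X) \<Longrightarrow>
    \<omega> c p vs = \<omega> d p (map (tangent_change X c d p) vs)"
  unfolding smooth_form_def by blast

text \<open>The chart at the target is chosen pointwise; the value does not depend on it, see \<open>pullback_form_eq\<close>.\<close>

definition pullback_form ::
    "'a smooth_manifold \<Rightarrow> 'm smooth_manifold \<Rightarrow> ('a \<Rightarrow> 'm) \<Rightarrow> 'm diff_form \<Rightarrow> 'a diff_form" where
  "pullback_form A M \<rho> \<omega> c p vs =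
     (let d = (SOME d. d \<in> matlas M \<and> \<rho> p \<in> fst d) in \<omega> d (\<rho> p) (map (tangent_map A \<rho> c d p) vs))"

lemma pullback_form_eq:
  assumes A: "compact_smooth_manifold A" "c \<in> matlas A" and M: "compact_smooth_manifold M" "d \<in> matlas M"
    and \<rho>: "smooth_map A M \<rho>" and \<omega>: "smooth_form M k \<omega>"
    and p: "p \<in> fst c" "\<rho> p \<in> fst d" and vs: "length vs = k"
  shows "pullback_form A M \<rho> \<omega> c p vs = \<omega> d (\<rho> p) (map (tangent_map A \<rho> c d p) vs)"
proof -
  define e where "e = (SOME d. d \<in> matlas M \<and> \<rho> p \<in> fst d)"
  have e: "e \<in> matlas M" "\<rho> p \<in> fst e"
    using someI[where P="\<lambda>d. d \<in> matlas M \<and> \<rho> p \<in> fst d", of d] M p unfolding e_def by auto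
  have c: "continuous_map (mtop A) (mtop M) \<rho>" using \<rho> by (simp add: smooth_map_def)
  have "set (map (tangent_map A \<rho> c e p) vs) \<subseteq> coord_space (mdim M)"
    using tangent_map_in_coord_space[OF A M(1) e(1) c p(1) e(2)] by auto
  then have "\<omega> e (\<rho> p) (map (tangent_map A \<rho> c e p) vs) =
      \<omega> d (\<rho> p) (map (tangent_change M e d (\<rho> p)) (map (tangent_map A \<rho> c e p) vs))"
    using vs by (intro smooth_form_change[OF \<omega> e(1) M(2) e(2) p(2)]) auto
  also have "map (tangent_change M e d (\<rho> p)) (map (tangent_map A \<rho> c e p) vs) = map (tangent_map A \<rho> c d p) vs"
    using tangent_map_change_target[OF A M(1) e(1) M(2) \<rho> p(1) e(2) p(2)] by simp
  finally show ?thesis unfolding pullback_form_def e_def[symmetric] Let_def .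
qed

text \<open>In coordinates the pullback has the coefficients of \<open>\<omega>\<close> composed with \<open>\<rho>\<close>, multiplied by
  Jacobian entries and summed; each factor is smooth.\<close>

lemma smooth_form_pullback:
  assumes A: "compact_smooth_manifold A" and M: "compact_smooth_manifold M"
    and \<rho>: "smooth_map A M \<rho>" and \<omega>: "smooth_form M k \<omega>"
  shows "smooth_form A k (pullback_form A M \<rho> \<omega>)"
  unfolding smooth_form_def
proof (intro conjI ballI allI impI)
  have cont: "continuous_map (mtop A) (mtop M) \<rho>" using \<rho> by (simp add: smooth_map_def)
  have top: "\<rho> p \<in> topspace (mtop M)" if "c \<in> matlas A" "p \<in> fst c" for c p
    using cont that openin_subset[OF chart_open[OF A that(1)]] by (auto simp: continuous_map_def)
  {
    fix c p assume c: "c \<in> matlas A" and p: "p \<in> fst c"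
    obtain d where d: "d \<in> matlas M" "\<rho> p \<in> fst d" using chart_cover[OF M top[OF c p]] by blast
    note eq = pullback_form_eq[OF A c M d(1) \<rho> \<omega> p d(2)]
    let ?D = "tangent_map A \<rho> c d p"
    have alt: "alternating_form (mdim M) k (\<omega> d (\<rho> p))" using smooth_form_alternating[OF \<omega> d] .
    have D: "?D v \<in> coord_space (mdim M)" for v by (rule tangent_map_in_coord_space[OF A c M d(1) cont p d(2)])
    show "alternating_form (mdim A) k (pullback_form A M \<rho> \<omega> c p)"
      unfolding alternating_form_def
    proof (intro allI impI conjI ballI)
      fix vs i v w a b
      assume vs: "length vs = k \<and> set vs \<subseteq> coord_space (mdim A)" and i: "i < k"
      have "\<omega> d (\<rho> p) ((map ?D vs)[i := (\<lambda>m. a * ?D v m + b * ?D w m)]) =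
          a * \<omega> d (\<rho> p) ((map ?D vs)[i := ?D v]) + b * \<omega> d (\<rho> p) ((map ?D vs)[i := ?D w])"
        using vs i D by (intro alternating_form_linear[OF alt]) auto
      then show "pullback_form A M \<rho> \<omega> c p (vs[i := (\<lambda>m. a * v m + b * w m)]) =
          a * pullback_form A M \<rho> \<omega> c p (vs[i := v]) + b * pullback_form A M \<rho> \<omega> c p (vs[i := w])"
        using vs by (simp add: eq map_update tangent_map_linear)
    next
      fix vs i j
      assume vs: "length vs = k \<and> set vs \<subseteq> coord_space (mdim A)" and ij: "i < j \<and> j < k \<and> vs ! i = vs ! j"
      have "length (map ?D vs) = k \<and> set (map ?D vs) \<subseteq> coord_space (mdim M)" using vs D by auto
      moreover have "map ?D vs ! i = map ?D vs ! j" using vs ij by simp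
      ultimately have "\<omega> d (\<rho> p) (map ?D vs) = 0"
        using alt ij unfolding alternating_form_def by blast
      then show "pullback_form A M \<rho> \<omega> c p vs = 0" using vs by (simp add: eq)
    qed
  }
  {
    fix c d p vs assume c: "c \<in> matlas A" and d: "d \<in> matlas A" and p: "p \<in> fst c \<inter> fst d"
      and vs: "length vs = k \<and> set vs \<subseteq> coord_space (mdim A)"
    then have p': "p \<in> fst c" "p \<in> fst d" by auto
    obtain e where e: "e \<in> matlas M" "\<rho> p \<in> fst e" using chart_cover[OF M top[OF c p'(1)]] by blast
    show "pullback_form A M \<rho> \<omega> c p vs = pullback_form A M \<rho> \<omega> d p (map (tangent_change A c d p) vs)"
      using vs tangent_map_change_source[OF A c d M e(1) \<rho> p' e(2)]
      by (simp add: pullback_form_eq[OF A c M e(1) \<rho> \<omega> p'(1) e(2)] pullback_form_eq[OF A d M e(1) \<rho> \<omega> p'(2) e(2)] comp_def)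
  }
  {
    fix c "is" assume c: "c \<in> matlas A" and "is": "length is = k \<and> set is \<subseteq> {..<mdim A}"
    have sub: "snd c ` fst c \<subseteq> coord_space (mdim A)" using chart_in_coord_space[OF A c] by auto
    show "smooth_on (mdim A) (snd c ` fst c)
        (\<lambda>x. pullback_form A M \<rho> \<omega> c (chart_inv c x) (map unit_vector is))"
    proof (rule smooth_on_local[OF sub])
      fix x assume "x \<in> snd c ` fst c"
      then obtain p where p: "p \<in> fst c" "x = snd c p" by auto
      obtain d where d: "d \<in> matlas M" "\<rho> p \<in> fst d" using chart_cover[OF M top[OF c p(1)]] by blast
      let ?S = "rep_domain \<rho> c d"
      have hS: "half_open (mdim A) ?S" by (rule rep_domain_half_open[OF A c M d(1) cont])
      obtain B where B: "open B" "?S = B \<inter> half_space (mdim A)" using hS half_open_iff by blast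
      define U where "U = B \<inter> coord_space (mdim A)"
      have U: "openin (Euclidean_space (mdim A)) U" using B(1) openin_coord_space U_def by blast
      have xU: "x \<in> U" using p d(2) B(2) sub by (auto simp: U_def)
      have SU: "snd c ` fst c \<inter> U = ?S"
        using B(2) half_open_subset[OF hS] chart_image_half_open[OF A c] unfolding half_open_iff U_def
        by auto
      have Ssub: "?S \<subseteq> coord_space (mdim A)" using half_open_subset[OF hS] .
      let ?J = "\<lambda>r i x. partial_deriv ?S (is ! r) (\<lambda>x. local_rep \<rho> c d x i) x"
      let ?C = "\<lambda>js x. \<omega> d (chart_inv d (local_rep \<rho> c d x)) (map unit_vector js)"
      have "smooth_on (mdim A) ?S (\<lambda>x. \<Sum>js\<in>index_lists (mdim M) k. (\<Prod>r<k. ?J r (js ! r) x) * ?C js x)"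
      proof (intro smooth_on_sum[OF Ssub] smooth_on_mult smooth_on_prod[OF Ssub])
        fix js r assume "js \<in> index_lists (mdim M) k" "r \<in> {..<k}"
        then have "is ! r < mdim A" using "is" nth_mem by fastforce
        then show "smooth_on (mdim A) ?S (\<lambda>x. ?J r (js ! r) x)"
          using smooth_on_partial_deriv[OF hS local_rep_smooth[OF A c M d(1) \<rho>]] by simp
      next
        fix js assume js: "js \<in> index_lists (mdim M) k"
        show "smooth_on (mdim A) ?S (?C js)"
          by (rule smooth_on_compose[OF smooth_form_coeff[OF \<omega> d(1) js] local_rep_smooth[OF A c M d(1) \<rho>] _ Ssub])
             (use A c in auto)
      qed
      moreover have "(\<Sum>js\<in>index_lists (mdim M) k. (\<Prod>r<k. ?J r (js ! r) y) * ?C js y) =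
          pullback_form A M \<rho> \<omega> c (chart_inv c y) (map unit_vector is)" if y: "y \<in> ?S" for y
      proof -
        obtain q where q: "q \<in> fst c" "\<rho> q \<in> fst d" "y = snd c q" using y by auto
        let ?vs = "map (tangent_map A \<rho> c d q) (map unit_vector is)"
        have "pullback_form A M \<rho> \<omega> c q (map unit_vector is) = \<omega> d (\<rho> q) ?vs"
          using "is" by (intro pullback_form_eq[OF A c M d(1) \<rho> \<omega> q(1,2)]) simp
        also have "\<dots> = (\<Sum>js\<in>index_lists (mdim M) k. (\<Prod>r<k. (?vs ! r) (js ! r)) * \<omega> d (\<rho> q) (map unit_vector js))"
          using "is" tangent_map_in_coord_space[OF A c M d(1) cont q(1,2)]
          by (intro alternating_form_expand[OF smooth_form_alternating[OF \<omega> d(1) q(2)]]) auto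
        also have "\<dots> = (\<Sum>js\<in>index_lists (mdim M) k. (\<Prod>r<k. ?J r (js ! r) y) * ?C js y)"
        proof (intro sum.cong prod.cong arg_cong2[where f="(*)"] refl)
          fix js r assume "r \<in> {..<k}"
          then have "is ! r < mdim A" "r < length is" using "is" nth_mem by fastforce+
          then show "(?vs ! r) (js ! r) = ?J r (js ! r) y" by (simp add: tangent_map_unit q)
        next
          fix js show "\<omega> d (\<rho> q) (map unit_vector js) = ?C js y" using A c M d q by simp
        qed
        finally show ?thesis using A c q by simp
      qed
      ultimately have "smooth_on (mdim A) (snd c ` fst c \<inter> U)
          (\<lambda>x. pullback_form A M \<rho> \<omega> c (chart_inv c x) (map unit_vector is))"
        unfolding SU by (rule smooth_on_cong)
      with U xU show "\<exists>U. openin (Euclidean_space (mdim A)) U \<and> x \<in> U \<and> smooth_on (mdim A) (snd c ` fst c \<inter> U)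
          (\<lambda>x. pullback_form A M \<rho> \<omega> c (chart_inv c x) (map unit_vector is))" by blast
    qed
  }
qed

lemma smooth_form_zero: "compact_smooth_manifold X \<Longrightarrow> smooth_form X k (\<lambda>c p vs. 0)"
  unfolding smooth_form_def alternating_form_def
  by (auto intro!: smooth_on_const chart_in_coord_space simp del: topspace_Euclidean_space)

lemma smooth_form_add:
  assumes "smooth_form X k \<omega>" "smooth_form X k \<eta>"
  shows "smooth_form X k (\<lambda>c p vs. \<omega> c p vs + \<eta> c p vs)"
  unfolding smooth_form_def
proof (intro conjI ballI allI impI)
  fix c p assume "c \<in> matlas X" "p \<in> fst c"
  then have "alternating_form (mdim X) k (\<omega> c p)" "alternating_form (mdim X) k (\<eta> c p)"
    by (blast intro: smooth_form_alternating assms)+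
  then show "alternating_form (mdim X) k (\<lambda>vs. \<omega> c p vs + \<eta> c p vs)"
    unfolding alternating_form_def by (simp add: algebra_simps)
next
  fix c "is" assume "c \<in> matlas X" "length is = k \<and> set is \<subseteq> {..<mdim X}"
  then show "smooth_on (mdim X) (snd c ` fst c)
      (\<lambda>x. \<omega> c (chart_inv c x) (map unit_vector is) + \<eta> c (chart_inv c x) (map unit_vector is))"
    using assms by (intro smooth_on_add smooth_form_coeff) (auto simp: index_lists_def)
next
  fix c d p vs assume "c \<in> matlas X" "d \<in> matlas X" "p \<in> fst c \<inter> fst d"
    "length vs = k \<and> set vs \<subseteq> coord_space (mdim X)"
  then show "\<omega> c p vs + \<eta> c p vs =
      \<omega> d p (map (tangent_change X c d p) vs) + \<eta> d p (map (tangent_change X c d p) vs)"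
    using smooth_form_change[OF assms(1), of c d p vs] smooth_form_change[OF assms(2), of c d p vs] by simp
qed

lemma smooth_form_uminus:
  assumes "compact_smooth_manifold X" "smooth_form X k \<omega>"
  shows "smooth_form X k (\<lambda>c p vs. - \<omega> c p vs)"
  unfolding smooth_form_def
proof (intro conjI ballI allI impI)
  fix c p assume "c \<in> matlas X" "p \<in> fst c"
  then have "alternating_form (mdim X) k (\<omega> c p)"
    by (blast intro: smooth_form_alternating assms)+
  then show "alternating_form (mdim X) k (\<lambda>vs. - \<omega> c p vs)"
    unfolding alternating_form_def by simp
next
  fix c "is" assume c: "c \<in> matlas X" and "is": "length is = k \<and> set is \<subseteq> {..<mdim X}"
  have "snd c ` fst c \<subseteq> coord_space (mdim X)"
    using chart_in_coord_space[OF assms(1) c] by auto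
  then have "smooth_on (mdim X) (snd c ` fst c) (\<lambda>x. (-1) * \<omega> c (chart_inv c x) (map unit_vector is))"
    using c "is" by (intro smooth_on_mult smooth_on_const smooth_form_coeff[OF assms(2)]) (auto simp: index_lists_def)
  then show "smooth_on (mdim X) (snd c ` fst c) (\<lambda>x. - \<omega> c (chart_inv c x) (map unit_vector is))" by simp
next
  fix c d p vs assume "c \<in> matlas X" "d \<in> matlas X" "p \<in> fst c \<inter> fst d"
    "length vs = k \<and> set vs \<subseteq> coord_space (mdim X)"
  then show "- \<omega> c p vs = - \<omega> d p (map (tangent_change X c d p) vs)"
    using smooth_form_change[OF assms(2), of c d p vs] by simp
qed

section \<open>Smooth simplices\<close>

lemma powertop_real_eq: "subtopology (powertop_real UNIV) S = top_of_set (S :: (nat \<Rightarrow> real) set)"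
  by (simp add: euclidean_product_topology)

lemma standard_simplex_subset: "standard_simplex p \<subseteq> coord_space (Suc p)"
  by (auto simp: standard_simplex_def coord_space_iff)

abbreviation simplex_domain :: "nat \<Rightarrow> ((nat \<Rightarrow> real) \<Rightarrow> 'a) \<Rightarrow> 'a chart \<Rightarrow> (nat \<Rightarrow> real) set" where
  "simplex_domain p \<sigma> d \<equiv> {t \<in> standard_simplex p. \<sigma> t \<in> fst d}"

lemma simplex_domain_subset: "simplex_domain p \<sigma> d \<subseteq> coord_space (Suc p)"
  using standard_simplex_subset by blast

lemma smooth_simplices_int:
  "\<sigma> \<in> smooth_simplices X (int p) \<longleftrightarrow> singular_simplex p (mtop X) \<sigma> \<and>
     (\<forall>d\<in>matlas X. \<forall>i<mdim X. smooth_on (Suc p) (simplex_domain p \<sigma> d) (\<lambda>t. snd d (\<sigma> t) i))"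
  by (simp add: smooth_simplices_def)

lemma smooth_simplices_neg: "k < 0 \<Longrightarrow> smooth_simplices X k = {}"
  by (simp add: smooth_simplices_def)

lemma smooth_simplex_continuous:
  "\<sigma> \<in> smooth_simplices X (int p) \<Longrightarrow> continuous_map (top_of_set (standard_simplex p)) (mtop X) \<sigma>"
  by (simp add: smooth_simplices_int singular_simplex_def powertop_real_eq)

lemma smooth_simplex_in_space:
  "\<sigma> \<in> smooth_simplices X (int p) \<Longrightarrow> t \<in> standard_simplex p \<Longrightarrow> \<sigma> t \<in> topspace (mtop X)"
  using smooth_simplex_continuous[of \<sigma> X p] by (auto simp: continuous_map_def)

lemma smooth_simplex_coord:
  assumes X: "compact_smooth_manifold X" "d \<in> matlas X" and \<sigma>: "\<sigma> \<in> smooth_simplices X (int p)"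
  shows "smooth_on (Suc p) (simplex_domain p \<sigma> d) (\<lambda>t. snd d (\<sigma> t) i)"
proof (cases "i < mdim X")
  case True
  then show ?thesis using \<sigma> X by (simp add: smooth_simplices_int)
next
  case False
  show ?thesis
  proof (rule smooth_on_cong[OF smooth_on_const[where c=0], OF simplex_domain_subset])
    fix t assume "t \<in> simplex_domain p \<sigma> d"
    then have "snd d (\<sigma> t) \<in> coord_space (mdim X)" using chart_in_coord_space[OF X] by blast
    then show "0 = snd d (\<sigma> t) i" using False by (simp add: coord_space_iff)
  qed
qed

lemma continuous_preimage_chart:
  assumes X: "compact_smooth_manifold X" "d \<in> matlas X"
    and \<sigma>: "continuous_map (top_of_set S) (mtop X) \<sigma>"
  obtains A where "open A" "{t \<in> S. \<sigma> t \<in> fst d} = A \<inter> S"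
proof -
  have "openin (top_of_set S) {t \<in> topspace (top_of_set S). \<sigma> t \<in> fst d}"
    by (rule openin_continuous_map_preimage[OF \<sigma> chart_open[OF X]])
  then obtain T where "open T" "{t \<in> S. \<sigma> t \<in> fst d} = S \<inter> T"
    by (auto simp: openin_open)
  then show ?thesis using that[of T] by blast
qed

lemma smooth_simplex_precompose:
  assumes X: "compact_smooth_manifold X" and \<sigma>: "\<sigma> \<in> smooth_simplices X (int q)"
    and a: "a ` standard_simplex p \<subseteq> standard_simplex q"
    and sm: "\<And>j. smooth_on (Suc p) (standard_simplex p) (\<lambda>t. a t j)"
  shows "restrict (\<sigma> \<circ> a) (standard_simplex p) \<in> smooth_simplices X (int p)"
  unfolding smooth_simplices_int
proof (intro conjI ballI allI impI)
  have "continuous_on (standard_simplex p) a"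
    by (rule continuous_on_coordinatewise_then_product) (rule smooth_on_continuous[OF sm])
  then have "continuous_map (top_of_set (standard_simplex p)) (top_of_set (standard_simplex q)) a"
    using a by (auto simp: continuous_map_in_subtopology)
  from continuous_map_compose[OF this smooth_simplex_continuous[OF \<sigma>]]
  show "singular_simplex p (mtop X) (restrict (\<sigma> \<circ> a) (standard_simplex p))"
    unfolding singular_simplex_def powertop_real_eq by simp
next
  fix d i assume d: "d \<in> matlas X" and i: "i < mdim X"
  let ?S = "simplex_domain p (restrict (\<sigma> \<circ> a) (standard_simplex p)) d"
  have S: "?S = {t \<in> standard_simplex p. \<sigma> (a t) \<in> fst d}" by auto
  have "smooth_on (Suc p) ?S (\<lambda>t. snd d (\<sigma> (a t)) i)"
    by (rule smooth_on_compose[OF smooth_simplex_coord[OF X d \<sigma>] smooth_on_subset[OF sm] _ simplex_domain_subset])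
       (use a in auto)
  then show "smooth_on (Suc p) ?S (\<lambda>t. snd d (restrict (\<sigma> \<circ> a) (standard_simplex p) t) i)"
    by (rule smooth_on_cong) auto
qed

text \<open>In a chart \<open>c\<close> around \<open>\<sigma> t\<close>, the coordinates of \<open>\<rho> \<circ> \<sigma>\<close> are a local representation of \<open>\<rho>\<close> composed with the
  coordinates of \<open>\<sigma>\<close>.\<close>

lemma smooth_simplex_map:
  assumes A: "compact_smooth_manifold A" and M: "compact_smooth_manifold M"
    and \<rho>: "smooth_map A M \<rho>" and \<sigma>: "\<sigma> \<in> smooth_simplices A (int p)"
  shows "simplex_map p \<rho> \<sigma> \<in> smooth_simplices M (int p)"
  unfolding smooth_simplices_int
proof (intro conjI ballI allI impI)
  have cont: "continuous_map (mtop A) (mtop M) \<rho>" using \<rho> by (simp add: smooth_map_def)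
  then show "singular_simplex p (mtop M) (simplex_map p \<rho> \<sigma>)"
    using \<sigma> singular_simplex_simplex_map by (auto simp: smooth_simplices_int)
  fix d i assume d: "d \<in> matlas M" and i: "i < mdim M"
  let ?S = "simplex_domain p (simplex_map p \<rho> \<sigma>) d"
  have "smooth_on (Suc p) ?S (\<lambda>t. snd d (\<rho> (\<sigma> t)) i)"
  proof (rule smooth_on_local[OF simplex_domain_subset])
    fix t assume t: "t \<in> ?S"
    then have "\<sigma> t \<in> topspace (mtop A)" using smooth_simplex_in_space[OF \<sigma>] by auto
    then obtain c where c: "c \<in> matlas A" "\<sigma> t \<in> fst c" using chart_cover[OF A] by blast
    obtain B where B: "open B" "simplex_domain p \<sigma> c = B \<inter> standard_simplex p"
      by (rule continuous_preimage_chart[OF A c(1) smooth_simplex_continuous[OF \<sigma>]])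
    define U where "U = B \<inter> coord_space (Suc p)"
    have U: "openin (Euclidean_space (Suc p)) U" using B(1) openin_coord_space U_def by blast
    have tU: "t \<in> U" using t c B simplex_domain_subset by (fastforce simp: U_def)
    have SU: "?S \<inter> U \<subseteq> simplex_domain p \<sigma> c" using B by (auto simp: U_def)
    have "smooth_on (Suc p) (?S \<inter> U) (\<lambda>t. local_rep \<rho> c d (snd c (\<sigma> t)) i)"
    proof (rule smooth_on_compose[OF local_rep_smooth[OF A c(1) M d \<rho>]])
      show "smooth_on (Suc p) (?S \<inter> U) (\<lambda>t. snd c (\<sigma> t) j)" for j
        by (rule smooth_on_subset[OF smooth_simplex_coord[OF A c(1) \<sigma>] SU])
      show "(\<lambda>t. snd c (\<sigma> t)) ` (?S \<inter> U) \<subseteq> rep_domain \<rho> c d"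
        using SU by (auto simp: simplex_map_def)
      show "?S \<inter> U \<subseteq> coord_space (Suc p)" unfolding U_def by blast
    qed
    then have "smooth_on (Suc p) (?S \<inter> U) (\<lambda>t. snd d (\<rho> (\<sigma> t)) i)"
      by (rule smooth_on_cong) (use SU chart_inv_left[OF A c(1)] in auto)
    with U tU show "\<exists>U. openin (Euclidean_space (Suc p)) U \<and> t \<in> U \<and>
        smooth_on (Suc p) (?S \<inter> U) (\<lambda>t. snd d (\<rho> (\<sigma> t)) i)" by blast
  qed
  then show "smooth_on (Suc p) ?S (\<lambda>t. snd d (simplex_map p \<rho> \<sigma> t) i)"
    by (rule smooth_on_cong) (auto simp: simplex_map_def)
qed

lemma smooth_on_simplical_face:
  "S \<subseteq> coord_space n \<Longrightarrow> smooth_on n S (\<lambda>x. simplical_face k x j)"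
  unfolding simplical_face_def
  by (cases "j < k"; cases "j = k") (simp_all add: smooth_on_coord smooth_on_const)

lemma smooth_simplex_face:
  assumes X: "compact_smooth_manifold X" and \<sigma>: "\<sigma> \<in> smooth_simplices X (int (Suc p))" and k: "k \<le> Suc p"
  shows "singular_face (Suc p) k \<sigma> \<in> smooth_simplices X (int p)"
proof -
  have "simplical_face k ` standard_simplex p \<subseteq> standard_simplex (Suc p)"
    using simplical_face_in_standard_simplex[of "Suc p" k] k by auto
  then have "restrict (\<sigma> \<circ> simplical_face k) (standard_simplex p) \<in> smooth_simplices X (int p)"
    by (intro smooth_simplex_precompose[OF X \<sigma>] smooth_on_simplical_face standard_simplex_subset)
  then show ?thesis by (simp add: singular_face_def)
qed

lemma smooth_chains_iff: "c \<in> smooth_chains X k \<longleftrightarrow> Poly_Mapping.keys c \<subseteq> smooth_simplices X k"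
  by (simp add: smooth_chain_group_def)

lemma smooth_chains_0 [simp]: "0 \<in> smooth_chains X k"
  by (simp add: smooth_chains_iff)

lemma smooth_chains_add: "a \<in> smooth_chains X k \<Longrightarrow> b \<in> smooth_chains X k \<Longrightarrow> a + b \<in> smooth_chains X k"
  unfolding smooth_chains_iff using keys_add[of a b] by blast

lemma smooth_chains_uminus: "a \<in> smooth_chains X k \<Longrightarrow> - a \<in> smooth_chains X k"
  unfolding smooth_chains_iff by simp

lemma smooth_chains_diff: "a \<in> smooth_chains X k \<Longrightarrow> b \<in> smooth_chains X k \<Longrightarrow> a - b \<in> smooth_chains X k"
  using smooth_chains_add[OF _ smooth_chains_uminus, of a X k b] by simp

lemma smooth_chains_of: "\<sigma> \<in> smooth_simplices X k \<Longrightarrow> frag_of \<sigma> \<in> smooth_chains X k"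
  by (simp add: smooth_chains_iff)

lemma smooth_chain_induct [consumes 1, case_names zero simplex diff]:
  assumes "c \<in> smooth_chains X k" "P 0" "\<And>\<sigma>. \<sigma> \<in> smooth_simplices X k \<Longrightarrow> P (frag_of \<sigma>)"
    "\<And>a b. a \<in> smooth_chains X k \<Longrightarrow> b \<in> smooth_chains X k \<Longrightarrow> P a \<Longrightarrow> P b \<Longrightarrow> P (a - b)"
  shows "P c"
proof -
  have "c \<in> smooth_chains X k \<and> P c"
    by (rule frag_induction[of c "smooth_simplices X k"])
       (use assms smooth_chains_of smooth_chains_diff in \<open>auto simp: smooth_chains_iff[symmetric]\<close>)
  then show ?thesis ..
qed

lemma chain_boundary_smooth:
  assumes X: "compact_smooth_manifold X" and c: "c \<in> smooth_chains X k"
  shows "chain_boundary (nat k) c \<in> smooth_chains X (k - 1)"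
proof (cases "k > 0")
  case False
  then show ?thesis by (simp add: chain_boundary_def)
next
  case True
  define p where "p = nat k - 1"
  have k: "k = int (Suc p)" using True by (simp add: p_def)
  have n: "nat k = Suc p" "k - 1 = int p" using k by auto
  from c show ?thesis unfolding n
  proof (induction rule: smooth_chain_induct)
    case (simplex \<sigma>)
    have "frag_cmul ((-1) ^ i) (frag_of (singular_face (Suc p) i \<sigma>)) \<in> smooth_chains X (int p)" if "i \<le> Suc p" for i
      using smooth_simplex_face[OF X simplex[unfolded k] that] keys_cmul[of "(-1) ^ i" "frag_of (singular_face (Suc p) i \<sigma>)"]
      by (auto simp: smooth_chains_iff)
    then have "(\<Sum>i\<in>I. frag_cmul ((-1) ^ i) (frag_of (singular_face (Suc p) i \<sigma>))) \<in> smooth_chains X (int p)"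
      if "I \<subseteq> {..Suc p}" for I
      using that by (induction I rule: infinite_finite_induct) (auto intro!: smooth_chains_add)
    from this[of "{..Suc p}"] show ?case unfolding chain_boundary_of by (simp del: sum.atMost_Suc)
  qed (auto simp: chain_boundary_diff intro: smooth_chains_diff)
qed

lemma chain_map_smooth:
  assumes A: "compact_smooth_manifold A" and M: "compact_smooth_manifold M"
    and \<rho>: "smooth_map A M \<rho>" and c: "c \<in> smooth_chains A k"
  shows "chain_map (nat k) \<rho> c \<in> smooth_chains M k"
  using c
proof (induction rule: smooth_chain_induct)
  case (simplex \<sigma>)
  then have "k \<ge> 0" using smooth_simplices_neg[of k A] by force
  then have "\<sigma> \<in> smooth_simplices A (int (nat k))" "k = int (nat k)" using simplex by auto
  then have "simplex_map (nat k) \<rho> \<sigma> \<in> smooth_simplices M k" using smooth_simplex_map[OF A M \<rho>] by metis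
  then show ?case by (simp add: smooth_chains_of)
qed (auto simp: chain_map_diff intro: smooth_chains_diff)

section \<open>The integrand along a smooth simplex\<close>


definition integrand ::
    "'a smooth_manifold \<Rightarrow> nat \<Rightarrow> 'a diff_form \<Rightarrow> ((nat \<Rightarrow> real) \<Rightarrow> 'a) \<Rightarrow> (nat \<Rightarrow> real) \<Rightarrow> real" where
  "integrand X p \<omega> \<sigma> t = (let y = \<sigma> (barycentric p t);
                c = (SOME c. c \<in> matlas X \<and> y \<in> fst c)
            in \<omega> c y (map (\<lambda>j i. partial_deriv {s \<in> open_simplex p. \<sigma> (barycentric p s) \<in> fst c} j
                                   (\<lambda>s. snd c (\<sigma> (barycentric p s)) i) t) [0..<p]))"

lemma simplex_integral_eq:
  "simplex_integral X p \<omega> \<sigma> =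
    set_lebesgue_integral (PiM {..<p} (\<lambda>_. lborel)) (open_simplex p) (integrand X p \<omega> \<sigma>)"
  unfolding simplex_integral_def integrand_def ..

lemma sum_barycentric: "(\<Sum>i\<le>p. barycentric p t i) = 1"
proof -
  have "(\<Sum>i\<le>p. barycentric p t i) = barycentric p t 0 + (\<Sum>i<p. barycentric p t (Suc i))"
    by (rule sum.atMost_shift)
  also have "(\<Sum>i<p. barycentric p t (Suc i)) = (\<Sum>i<p. t i)" by (simp add: barycentric_def)
  finally show ?thesis by (simp add: barycentric_def)
qed

lemma barycentric_in_simplex:
  assumes t: "t \<in> open_simplex p"
  shows "barycentric p t \<in> standard_simplex p"
proof -
  have pos: "\<And>i. i < p \<Longrightarrow> 0 < t i" and lt: "(\<Sum>i<p. t i) < 1" using t by (auto simp: open_simplex_def)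
  have nn: "0 \<le> barycentric p t i" for i
  proof (cases i)
    case (Suc m) then show ?thesis using pos[of m] by (auto simp: barycentric_def intro: less_imp_le)
  qed (use lt in \<open>simp add: barycentric_def\<close>)
  have "barycentric p t i \<le> 1" for i
  proof (cases "i \<le> p")
    case True
    have "barycentric p t i \<le> (\<Sum>i\<le>p. barycentric p t i)"
      by (rule member_le_sum) (use True nn in auto)
    then show ?thesis by (simp add: sum_barycentric)
  qed (auto simp: barycentric_def)
  then show ?thesis using nn sum_barycentric[of p t] by (auto simp: standard_simplex_def barycentric_def)
qed

text \<open>The velocity of the barycentric coordinates when the \<open>j\<close>-th parameter moves.\<close>

definition bary_dir :: "nat \<Rightarrow> nat \<Rightarrow> real" where
  "bary_dir j = (\<lambda>l. if l = 0 then -1 else if l = Suc j then 1 else 0)"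

lemma sum_fun_upd:
  fixes j p :: nat
  assumes "j < p"
  shows "(\<Sum>i<p. (t(j := u)) i) = (\<Sum>i<p. t i) + (u - t j :: real)"
proof -
  have "(\<Sum>i<p. (t(j := u)) i) = (t(j := u)) j + (\<Sum>i\<in>{..<p} - {j}. (t(j := u)) i)"
    using assms by (intro sum.remove) auto
  also have "(\<Sum>i\<in>{..<p} - {j}. (t(j := u)) i) = (\<Sum>i\<in>{..<p} - {j}. t i)" by (rule sum.cong) auto
  also have "\<dots> = (\<Sum>i<p. t i) - t j" using assms by (subst sum.remove[of "{..<p}" j]) auto
  finally show ?thesis by simp
qed

lemma barycentric_derivative:
  assumes "j < p"
  shows "((\<lambda>u. barycentric p (t(j := u)) l) has_real_derivative bary_dir j l) (at (t j))"
proof (cases l)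
  case 0
  have "(\<lambda>u. barycentric p (t(j := u)) l) = (\<lambda>u. 1 - ((\<Sum>i<p. t i) + (u - t j)))"
    using 0 sum_fun_upd[OF assms] by (simp add: barycentric_def)
  moreover have "((\<lambda>u. 1 - ((\<Sum>i<p. t i) + (u - t j))) has_real_derivative 0 - (0 + (1 - 0))) (at (t j))"
    by (intro derivative_intros)
  ultimately show ?thesis using 0 by (simp add: bary_dir_def)
next
  case (Suc m)
  then show ?thesis using assms by (cases "m = j"; cases "Suc m \<le> p") (auto simp: barycentric_def bary_dir_def)
qed

lemma sum_bary_dir: "j < p \<Longrightarrow> (\<Sum>l<Suc p. bary_dir j l) = 0"
  unfolding sum.lessThan_Suc_shift by (simp add: bary_dir_def)

lemma eventually_imp_within_nontrivial:
  fixes x :: real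
  assumes "\<forall>\<^sub>F u in at x. u \<in> T"
  shows "at x within T \<noteq> bot"
proof
  assume "at x within T = bot"
  then have "\<forall>\<^sub>F u in at x within T. False" by simp
  then have "\<forall>\<^sub>F u in at x. u \<in> T \<longrightarrow> False"
    unfolding eventually_at_filter by (auto elim: eventually_mono)
  with assms have "\<forall>\<^sub>F u in at x. False" by eventually_elim auto
  then show False by simp
qed

text \<open>The partial derivatives in the integrand are derivatives along lines in the parameter domain. These run
  inside the simplex, so they can be computed from any gradient on the simplex.\<close>

lemma integrand_gradient:
  assumes X: "compact_smooth_manifold X" and \<sigma>: "\<sigma> \<in> smooth_simplices X (int q)"
    and a: "a ` standard_simplex p \<subseteq> standard_simplex q" and t: "t \<in> open_simplex p"
    and V: "\<And>j l. j < p \<Longrightarrow> l < Suc q \<Longrightarrow>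
      ((\<lambda>u. a (barycentric p (t(j := u))) l) has_real_derivative V j l) (at (t j))"
    and c: "c = (SOME c. c \<in> matlas X \<and> \<sigma> (a (barycentric p t)) \<in> fst c)"
    and L: "\<And>i. has_grad (Suc q) (simplex_domain q \<sigma> c) (\<lambda>t. snd c (\<sigma> t) i) (a (barycentric p t)) (L i)"
  shows "integrand X p \<omega> (restrict (\<sigma> \<circ> a) (standard_simplex p)) t =
    \<omega> c (\<sigma> (a (barycentric p t))) (map (\<lambda>j i. \<Sum>l<Suc q. L i l * V j l) [0..<p])"
proof -
  define \<tau> where "\<tau> = restrict (\<sigma> \<circ> a) (standard_simplex p)"
  let ?y = "a (barycentric p t)"
  have \<tau>: "\<tau> (barycentric p s) = \<sigma> (a (barycentric p s))" if "s \<in> open_simplex p" for s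
    using barycentric_in_simplex[OF that] by (simp add: \<tau>_def)
  have y: "?y \<in> standard_simplex q" using a barycentric_in_simplex[OF t] by auto
  then have "\<exists>c. c \<in> matlas X \<and> \<sigma> ?y \<in> fst c" using chart_cover[OF X] smooth_simplex_in_space[OF \<sigma>] by blast
  from someI_ex[OF this] have cX: "c \<in> matlas X" "\<sigma> ?y \<in> fst c" unfolding c by auto
  obtain A where A: "open A" "simplex_domain q \<sigma> c = A \<inter> standard_simplex q"
    by (rule continuous_preimage_chart[OF X cX(1) smooth_simplex_continuous[OF \<sigma>]])
  have "?y \<in> A" using A y cX by auto
  from box_in_open[OF A(1) this subsetD[OF standard_simplex_subset y]]
  obtain \<delta> where \<delta>: "\<delta> > 0" "\<And>z. z \<in> coord_space (Suc q) \<Longrightarrow> (\<And>i. i < Suc q \<Longrightarrow> \<bar>z i - ?y i\<bar> < \<delta>) \<Longrightarrow> z \<in> A"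
    by blast
  have pd: "partial_deriv {s \<in> open_simplex p. \<tau> (barycentric p s) \<in> fst c} j
      (\<lambda>s. snd c (\<tau> (barycentric p s)) i) t = (\<Sum>l<Suc q. L i l * V j l)" if j: "j < p" for i j
  proof -
    have o: "\<forall>\<^sub>F u in at (t j). t(j := u) \<in> open_simplex p"
    proof -
      have s: "(\<Sum>i<p. (t(j := u)) i) = (\<Sum>i<p. t i) + (u - t j)" for u
        by (rule sum_fun_upd[OF j])
      have "0 < t j" "(\<Sum>i<p. t i) < 1" using t j by (auto simp: open_simplex_def)
      then have "\<forall>\<^sub>F u in at (t j). 0 < u" "\<forall>\<^sub>F u in at (t j). u < t j + (1 - (\<Sum>i<p. t i))"
        using order_tendstoD[OF tendsto_ident_at[of "t j" UNIV]] by simp_all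
      then show ?thesis
      proof eventually_elim
        case (elim u)
        then have "(\<Sum>i<p. (t(j := u)) i) < 1" unfolding s by simp
        then show ?case using t j elim by (auto simp: open_simplex_def extensional_def)
      qed
    qed
    have "\<forall>\<^sub>F u in at (t j). \<forall>l\<in>{..<Suc q}. \<bar>a (barycentric p (t(j := u))) l - ?y l\<bar> < \<delta>"
    proof (rule eventually_ball_finite)
      show "\<forall>l\<in>{..<Suc q}. \<forall>\<^sub>F u in at (t j). \<bar>a (barycentric p (t(j := u))) l - ?y l\<bar> < \<delta>"
      proof
        fix l assume "l \<in> {..<Suc q}"
        then have "((\<lambda>u. a (barycentric p (t(j := u))) l) \<longlongrightarrow> a (barycentric p (t(j := t j))) l) (at (t j))"
          using DERIV_isCont[OF V[OF j, of l]] by (simp add: isCont_def)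
        from tendstoD[OF this \<delta>(1)] show "\<forall>\<^sub>F u in at (t j). \<bar>a (barycentric p (t(j := u))) l - ?y l\<bar> < \<delta>"
          by (simp add: dist_real_def)
      qed
    qed simp
    with o have dom: "\<forall>\<^sub>F u in at (t j). t(j := u) \<in> open_simplex p \<and> a (barycentric p (t(j := u))) \<in> simplex_domain q \<sigma> c"
    proof eventually_elim
      case (elim u)
      have "a (barycentric p (t(j := u))) \<in> standard_simplex q" using a barycentric_in_simplex[OF elim(1)] by auto
      moreover from this have "a (barycentric p (t(j := u))) \<in> A"
        using elim(2) standard_simplex_subset by (intro \<delta>(2)) auto
      ultimately show ?case using elim(1) A(2) by auto
    qed
    let ?T = "{u. t(j := u) \<in> {s \<in> open_simplex p. \<tau> (barycentric p s) \<in> fst c}}"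
    have "\<forall>\<^sub>F u in at (t j). u \<in> ?T" using dom by eventually_elim (use \<tau> in auto)
    then have nt: "at (t j) within ?T \<noteq> bot" by (rule eventually_imp_within_nontrivial)
    have "((\<lambda>u. snd c (\<sigma> (a (barycentric p (t(j := u))))) i) has_real_derivative (\<Sum>l<Suc q. L i l * V j l)) (at (t j))"
    proof (rule has_grad_curve[of "Suc q" "simplex_domain q \<sigma> c" "\<lambda>t. snd c (\<sigma> t) i"
          "\<lambda>u. a (barycentric p (t(j := u)))" "t j" "L i" UNIV "V j"])
      show "has_grad (Suc q) (simplex_domain q \<sigma> c) (\<lambda>t. snd c (\<sigma> t) i) (a (barycentric p (t(j := t j)))) (L i)"
        using L by simp
    qed (use dom V j in \<open>auto elim: eventually_mono\<close>)
    moreover have "\<forall>\<^sub>F u in at (t j). snd c (\<sigma> (a (barycentric p (t(j := u))))) i = snd c (\<tau> (barycentric p (t(j := u)))) i"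
      using o by eventually_elim (simp add: \<tau>)
    moreover have "snd c (\<sigma> (a (barycentric p (t(j := t j))))) i = snd c (\<tau> (barycentric p (t(j := t j)))) i"
      using t by (simp add: \<tau>)
    ultimately have "((\<lambda>u. snd c (\<tau> (barycentric p (t(j := u)))) i) has_real_derivative (\<Sum>l<Suc q. L i l * V j l)) (at (t j))"
      by (simp only: has_field_derivative_cong_eventually)
    then have "((\<lambda>u. snd c (\<tau> (barycentric p (t(j := u)))) i) has_vector_derivative (\<Sum>l<Suc q. L i l * V j l)) (at (t j) within ?T)"
      using has_field_derivative_at_within has_real_derivative_iff_has_vector_derivative by blast
    then show ?thesis unfolding partial_deriv_def by (rule vector_derivative_within[OF nt])
  qed
  have "map (\<lambda>j i. partial_deriv {s \<in> open_simplex p. \<tau> (barycentric p s) \<in> fst c} j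
      (\<lambda>s. snd c (\<tau> (barycentric p s)) i) t) [0..<p] = map (\<lambda>j i. \<Sum>l<Suc q. L i l * V j l) [0..<p]"
    using pd by (intro map_cong) auto
  then show ?thesis unfolding integrand_def Let_def \<tau>_def[symmetric] \<tau>[OF t] c[symmetric] by (rule arg_cong)
qed

text \<open>The segments from a point of a simplex to the vertices stay in the simplex, and their directions span
  its tangent space. So a gradient on a simplex acts in a well-defined way on tangent vectors, also at
  boundary points, and it transforms by the tangent map of \<open>f\<close>.\<close>

lemma simplex_gradient_map:
  assumes X: "compact_smooth_manifold X" "c \<in> matlas X" and Y: "compact_smooth_manifold Y" "d \<in> matlas Y"
    and f: "smooth_map X Y f" and \<sigma>: "\<sigma> \<in> smooth_simplices X (int q)"
    and y: "y \<in> standard_simplex q" "\<sigma> y \<in> fst c" "f (\<sigma> y) \<in> fst d"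
    and L: "\<And>i. has_grad (Suc q) (simplex_domain q \<sigma> c) (\<lambda>t. snd c (\<sigma> t) i) y (L i)"
    and K: "\<And>i. has_grad (Suc q) (simplex_domain q (\<lambda>t. f (\<sigma> t)) d) (\<lambda>t. snd d (f (\<sigma> t)) i) y (K i)"
    and v: "(\<Sum>l<Suc q. v l) = 0"
  shows "tangent_map X f c d (\<sigma> y) (\<lambda>i. \<Sum>l<Suc q. L i l * v l) i = (\<Sum>l<Suc q. K i l * v l)"
proof -
  have f\<sigma>: "continuous_map (top_of_set (standard_simplex q)) (mtop Y) (\<lambda>t. f (\<sigma> t))"
    using continuous_map_compose[OF smooth_simplex_continuous[OF \<sigma>], of "mtop Y" f] f
    by (simp add: comp_def smooth_map_def)
  define e where "e k l = unit_vector k l - y l" for k l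
  have span: "(\<Sum>l<Suc q. A l * v l) = (\<Sum>k<Suc q. v k * (\<Sum>l<Suc q. A l * e k l))" for A :: "nat \<Rightarrow> real"
  proof -
    have "(\<Sum>l<Suc q. A l * unit_vector k l) = A k" if "k < Suc q" for k
      using that by (simp add: unit_vector_def if_distrib cong: if_cong)
    then have "(\<Sum>k<Suc q. v k * (\<Sum>l<Suc q. A l * e k l)) = (\<Sum>k<Suc q. v k * (A k - (\<Sum>l<Suc q. A l * y l)))"
      by (intro sum.cong refl) (simp only: e_def right_diff_distrib sum_subtractf lessThan_iff)
    also have "\<dots> = (\<Sum>k<Suc q. A k * v k) - (\<Sum>k<Suc q. v k) * (\<Sum>l<Suc q. A l * y l)"
      by (simp only: right_diff_distrib sum_subtractf sum_distrib_right mult.commute)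
    finally show ?thesis using v by simp
  qed
  have edge: "tangent_map X f c d (\<sigma> y) (\<lambda>i. \<Sum>l<Suc q. L i l * e k l) i = (\<Sum>l<Suc q. K i l * e k l)"
    if k: "k < Suc q" for k
  proof -
    define \<gamma> where "\<gamma> u = (\<lambda>l. y l + u * e k l)" for u
    have g0: "\<gamma> 0 = y" by (simp add: \<gamma>_def)
    have gS: "\<gamma> u \<in> standard_simplex q" if "u \<in> {0..1}" for u
    proof -
      have "unit_vector k \<in> standard_simplex q" using k unfolding unit_vector_def by simp
      then have "(\<lambda>i. (1 - u) * y i + u * unit_vector k i) \<in> standard_simplex q"
        using convex_standard_simplex[of y q "unit_vector k" u] y(1) that by simp
      moreover have "(\<lambda>i. (1 - u) * y i + u * unit_vector k i) = \<gamma> u"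
        by (simp add: \<gamma>_def e_def fun_eq_iff algebra_simps)
      ultimately show ?thesis by simp
    qed
    let ?F = "at (0::real) within {0..1}"
    have ev01: "\<forall>\<^sub>F u in ?F. u \<in> {0..1}" by (simp add: eventually_at_filter)
    have der: "((\<lambda>u. \<gamma> u l) has_real_derivative e k l) ?F" for l
      unfolding \<gamma>_def by (auto intro!: derivative_eq_intros)
    have cg: "continuous_on {0..1} \<gamma>"
      by (rule continuous_on_coordinatewise_then_product) (auto simp: \<gamma>_def intro!: continuous_intros)
    have dom: "\<forall>\<^sub>F u in ?F. \<gamma> u \<in> D" if D: "open A" "D = A \<inter> standard_simplex q" "y \<in> D" for A D
    proof -
      have "(\<gamma> \<longlongrightarrow> \<gamma> 0) ?F" using cg by (simp add: continuous_on_def)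
      moreover have "\<gamma> 0 \<in> A" using g0 D by auto
      ultimately have "\<forall>\<^sub>F u in ?F. \<gamma> u \<in> A" using topological_tendstoD[OF _ D(1)] by blast
      with ev01 show ?thesis by eventually_elim (use D(2) gS in auto)
    qed
    obtain A where A: "open A" "simplex_domain q \<sigma> c = A \<inter> standard_simplex q"
      by (rule continuous_preimage_chart[OF X smooth_simplex_continuous[OF \<sigma>]])
    have domc: "\<forall>\<^sub>F u in ?F. \<gamma> u \<in> simplex_domain q \<sigma> c" by (rule dom[OF A]) (use y in auto)
    obtain B where B: "open B" "simplex_domain q (\<lambda>t. f (\<sigma> t)) d = B \<inter> standard_simplex q"
      by (rule continuous_preimage_chart[OF Y f\<sigma>])
    have domd: "\<forall>\<^sub>F u in ?F. \<gamma> u \<in> simplex_domain q (\<lambda>t. f (\<sigma> t)) d" by (rule dom[OF B]) (use y in auto)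
    have dc: "((\<lambda>u. snd c (\<sigma> (\<gamma> u)) i) has_real_derivative (\<Sum>l<Suc q. L i l * e k l)) ?F" for i
      by (rule has_grad_curve[where f="\<lambda>t. snd c (\<sigma> t) i" and S="simplex_domain q \<sigma> c"])
         (use L g0 domc der in auto)
    have dd: "((\<lambda>u. snd d (f (\<sigma> (\<gamma> u))) i) has_real_derivative (\<Sum>l<Suc q. K i l * e k l)) ?F" for i
      by (rule has_grad_curve[where f="\<lambda>t. snd d (f (\<sigma> t)) i" and S="simplex_domain q (\<lambda>t. f (\<sigma> t)) d"])
         (use K g0 domd der in auto)
    have "\<forall>\<^sub>F u in ?F. \<sigma> (\<gamma> u) \<in> fst c \<and> f (\<sigma> (\<gamma> u)) \<in> fst d"
      using domc domd by eventually_elim auto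
    then have "((\<lambda>u. snd d (f (\<sigma> (\<gamma> u))) i) has_real_derivative
        tangent_map X f c d (\<sigma> (\<gamma> 0)) (\<lambda>i. \<Sum>l<Suc q. L i l * e k l) i) ?F"
      using dc g0 y
      by (intro tangent_map_curve[OF X Y f, where \<gamma>="\<lambda>u. \<sigma> (\<gamma> u)"]) auto
    moreover have "?F \<noteq> bot" using at_within_Icc_at_right[of 0 "1::real"] by simp
    ultimately show ?thesis using dd[of i]
      unfolding g0 has_real_derivative_iff_has_vector_derivative
      by (blast intro: vector_derivative_unique_within)
  qed
  have "tangent_map X f c d (\<sigma> y) (\<lambda>i. \<Sum>l<Suc q. L i l * v l) i =
      (\<Sum>k<Suc q. v k * tangent_map X f c d (\<sigma> y) (\<lambda>i. \<Sum>l<Suc q. L i l * e k l) i)"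
    unfolding tangent_map_def span[of "L _"] sum_distrib_right sum_distrib_left
    by (subst sum.swap) (simp only: mult.assoc)
  also have "\<dots> = (\<Sum>k<Suc q. v k * (\<Sum>l<Suc q. K i l * e k l))"
    by (intro sum.cong refl) (simp only: edge lessThan_iff)
  finally show ?thesis unfolding span[of "K i"] .
qed

lemma simplex_gradient_change:
  assumes X: "compact_smooth_manifold X" "c \<in> matlas X" "d \<in> matlas X"
    and \<sigma>: "\<sigma> \<in> smooth_simplices X (int q)" and y: "y \<in> standard_simplex q" "\<sigma> y \<in> fst c" "\<sigma> y \<in> fst d"
    and L: "\<And>i. has_grad (Suc q) (simplex_domain q \<sigma> c) (\<lambda>t. snd c (\<sigma> t) i) y (L i)"
    and K: "\<And>i. has_grad (Suc q) (simplex_domain q \<sigma> d) (\<lambda>t. snd d (\<sigma> t) i) y (K i)"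
    and v: "(\<Sum>l<Suc q. v l) = 0"
  shows "tangent_change X c d (\<sigma> y) (\<lambda>i. \<Sum>l<Suc q. L i l * v l) i = (\<Sum>l<Suc q. K i l * v l)"
  unfolding tangent_change_eq
  by (rule simplex_gradient_map[OF X(1,2) X(1,3) smooth_map_ident[OF X(1)] \<sigma> y L K v])

lemma simplex_gradient_in_coord_space:
  assumes X: "compact_smooth_manifold X" "c \<in> matlas X"
    and \<sigma>: "\<sigma> \<in> smooth_simplices X (int q)" and y: "y \<in> standard_simplex q" "\<sigma> y \<in> fst c"
    and L: "\<And>i. has_grad (Suc q) (simplex_domain q \<sigma> c) (\<lambda>t. snd c (\<sigma> t) i) y (L i)"
    and v: "(\<Sum>l<Suc q. v l) = 0"
  shows "(\<lambda>i. \<Sum>l<Suc q. L i l * v l) \<in> coord_space (mdim X)"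
proof -
  have eq: "tangent_change X c c (\<sigma> y) (\<lambda>i. \<Sum>l<Suc q. L i l * v l) = (\<lambda>i. \<Sum>l<Suc q. L i l * v l)"
    by (rule ext, rule simplex_gradient_change[OF X X(2) \<sigma> y y(2) L L v])
  have "tangent_change X c c (\<sigma> y) (\<lambda>i. \<Sum>l<Suc q. L i l * v l) \<in> coord_space (mdim X)"
    unfolding tangent_change_eq
    by (rule tangent_map_in_coord_space[OF X X, where f="\<lambda>p. p"]) (use y in auto)
  then show ?thesis unfolding eq .
qed

text \<open>The value of \<open>\<omega>\<close> at \<open>\<sigma>(y)\<close> on the images under \<open>d\<sigma>\<close> of fixed tangent vectors \<open>V\<close> of the simplex. In
  contrast to the integrand it is meaningful on the closed simplex.\<close>

definition form_along ::
    "'a smooth_manifold \<Rightarrow> nat \<Rightarrow> 'a diff_form \<Rightarrow> nat \<Rightarrow> ((nat \<Rightarrow> real) \<Rightarrow> 'a) \<Rightarrow> (nat \<Rightarrow> nat \<Rightarrow> real) \<Rightarrow>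
     (nat \<Rightarrow> real) \<Rightarrow> real" where
  "form_along X p \<omega> q \<sigma> V y =
     (let c = (SOME c. c \<in> matlas X \<and> \<sigma> y \<in> fst c);
          L = (\<lambda>i. SOME L. has_grad (Suc q) (simplex_domain q \<sigma> c) (\<lambda>t. snd c (\<sigma> t) i) y L)
      in \<omega> c (\<sigma> y) (map (\<lambda>j i. \<Sum>l<Suc q. L i l * V j l) [0..<p]))"

lemma simplex_has_grad:
  assumes "compact_smooth_manifold X" "c \<in> matlas X" "\<sigma> \<in> smooth_simplices X (int q)"
    "y \<in> standard_simplex q" "\<sigma> y \<in> fst c"
  shows "\<exists>L. has_grad (Suc q) (simplex_domain q \<sigma> c) (\<lambda>t. snd c (\<sigma> t) i) y L"
  using smooth_on_has_grad[OF smooth_simplex_coord[OF assms(1-3)], of y i] assms(4,5) by blast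

text \<open>Neither the chart nor the gradients chosen in the definition matter on tangent vectors. So near a given
  point they may be replaced by a fixed chart and by gradients that vary smoothly.\<close>

lemma form_along_chart:
  assumes X: "compact_smooth_manifold X" "d \<in> matlas X" and \<omega>: "smooth_form X p \<omega>"
    and \<sigma>: "\<sigma> \<in> smooth_simplices X (int q)" and y: "y \<in> standard_simplex q" "\<sigma> y \<in> fst d"
    and V: "\<And>j. j < p \<Longrightarrow> (\<Sum>l<Suc q. V j l) = 0"
    and K: "\<And>i. has_grad (Suc q) (simplex_domain q \<sigma> d) (\<lambda>t. snd d (\<sigma> t) i) y (K i)"
  shows "form_along X p \<omega> q \<sigma> V y = \<omega> d (\<sigma> y) (map (\<lambda>j i. \<Sum>l<Suc q. K i l * V j l) [0..<p])"
proof -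
  define c where "c = (SOME c. c \<in> matlas X \<and> \<sigma> y \<in> fst c)"
  have c: "c \<in> matlas X" "\<sigma> y \<in> fst c"
    using someI[where P="\<lambda>c. c \<in> matlas X \<and> \<sigma> y \<in> fst c", of d] X y unfolding c_def by auto
  define L where "L i = (SOME L. has_grad (Suc q) (simplex_domain q \<sigma> c) (\<lambda>t. snd c (\<sigma> t) i) y L)" for i
  have L: "has_grad (Suc q) (simplex_domain q \<sigma> c) (\<lambda>t. snd c (\<sigma> t) i) y (L i)" for i
    unfolding L_def by (rule someI_ex[OF simplex_has_grad[OF X(1) c(1) \<sigma> y(1) c(2)]])
  let ?ws = "map (\<lambda>j i. \<Sum>l<Suc q. L i l * V j l) [0..<p]"
  have "set ?ws \<subseteq> coord_space (mdim X)"
    using simplex_gradient_in_coord_space[OF X(1) c(1) \<sigma> y(1) c(2) L V] by auto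
  then have "\<omega> c (\<sigma> y) ?ws = \<omega> d (\<sigma> y) (map (tangent_change X c d (\<sigma> y)) ?ws)"
    by (intro smooth_form_change[OF \<omega> c(1) X(2) c(2) y(2)]) simp
  also have "map (tangent_change X c d (\<sigma> y)) ?ws = map (\<lambda>j i. \<Sum>l<Suc q. K i l * V j l) [0..<p]"
    using simplex_gradient_change[OF X(1) c(1) X(2) \<sigma> y(1) c(2) y(2) L K V] by (auto simp: comp_def)
  finally show ?thesis unfolding form_along_def c_def[symmetric] Let_def L_def[symmetric] .
qed

lemma form_along_smooth:
  assumes X: "compact_smooth_manifold X" and \<omega>: "smooth_form X p \<omega>"
    and \<sigma>: "\<sigma> \<in> smooth_simplices X (int q)"
    and V: "\<And>j. j < p \<Longrightarrow> (\<Sum>l<Suc q. V j l) = 0"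
  shows "smooth_on (Suc q) (standard_simplex q) (form_along X p \<omega> q \<sigma> V)"
proof (rule smooth_on_local[OF standard_simplex_subset])
  fix y assume y: "y \<in> standard_simplex q"
  obtain d where d: "d \<in> matlas X" "\<sigma> y \<in> fst d"
    using chart_cover[OF X smooth_simplex_in_space[OF \<sigma> y]] by blast
  let ?S = "simplex_domain q \<sigma> d" and ?m = "mdim X"
  have yS: "y \<in> ?S" using y d by auto
  have "\<forall>i. \<exists>U L. openin (Euclidean_space (Suc q)) U \<and> y \<in> U \<and>
      (\<forall>l<Suc q. smooth_on (Suc q) (?S \<inter> U) (\<lambda>y. L y l)) \<and>
      (\<forall>z\<in>?S \<inter> U. has_grad (Suc q) ?S (\<lambda>t. snd d (\<sigma> t) i) z (L z))"
  proof
    fix i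
    obtain U L where "openin (Euclidean_space (Suc q)) U" "y \<in> U"
      "\<And>l. l < Suc q \<Longrightarrow> smooth_on (Suc q) (?S \<inter> U) (\<lambda>y. L y l)"
      "\<And>z. z \<in> ?S \<inter> U \<Longrightarrow> has_grad (Suc q) ?S (\<lambda>t. snd d (\<sigma> t) i) z (L z)"
      by (fact smooth_on_gradient[OF smooth_simplex_coord[OF X d(1) \<sigma>] yS])
    then show "\<exists>U L. openin (Euclidean_space (Suc q)) U \<and> y \<in> U \<and>
      (\<forall>l<Suc q. smooth_on (Suc q) (?S \<inter> U) (\<lambda>y. L y l)) \<and>
      (\<forall>z\<in>?S \<inter> U. has_grad (Suc q) ?S (\<lambda>t. snd d (\<sigma> t) i) z (L z))"
      by (intro exI conjI allI impI ballI) assumption+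
  qed
  from choice[OF this] obtain U where "\<forall>i. \<exists>L. openin (Euclidean_space (Suc q)) (U i) \<and> y \<in> U i \<and>
      (\<forall>l<Suc q. smooth_on (Suc q) (?S \<inter> U i) (\<lambda>y. L y l)) \<and>
      (\<forall>z\<in>?S \<inter> U i. has_grad (Suc q) ?S (\<lambda>t. snd d (\<sigma> t) i) z (L z))" by blast
  from choice[OF this] obtain L where "\<forall>i. openin (Euclidean_space (Suc q)) (U i) \<and> y \<in> U i \<and>
      (\<forall>l<Suc q. smooth_on (Suc q) (?S \<inter> U i) (\<lambda>y. L i y l)) \<and>
      (\<forall>z\<in>?S \<inter> U i. has_grad (Suc q) ?S (\<lambda>t. snd d (\<sigma> t) i) z (L i z))" by blast
  then have U: "\<And>i. openin (Euclidean_space (Suc q)) (U i)" "\<And>i. y \<in> U i"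
    and L: "\<And>i l. l < Suc q \<Longrightarrow> smooth_on (Suc q) (?S \<inter> U i) (\<lambda>y. L i y l)"
    "\<And>i z. z \<in> ?S \<Longrightarrow> z \<in> U i \<Longrightarrow> has_grad (Suc q) ?S (\<lambda>t. snd d (\<sigma> t) i) z (L i z)" by auto
  obtain A where A: "open A" "?S = A \<inter> standard_simplex q"
    by (rule continuous_preimage_chart[OF X d(1) smooth_simplex_continuous[OF \<sigma>]])
  define W where "W = (A \<inter> coord_space (Suc q)) \<inter> (\<Inter>i\<in>{..<Suc ?m}. U i)"
  have "openin (Euclidean_space (Suc q)) (\<Inter>i\<in>{..<Suc ?m}. U i)" using U by (intro openin_INT2) auto
  moreover have "openin (Euclidean_space (Suc q)) (A \<inter> coord_space (Suc q))" using A(1) openin_coord_space by blast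
  ultimately have W: "openin (Euclidean_space (Suc q)) W" unfolding W_def by blast
  have yW: "y \<in> W" using U(2) A yS y standard_simplex_subset by (auto simp: W_def)
  have SW: "standard_simplex q \<inter> W \<subseteq> ?S" using A by (auto simp: W_def)
  have sub: "standard_simplex q \<inter> W \<subseteq> coord_space (Suc q)" by (auto simp: W_def)
  let ?C = "\<lambda>js z. \<omega> d (\<sigma> z) (map unit_vector js)"
  have "smooth_on (Suc q) (standard_simplex q \<inter> W)
      (\<lambda>z. \<Sum>js\<in>index_lists ?m p. (\<Prod>r<p. \<Sum>l<Suc q. L (js ! r) z l * V r l) * ?C js z)"
  proof (intro smooth_on_sum[OF sub] smooth_on_mult smooth_on_prod[OF sub] smooth_on_const[OF sub])
    fix js r l assume "js \<in> index_lists ?m p" "r \<in> {..<p}" "l \<in> {..<Suc q}"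
    then have "js ! r \<in> set js" "set js \<subseteq> {..<?m}" "l < Suc q" by (auto simp: index_lists_def)
    then have "js ! r < Suc ?m" "l < Suc q" by auto
    then show "smooth_on (Suc q) (standard_simplex q \<inter> W) (\<lambda>z. L (js ! r) z l)"
      using SW by (intro smooth_on_subset[OF L(1)]) (auto simp: W_def)
  next
    fix js assume js: "js \<in> index_lists ?m p"
    have "smooth_on (Suc q) (standard_simplex q \<inter> W)
        (\<lambda>z. \<omega> d (chart_inv d (snd d (\<sigma> z))) (map unit_vector js))"
      by (rule smooth_on_compose[OF smooth_form_coeff[OF \<omega> d(1) js] smooth_on_subset[OF smooth_simplex_coord[OF X d(1) \<sigma>] SW] _ sub])
         (use SW in auto)
    then show "smooth_on (Suc q) (standard_simplex q \<inter> W) (?C js)"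
      by (rule smooth_on_cong) (use SW chart_inv_left[OF X d(1)] in auto)
  qed
  moreover have "(\<Sum>js\<in>index_lists ?m p. (\<Prod>r<p. \<Sum>l<Suc q. L (js ! r) z l * V r l) * ?C js z) =
      form_along X p \<omega> q \<sigma> V z" if z: "z \<in> standard_simplex q \<inter> W" for z
  proof -
    have zS: "z \<in> ?S" using SW z by auto
    \<comment> \<open>Only finitely many \<open>U i\<close> were intersected; the components from \<open>mdim X\<close> on are constantly \<open>0\<close>.\<close>
    define K where "K i = (if i < ?m then L i z else (\<lambda>_. 0))" for i
    have K: "has_grad (Suc q) ?S (\<lambda>t. snd d (\<sigma> t) i) z (K i)" for i
    proof (cases "i < ?m")
      case True
      then show ?thesis using L(2)[OF zS, of i] z by (auto simp: K_def W_def)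
    next
      case False
      have "snd d (\<sigma> t) i = 0" if "t \<in> ?S" for t
      proof -
        have "snd d (\<sigma> t) \<in> coord_space ?m" using that chart_in_coord_space[OF X d(1)] by blast
        then show ?thesis using False by (simp add: coord_space_iff)
      qed
      then show ?thesis using zS False unfolding has_grad_def K_def
        by (intro allI impI exI[where x=1] conjI ballI) (auto simp: sum_nonneg)
    qed
    let ?vs = "map (\<lambda>j i. \<Sum>l<Suc q. K i l * V j l) [0..<p]"
    have zs: "z \<in> standard_simplex q" "\<sigma> z \<in> fst d" using zS by auto
    have "form_along X p \<omega> q \<sigma> V z = \<omega> d (\<sigma> z) ?vs"
      by (rule form_along_chart[OF X d(1) \<omega> \<sigma> zs V K])
    also have "\<dots> = (\<Sum>js\<in>index_lists ?m p. (\<Prod>r<p. (?vs ! r) (js ! r)) * ?C js z)"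
    proof (rule alternating_form_expand[OF smooth_form_alternating[OF \<omega> d(1) zs(2)]])
      show "set ?vs \<subseteq> coord_space ?m"
        using simplex_gradient_in_coord_space[OF X d(1) \<sigma> zs K V] by auto
    qed simp
    also have "\<dots> = (\<Sum>js\<in>index_lists ?m p. (\<Prod>r<p. \<Sum>l<Suc q. L (js ! r) z l * V r l) * ?C js z)"
    proof (intro sum.cong prod.cong arg_cong2[where f="(*)"] refl)
      fix js r assume "js \<in> index_lists ?m p" "r \<in> {..<p}"
      then have "js ! r \<in> set js" "set js \<subseteq> {..<?m}" "r < p" by (auto simp: index_lists_def)
      then have "js ! r < ?m" "r < p" by auto
      then show "(?vs ! r) (js ! r) = (\<Sum>l<Suc q. L (js ! r) z l * V r l)"
        by (simp add: K_def del: sum.lessThan_Suc)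
    qed
    finally show ?thesis by simp
  qed
  ultimately have "smooth_on (Suc q) (standard_simplex q \<inter> W) (form_along X p \<omega> q \<sigma> V)"
    by (rule smooth_on_cong)
  with W yW show "\<exists>U. openin (Euclidean_space (Suc q)) U \<and> y \<in> U \<and>
      smooth_on (Suc q) (standard_simplex q \<inter> U) (form_along X p \<omega> q \<sigma> V)" by blast
qed

lemma alternating_form_scale:
  assumes T: "alternating_form n p T" and w: "\<And>j. j < p \<Longrightarrow> w j \<in> coord_space n"
  shows "T (map (\<lambda>j i. s * w j i) [0..<p]) = s ^ p * T (map w [0..<p])"
proof -
  have "T (map w [0..<p]) = (\<Sum>js\<in>index_lists n p. (\<Prod>r<p. (map w [0..<p] ! r) (js ! r)) * T (map unit_vector js))"
    using w by (intro alternating_form_expand[OF T]) auto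
  moreover have "(\<lambda>i. s * w j i) \<in> coord_space n" if "j < p" for j
    using w[OF that] by (simp add: coord_space_iff)
  then have "T (map (\<lambda>j i. s * w j i) [0..<p]) =
      (\<Sum>js\<in>index_lists n p. (\<Prod>r<p. (map (\<lambda>j i. s * w j i) [0..<p] ! r) (js ! r)) * T (map unit_vector js))"
    by (intro alternating_form_expand[OF T]) auto
  ultimately show ?thesis by (simp add: prod.distrib sum_distrib_left mult.assoc)
qed

text \<open>If the velocities of \<open>a\<close> are \<open>s\<close> times fixed vectors, the factors \<open>s\<close> come out of the form. This
  separates the dependence on the scale from a function on the simplex that does not involve \<open>s\<close>.\<close>

lemma integrand_form_along:
  assumes X: "compact_smooth_manifold X" and \<omega>: "smooth_form X p \<omega>" and \<sigma>: "\<sigma> \<in> smooth_simplices X (int q)"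
    and a: "a ` standard_simplex p \<subseteq> standard_simplex q" and t: "t \<in> open_simplex p"
    and D: "\<And>j l. j < p \<Longrightarrow> l < Suc q \<Longrightarrow>
      ((\<lambda>u. a (barycentric p (t(j := u))) l) has_real_derivative s * V j l) (at (t j))"
    and V: "\<And>j. j < p \<Longrightarrow> (\<Sum>l<Suc q. V j l) = 0"
  shows "integrand X p \<omega> (restrict (\<sigma> \<circ> a) (standard_simplex p)) t =
    s ^ p * form_along X p \<omega> q \<sigma> V (a (barycentric p t))"
proof -
  let ?y = "a (barycentric p t)"
  have y: "?y \<in> standard_simplex q" using a barycentric_in_simplex[OF t] by auto
  define c where "c = (SOME c. c \<in> matlas X \<and> \<sigma> ?y \<in> fst c)"
  have "\<exists>c. c \<in> matlas X \<and> \<sigma> ?y \<in> fst c" using chart_cover[OF X] smooth_simplex_in_space[OF \<sigma> y] by blast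
  from someI_ex[OF this] have c: "c \<in> matlas X" "\<sigma> ?y \<in> fst c" unfolding c_def by auto
  from simplex_has_grad[OF X c(1) \<sigma> y c(2)]
  have "\<forall>i. \<exists>L. has_grad (Suc q) (simplex_domain q \<sigma> c) (\<lambda>t. snd c (\<sigma> t) i) ?y L" by blast
  from choice[OF this] obtain L where L: "\<And>i. has_grad (Suc q) (simplex_domain q \<sigma> c) (\<lambda>t. snd c (\<sigma> t) i) ?y (L i)"
    by blast
  have "integrand X p \<omega> (restrict (\<sigma> \<circ> a) (standard_simplex p)) t =
      \<omega> c (\<sigma> ?y) (map (\<lambda>j i. \<Sum>l<Suc q. L i l * (s * V j l)) [0..<p])"
    by (rule integrand_gradient[OF X \<sigma> a t D c_def L])
  also have "(\<lambda>j i. \<Sum>l<Suc q. L i l * (s * V j l)) = (\<lambda>j i. s * (\<Sum>l<Suc q. L i l * V j l))"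
    by (simp only: sum_distrib_left mult.left_commute)
  also have "\<omega> c (\<sigma> ?y) (map (\<lambda>j i. s * (\<Sum>l<Suc q. L i l * V j l)) [0..<p]) =
      s ^ p * \<omega> c (\<sigma> ?y) (map (\<lambda>j i. \<Sum>l<Suc q. L i l * V j l) [0..<p])"
    by (rule alternating_form_scale[OF smooth_form_alternating[OF \<omega> c]
          simplex_gradient_in_coord_space[OF X c(1) \<sigma> y c(2) L V]])
  also have "\<omega> c (\<sigma> ?y) (map (\<lambda>j i. \<Sum>l<Suc q. L i l * V j l) [0..<p]) = form_along X p \<omega> q \<sigma> V ?y"
    by (rule form_along_chart[OF X c(1) \<omega> \<sigma> y c(2) V L, symmetric])
  finally show ?thesis .
qed

section \<open>Integrals along shrinking simplices\<close>

abbreviation param_measure :: "nat \<Rightarrow> (nat \<Rightarrow> real) measure" where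
  "param_measure p \<equiv> PiM {..<p} (\<lambda>_. lborel)"

lemma open_simplex_sets: "open_simplex p \<in> sets (param_measure p)"
proof -
  have "open_simplex p = {t \<in> space (param_measure p). (\<forall>i<p. 0 < t i) \<and> (\<Sum>i<p. t i) < 1}"
    by (auto simp: open_simplex_def space_PiM PiE_def)
  also have "\<dots> = {t \<in> space (param_measure p). \<forall>i\<in>{..<p}. 0 < t i} \<inter> {t \<in> space (param_measure p). (\<Sum>i\<in>{..<p}. t i) < 1}"
    by auto
  also have "\<dots> \<in> sets (param_measure p)" by (intro sets.Int) measurable
  finally show ?thesis .
qed

lemma emeasure_open_simplex: "emeasure (param_measure p) (open_simplex p) < \<infinity>"
proof -
  interpret product_sigma_finite "\<lambda>_::nat. lborel :: real measure" by standard
  have le: "t i \<le> 1" if "\<forall>i<p. 0 < t i" "(\<Sum>i<p. t i) < 1" "i < p" for t :: "nat \<Rightarrow> real" and i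
  proof -
    have "t i \<le> (\<Sum>i<p. t i)" using that by (intro member_le_sum) (auto intro: less_imp_le)
    then show ?thesis using that by simp
  qed
  have "open_simplex p \<subseteq> (\<Pi>\<^sub>E i\<in>{..<p}. {0..1})"
  proof
    fix t assume "t \<in> open_simplex p"
    then have t: "t \<in> extensional {..<p}" "\<forall>i<p. 0 < t i" "(\<Sum>i<p. t i) < 1" by (auto simp: open_simplex_def)
    then have "t i \<in> {0..1}" if "i < p" for i using le[OF t(2,3) that] that by (auto intro: less_imp_le)
    then show "t \<in> (\<Pi>\<^sub>E i\<in>{..<p}. {0..1})" using t(1) by (auto simp: PiE_def)
  qed
  then have "emeasure (param_measure p) (open_simplex p) \<le> emeasure (param_measure p) (\<Pi>\<^sub>E i\<in>{..<p}. {0..1})"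
    by (rule emeasure_mono) (auto intro!: sets_PiM_I_finite)
  also have "\<dots> = (\<Prod>i<p. emeasure lborel {0..1::real})" by (rule emeasure_PiM) auto
  also have "\<dots> = 1" by simp
  finally show ?thesis by (simp add: le_less_trans[of _ 1])
qed

lemma barycentric_measurable: "barycentric p \<in> measurable (param_measure p) borel"
proof (rule measurable_coordinatewise_then_product)
  fix i
  show "(\<lambda>t. barycentric p t i) \<in> measurable (param_measure p) borel"
  proof (cases "i = 0")
    case True
    have "(\<lambda>t. 1 - (\<Sum>j\<in>{..<p}. t j)) \<in> measurable (param_measure p) borel" by measurable
    with True show ?thesis by (simp add: barycentric_def)
  next
    case False
    show ?thesis
    proof (cases "i \<le> p")
      case True
      then have "i - 1 \<in> {..<p}" using False by auto
      then have "(\<lambda>t. t (i - 1)) \<in> measurable (param_measure p) borel" by measurable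
      with True False show ?thesis by (simp add: barycentric_def)
    qed (use False in \<open>simp add: barycentric_def\<close>)
  qed
qed

lemma compact_standard_simplex: "compact (standard_simplex p)"
  using compactin_standard_simplex[of p] by (simp add: euclidean_product_topology)

text \<open>The homothety of ratio \<open>s\<close> towards the vertex \<open>0\<close>.\<close>

definition shrink :: "real \<Rightarrow> (nat \<Rightarrow> real) \<Rightarrow> nat \<Rightarrow> real" where
  "shrink s y = (\<lambda>l. (1 - s) * unit_vector 0 l + s * y l)"

lemma shrink_simplex:
  assumes "0 \<le> s" "s \<le> 1"
  shows "shrink s ` standard_simplex q \<subseteq> standard_simplex q"
proof -
  have "unit_vector 0 \<in> standard_simplex q" unfolding unit_vector_def by simp
  then show ?thesis unfolding shrink_def using convex_standard_simplex assms by auto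
qed

lemma smooth_on_shrink: "smooth_on (Suc q) (standard_simplex q) (\<lambda>t. shrink s t j)"
  unfolding shrink_def
  by (intro smooth_on_add smooth_on_mult smooth_on_const smooth_on_coord standard_simplex_subset)

text \<open>The data of an affine map \<open>b\<close> between simplices that the integral over \<open>\<sigma> \<circ> b\<close> depends on:
  \<open>V j\<close> is the image under \<open>b\<close> of the \<open>j\<close>-th coordinate direction.\<close>

definition affine_simplex_map ::
    "nat \<Rightarrow> nat \<Rightarrow> ((nat \<Rightarrow> real) \<Rightarrow> nat \<Rightarrow> real) \<Rightarrow> (nat \<Rightarrow> nat \<Rightarrow> real) \<Rightarrow> bool" where
  "affine_simplex_map p q b V \<longleftrightarrow> continuous_on UNIV b \<and> b ` standard_simplex p \<subseteq> standard_simplex q \<and>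
     (\<forall>t\<in>open_simplex p. \<forall>j<p. \<forall>l<Suc q. ((\<lambda>u. b (barycentric p (t(j := u))) l) has_real_derivative V j l) (at (t j))) \<and>
     (\<forall>j<p. (\<Sum>l<Suc q. V j l) = 0)"

lemma affine_simplex_map_id: "affine_simplex_map p p (\<lambda>y. y) bary_dir"
  unfolding affine_simplex_map_def
  using barycentric_derivative sum_bary_dir by auto

lemma affine_simplex_map_face:
  assumes k: "k \<le> Suc p"
  shows "affine_simplex_map p (Suc p) (simplical_face k) (\<lambda>j. simplical_face k (bary_dir j))"
  unfolding affine_simplex_map_def
proof (intro conjI ballI allI impI)
  show "continuous_on UNIV (simplical_face k :: (nat \<Rightarrow> real) \<Rightarrow> _)"
  proof (rule continuous_on_coordinatewise_then_product)
    fix i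
    show "continuous_on UNIV (\<lambda>x::nat \<Rightarrow> real. simplical_face k x i)"
      unfolding simplical_face_def by (cases "i < k"; cases "i = k") (simp_all add: continuous_on_coord)
  qed
  show "simplical_face k ` standard_simplex p \<subseteq> standard_simplex (Suc p)"
    using simplical_face_in_standard_simplex[of "Suc p" k] k by auto
next
  fix t j l assume "j < p"
  then show "((\<lambda>u. simplical_face k (barycentric p (t(j := u))) l) has_real_derivative simplical_face k (bary_dir j) l) (at (t j))"
    unfolding simplical_face_def
    by (cases "l < k"; cases "l = k") (simp_all add: barycentric_derivative)
next
  fix j assume j: "j < p"
  have "(\<Sum>l<Suc (Suc p). simplical_face k f l) = (\<Sum>l<Suc p. f l)" for f :: "nat \<Rightarrow> real"
  proof -
    have "(\<Sum>l<Suc (Suc p). simplical_face k f l) = (\<Sum>l\<in>{..<Suc (Suc p)} - {k}. simplical_face k f l)"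
      by (rule sum.mono_neutral_right) (auto simp: simplical_face_def)
    also have "\<dots> = (\<Sum>l<Suc p. f l)"
      by (rule sum.reindex_bij_witness[where i="\<lambda>l. if l < k then l else Suc l" and j="\<lambda>l. if l < k then l else l - 1"])
         (use k in \<open>auto simp: simplical_face_def\<close>)
    finally show ?thesis .
  qed
  then show "(\<Sum>l<Suc (Suc p). simplical_face k (bary_dir j) l) = 0" using sum_bary_dir[OF j] by simp
qed

lemma integrand_shrink:
  assumes X: "compact_smooth_manifold X" and \<omega>: "smooth_form X p \<omega>" and \<sigma>: "\<sigma> \<in> smooth_simplices X (int q)"
    and b: "affine_simplex_map p q b V" and s: "0 \<le> s" "s \<le> 1" and t: "t \<in> open_simplex p"
  shows "integrand X p \<omega> (restrict (\<sigma> \<circ> (\<lambda>y. shrink s (b y))) (standard_simplex p)) t =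
    s ^ p * form_along X p \<omega> q \<sigma> V (shrink s (b (barycentric p t)))"
proof (rule integrand_form_along[OF X \<omega> \<sigma> _ t])
  show "(\<lambda>y. shrink s (b y)) ` standard_simplex p \<subseteq> standard_simplex q"
    using b shrink_simplex[OF s, of q] unfolding affine_simplex_map_def by blast
next
  fix j l assume "j < p" "l < Suc q"
  then have "((\<lambda>u. b (barycentric p (t(j := u))) l) has_real_derivative V j l) (at (t j))"
    using b t unfolding affine_simplex_map_def by blast
  then show "((\<lambda>u. shrink s (b (barycentric p (t(j := u)))) l) has_real_derivative s * V j l) (at (t j))"
    unfolding shrink_def by (auto intro!: derivative_eq_intros)
qed (use b in \<open>simp add: affine_simplex_map_def\<close>)

lemma form_along_pullback_measurable:
  assumes X: "compact_smooth_manifold X" and \<omega>: "smooth_form X p \<omega>" and \<sigma>: "\<sigma> \<in> smooth_simplices X (int q)"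
    and b: "affine_simplex_map p q b V" and s: "0 \<le> s" "s \<le> 1"
  shows "(\<lambda>t. indicator (open_simplex p) t * form_along X p \<omega> q \<sigma> V (shrink s (b (barycentric p t))))
    \<in> borel_measurable (param_measure p)"
proof -
  let ?\<Psi> = "form_along X p \<omega> q \<sigma> V"
  have "continuous_on (standard_simplex q) ?\<Psi>"
    using form_along_smooth[OF X \<omega> \<sigma>, of V] b smooth_on_continuous unfolding affine_simplex_map_def by blast
  then have M: "(\<lambda>y. indicator (standard_simplex q) y *\<^sub>R ?\<Psi> y) \<in> borel_measurable borel"
    using compact_imp_closed[OF compact_standard_simplex] by (intro borel_measurable_continuous_on_indicator) auto
  have "continuous_on UNIV (\<lambda>y. shrink s (b y))"
  proof (rule continuous_on_coordinatewise_then_product)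
    fix l
    have "continuous_on UNIV (\<lambda>y. b y l)"
      using b unfolding affine_simplex_map_def by (auto intro: continuous_on_product_then_coordinatewise)
    then show "continuous_on UNIV (\<lambda>y. shrink s (b y) l)"
      unfolding shrink_def by (intro continuous_intros)
  qed
  then have "(\<lambda>y. shrink s (b y)) \<in> measurable borel borel" by (rule borel_measurable_continuous_onI)
  from measurable_compose[OF measurable_compose[OF barycentric_measurable this] M]
  have "(\<lambda>t. indicator (open_simplex p) t * (indicator (standard_simplex q) (shrink s (b (barycentric p t))) *\<^sub>R
      ?\<Psi> (shrink s (b (barycentric p t))))) \<in> borel_measurable (param_measure p)"
    using open_simplex_sets by (intro borel_measurable_times borel_measurable_indicator) auto
  moreover have "(\<lambda>t. indicator (open_simplex p) t * (indicator (standard_simplex q) (shrink s (b (barycentric p t))) *\<^sub>R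
      ?\<Psi> (shrink s (b (barycentric p t))))) =
      (\<lambda>t. indicator (open_simplex p) t * ?\<Psi> (shrink s (b (barycentric p t))))"
  proof
    fix t
    show "indicator (open_simplex p) t * (indicator (standard_simplex q) (shrink s (b (barycentric p t))) *\<^sub>R
      ?\<Psi> (shrink s (b (barycentric p t)))) =
      indicator (open_simplex p) t * ?\<Psi> (shrink s (b (barycentric p t)))"
  proof (cases "t \<in> open_simplex p")
    case True
    then have "shrink s (b (barycentric p t)) \<in> standard_simplex q"
      using b shrink_simplex[OF s] barycentric_in_simplex[OF True] unfolding affine_simplex_map_def by blast
    then show ?thesis by simp
  qed simp
  qed
  ultimately show ?thesis by (simp only:)
qed

lemma form_along_bounded:
  assumes "compact_smooth_manifold X" "smooth_form X p \<omega>" "\<sigma> \<in> smooth_simplices X (int q)"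
    and "affine_simplex_map p q b V"
  obtains B where "\<And>y. y \<in> standard_simplex q \<Longrightarrow> \<bar>form_along X p \<omega> q \<sigma> V y\<bar> \<le> B"
proof -
  have "continuous_on (standard_simplex q) (form_along X p \<omega> q \<sigma> V)"
    using form_along_smooth[OF assms(1-3), of V] assms(4) smooth_on_continuous unfolding affine_simplex_map_def by blast
  then have "bounded (form_along X p \<omega> q \<sigma> V ` standard_simplex q)"
    using compact_continuous_image compact_imp_bounded compact_standard_simplex by blast
  then obtain B where "\<forall>z\<in>form_along X p \<omega> q \<sigma> V ` standard_simplex q. norm z \<le> B" by (auto simp: bounded_iff)
  then show ?thesis using that[of B] by simp
qed

lemma integrable_open_simplex_const: "integrable (param_measure p) (\<lambda>t. B * indicator (open_simplex p) t :: real)"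
  using open_simplex_sets emeasure_open_simplex by (intro integrable_mult_right integrable_real_indicator) auto

text \<open>On the open simplex, which has finite measure, the integrand coincides with a function that is continuous
  on the compact closed simplex.\<close>

lemma integrand_integrable:
  assumes X: "compact_smooth_manifold X" and \<omega>: "smooth_form X p \<omega>" and \<sigma>: "\<sigma> \<in> smooth_simplices X (int p)"
  shows "set_integrable (param_measure p) (open_simplex p) (integrand X p \<omega> \<sigma>)"
proof -
  let ?\<Psi> = "form_along X p \<omega> p \<sigma> bary_dir"
  have ext: "restrict (\<sigma> \<circ> (\<lambda>y. shrink 1 y)) (standard_simplex p) = \<sigma>"
    using \<sigma> by (auto simp: smooth_simplices_int singular_simplex_def shrink_def fun_eq_iff extensional_def)
  have eq: "integrand X p \<omega> \<sigma> t = ?\<Psi> (shrink 1 (barycentric p t))" if "t \<in> open_simplex p" for t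
    using integrand_shrink[OF X \<omega> \<sigma> affine_simplex_map_id, of 1 t] that ext by simp
  obtain B where B: "\<And>y. y \<in> standard_simplex p \<Longrightarrow> \<bar>?\<Psi> y\<bar> \<le> B"
    by (fact form_along_bounded[OF X \<omega> \<sigma> affine_simplex_map_id])
  have "integrable (param_measure p) (\<lambda>t. indicator (open_simplex p) t * ?\<Psi> (shrink 1 (barycentric p t)))"
  proof (rule Bochner_Integration.integrable_bound[OF integrable_open_simplex_const[of p B]])
    show "(\<lambda>t. indicator (open_simplex p) t * ?\<Psi> (shrink 1 (barycentric p t))) \<in> borel_measurable (param_measure p)"
      by (rule form_along_pullback_measurable[OF X \<omega> \<sigma> affine_simplex_map_id]) auto
    show "AE t in param_measure p. norm (indicator (open_simplex p) t * ?\<Psi> (shrink 1 (barycentric p t)))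
        \<le> norm (B * indicator (open_simplex p) t)"
    proof (rule AE_I2)
      fix t
      show "norm (indicator (open_simplex p) t * ?\<Psi> (shrink 1 (barycentric p t))) \<le> norm (B * indicator (open_simplex p) t)"
      proof (cases "t \<in> open_simplex p")
        case True
        have "shrink 1 (barycentric p t) \<in> standard_simplex p"
          using shrink_simplex[of 1 p] barycentric_in_simplex[OF True] by auto
        from B[OF this] show ?thesis using True by simp
      qed simp
    qed
  qed
  moreover have "(\<lambda>t. indicator (open_simplex p) t *\<^sub>R integrand X p \<omega> \<sigma> t) =
      (\<lambda>t. indicator (open_simplex p) t * ?\<Psi> (shrink 1 (barycentric p t)))"
    using eq by (auto simp: indicator_def fun_eq_iff)
  ultimately show ?thesis unfolding set_integrable_def by (simp only:)
qed

text \<open>Dominated convergence, with a bound that comes from the compactness of the simplex. The factor \<open>s ^ p\<close>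
  accounts for the value \<open>0\<close> at the constant simplex.\<close>

lemma simplex_integral_shrink_continuous:
  assumes X: "compact_smooth_manifold X" and \<omega>: "smooth_form X p \<omega>" and \<sigma>: "\<sigma> \<in> smooth_simplices X (int q)"
    and b: "affine_simplex_map p q b V"
  shows "continuous_on {0..1} (\<lambda>s. simplex_integral X p \<omega> (restrict (\<sigma> \<circ> (\<lambda>y. shrink s (b y))) (standard_simplex p)))"
    (is "continuous_on _ ?I")
    and "p > 0 \<Longrightarrow> simplex_integral X p \<omega> (restrict (\<sigma> \<circ> (\<lambda>y. shrink 0 (b y))) (standard_simplex p)) = 0"
proof -
  let ?\<Psi> = "form_along X p \<omega> q \<sigma> V"
  define F where "F s t = indicator (open_simplex p) t * ?\<Psi> (shrink s (b (barycentric p t)))" for s t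
  have I: "?I s = (\<integral>t. s ^ p * F s t \<partial>param_measure p)" if "s \<in> {0..1}" for s
    unfolding simplex_integral_eq set_lebesgue_integral_def F_def
  proof (rule Bochner_Integration.integral_cong[OF refl])
    fix t
    show "indicator (open_simplex p) t *\<^sub>R integrand X p \<omega> (restrict (\<sigma> \<circ> (\<lambda>y. shrink s (b y))) (standard_simplex p)) t =
        s ^ p * (indicator (open_simplex p) t * ?\<Psi> (shrink s (b (barycentric p t))))"
      using integrand_shrink[OF X \<omega> \<sigma> b, of s t] that by (cases "t \<in> open_simplex p") auto
  qed
  show "?I 0 = 0" if "p > 0" using I[of 0] that by simp
  have cont: "continuous_on (standard_simplex q) ?\<Psi>"
    using form_along_smooth[OF X \<omega> \<sigma>, of V] b smooth_on_continuous unfolding affine_simplex_map_def by blast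
  obtain B where B: "\<And>y. y \<in> standard_simplex q \<Longrightarrow> \<bar>?\<Psi> y\<bar> \<le> B"
    by (fact form_along_bounded[OF X \<omega> \<sigma> b])
  have inS: "shrink s (b (barycentric p t)) \<in> standard_simplex q" if "t \<in> open_simplex p" "s \<in> {0..1}" for s t
    using b shrink_simplex[of s q] barycentric_in_simplex[OF that(1)] that(2) unfolding affine_simplex_map_def
    by (auto simp: image_subset_iff)
  show "continuous_on {0..1} ?I"
  proof (rule continuous_on_sequentiallyI)
    fix u :: "nat \<Rightarrow> real" and a assume u: "\<forall>n. u n \<in> {0..1}" and a: "a \<in> {0..1}" and lim: "u \<longlonglongrightarrow> a"
    have "(\<lambda>n. \<integral>t. u n ^ p * F (u n) t \<partial>param_measure p) \<longlonglongrightarrow> (\<integral>t. a ^ p * F a t \<partial>param_measure p)"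
    proof (rule integral_dominated_convergence[where w="\<lambda>t. B * indicator (open_simplex p) t"])
      show "(\<lambda>t. a ^ p * F a t) \<in> borel_measurable (param_measure p)"
        unfolding F_def using a by (intro borel_measurable_times form_along_pullback_measurable[OF X \<omega> \<sigma> b]) auto
      show "(\<lambda>t. u n ^ p * F (u n) t) \<in> borel_measurable (param_measure p)" for n
        unfolding F_def using u by (intro borel_measurable_times form_along_pullback_measurable[OF X \<omega> \<sigma> b]) auto
      show "integrable (param_measure p) (\<lambda>t. B * indicator (open_simplex p) t)"
        by (rule integrable_open_simplex_const)
      show "AE t in param_measure p. (\<lambda>n. u n ^ p * F (u n) t) \<longlonglongrightarrow> a ^ p * F a t"
      proof (rule AE_I2)
        fix t
        have "(\<lambda>n. F (u n) t) \<longlonglongrightarrow> F a t"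
        proof (cases "t \<in> open_simplex p")
          case True
          have "continuous_on {0..1} (\<lambda>s. shrink s (b (barycentric p t)))"
            by (rule continuous_on_coordinatewise_then_product) (auto simp: shrink_def intro!: continuous_intros)
          then have "continuous_on {0..1} (\<lambda>s. ?\<Psi> (shrink s (b (barycentric p t))))"
            by (rule continuous_on_compose2[OF cont]) (use inS True in auto)
          then show ?thesis using True u a lim unfolding F_def
            by (simp add: continuous_on_sequentially comp_def)
        qed (simp add: F_def)
        then show "(\<lambda>n. u n ^ p * F (u n) t) \<longlonglongrightarrow> a ^ p * F a t"
          by (intro tendsto_mult tendsto_power lim)
      qed
      show "AE t in param_measure p. norm (u n ^ p * F (u n) t) \<le> B * indicator (open_simplex p) t" for n
      proof (rule AE_I2)
        fix t
        show "norm (u n ^ p * F (u n) t) \<le> B * indicator (open_simplex p) t"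
        proof (cases "t \<in> open_simplex p")
          case True
          have u01: "u n \<in> {0..1}" using u by blast
          then have "\<bar>u n ^ p\<bar> \<le> 1" by (simp add: power_le_one)
          then have "\<bar>u n ^ p\<bar> * \<bar>?\<Psi> (shrink (u n) (b (barycentric p t)))\<bar> \<le> 1 * B"
            using B[OF inS[OF True u01]] by (intro mult_mono) auto
          then show ?thesis using True by (simp add: F_def abs_mult)
        qed (simp add: F_def)
      qed
    qed
    then show "(\<lambda>n. ?I (u n)) \<longlonglongrightarrow> ?I a" using u a I by simp
  qed
qed

section \<open>Forms as cochains\<close>

definition chain_eval :: "(((nat \<Rightarrow> real) \<Rightarrow> 'a) \<Rightarrow> real) \<Rightarrow> 'a chain \<Rightarrow> real" where
  "chain_eval \<phi> c = (\<Sum>\<sigma>\<in>Poly_Mapping.keys c. of_int (Poly_Mapping.lookup c \<sigma>) * \<phi> \<sigma>)"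

lemma chain_eval_superset:
  assumes "finite S" "Poly_Mapping.keys c \<subseteq> S"
  shows "chain_eval \<phi> c = (\<Sum>\<sigma>\<in>S. of_int (Poly_Mapping.lookup c \<sigma>) * \<phi> \<sigma>)"
  unfolding chain_eval_def by (rule sum.mono_neutral_left) (use assms in \<open>auto simp: in_keys_iff\<close>)

lemma chain_eval_zero [simp]: "chain_eval \<phi> 0 = 0"
  by (simp add: chain_eval_def)

lemma chain_eval_of [simp]: "chain_eval \<phi> (frag_of \<sigma>) = \<phi> \<sigma>"
  by (simp add: chain_eval_def)

lemma chain_eval_add: "chain_eval \<phi> (a + b) = chain_eval \<phi> a + chain_eval \<phi> b"
proof -
  let ?S = "Poly_Mapping.keys a \<union> Poly_Mapping.keys b"
  have "chain_eval \<phi> (a + b) = (\<Sum>\<sigma>\<in>?S. of_int (Poly_Mapping.lookup (a + b) \<sigma>) * \<phi> \<sigma>)"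
    using keys_add[of a b] by (intro chain_eval_superset) auto
  also have "\<dots> = (\<Sum>\<sigma>\<in>?S. of_int (Poly_Mapping.lookup a \<sigma>) * \<phi> \<sigma>) + (\<Sum>\<sigma>\<in>?S. of_int (Poly_Mapping.lookup b \<sigma>) * \<phi> \<sigma>)"
    by (simp add: lookup_add distrib_right sum.distrib)
  also have "\<dots> = chain_eval \<phi> a + chain_eval \<phi> b"
    by (simp add: chain_eval_superset[of ?S a] chain_eval_superset[of ?S b])
  finally show ?thesis .
qed

lemma chain_eval_uminus: "chain_eval \<phi> (- a) = - chain_eval \<phi> a"
  using chain_eval_add[of \<phi> a "- a"] by simp

lemma chain_eval_diff: "chain_eval \<phi> (a - b) = chain_eval \<phi> a - chain_eval \<phi> b"
  using chain_eval_add[of \<phi> a "- b"] by (simp add: chain_eval_uminus)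

lemma chain_eval_sum: "chain_eval \<phi> (\<Sum>i\<in>I. f i) = (\<Sum>i\<in>I. chain_eval \<phi> (f i))"
  by (induction I rule: infinite_finite_induct) (auto simp: chain_eval_add)

lemma chain_eval_sign: "chain_eval \<phi> (frag_cmul ((-1) ^ i) a) = (-1) ^ i * chain_eval \<phi> a"
  by (cases "even i") (auto simp: chain_eval_uminus)

lemma form_cochain_eq:
  "form_cochain X k \<omega> c = (if c \<in> smooth_chains X k then chain_eval (simplex_integral X (nat k) \<omega>) c else 0)"
  by (simp add: form_cochain_def chain_eval_def)

text \<open>Additivity in the form is the place where integrability is needed.\<close>

lemma form_cochain_add:
  assumes X: "compact_smooth_manifold X" and \<omega>: "smooth_form X (nat k) \<omega>" and \<eta>: "smooth_form X (nat k) \<eta>"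
    and k: "k \<ge> 0"
  shows "form_cochain X k \<omega> + form_cochain X k \<eta> = form_cochain X k (\<lambda>c p vs. \<omega> c p vs + \<eta> c p vs)"
proof
  fix c
  have I: "simplex_integral X (nat k) (\<lambda>c p vs. \<omega> c p vs + \<eta> c p vs) \<sigma> =
      simplex_integral X (nat k) \<omega> \<sigma> + simplex_integral X (nat k) \<eta> \<sigma>" if "\<sigma> \<in> smooth_simplices X k" for \<sigma>
  proof -
    have \<sigma>: "\<sigma> \<in> smooth_simplices X (int (nat k))" using that k by simp
    have "integrand X (nat k) (\<lambda>c p vs. \<omega> c p vs + \<eta> c p vs) \<sigma> = (\<lambda>t. integrand X (nat k) \<omega> \<sigma> t + integrand X (nat k) \<eta> \<sigma> t)"
      by (simp add: integrand_def Let_def fun_eq_iff)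
    then show ?thesis unfolding simplex_integral_eq
      using set_integral_add(2)[OF integrand_integrable[OF X \<omega> \<sigma>] integrand_integrable[OF X \<eta> \<sigma>]] by simp
  qed
  have "chain_eval (simplex_integral X (nat k) (\<lambda>c p vs. \<omega> c p vs + \<eta> c p vs)) c =
     chain_eval (simplex_integral X (nat k) \<omega>) c + chain_eval (simplex_integral X (nat k) \<eta>) c"
    if "c \<in> smooth_chains X k"
    using that unfolding chain_eval_def smooth_chains_iff
    by (auto simp: sum.distrib[symmetric] distrib_left[symmetric] I intro!: sum.cong)
  then show "(form_cochain X k \<omega> + form_cochain X k \<eta>) c = form_cochain X k (\<lambda>c p vs. \<omega> c p vs + \<eta> c p vs) c"
    by (simp add: form_cochain_eq)
qed

lemma form_cochain_uminus: "- form_cochain X k \<omega> = form_cochain X k (\<lambda>c p vs. - \<omega> c p vs)"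
proof
  fix c
  have "integrand X (nat k) (\<lambda>c p vs. - \<omega> c p vs) \<sigma> = (\<lambda>t. - integrand X (nat k) \<omega> \<sigma> t)" for \<sigma>
    by (simp add: integrand_def Let_def fun_eq_iff)
  then have "simplex_integral X (nat k) (\<lambda>c p vs. - \<omega> c p vs) \<sigma> = - simplex_integral X (nat k) \<omega> \<sigma>" for \<sigma>
    unfolding simplex_integral_eq set_lebesgue_integral_def by simp
  then show "(- form_cochain X k \<omega>) c = form_cochain X k (\<lambda>c p vs. - \<omega> c p vs) c"
    by (simp add: form_cochain_eq chain_eval_def sum_negf)
qed

lemma form_cochain_zero: "form_cochain X k (\<lambda>c p vs. 0) = 0"
  by (simp add: form_cochain_eq chain_eval_def simplex_integral_eq integrand_def fun_eq_iff
      set_lebesgue_integral_def)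

lemma forms_zero: "compact_smooth_manifold X \<Longrightarrow> 0 \<in> forms X k"
  unfolding forms_def using smooth_form_zero[of X "nat k"] form_cochain_zero[of X k, symmetric]
  by (auto intro!: image_eqI)

lemma forms_add: "compact_smooth_manifold X \<Longrightarrow> v \<in> forms X k \<Longrightarrow> w \<in> forms X k \<Longrightarrow> v + w \<in> forms X k"
  unfolding forms_def using form_cochain_add[of X k] smooth_form_add[of X "nat k"]
  by (auto split: if_splits)

lemma forms_uminus: "compact_smooth_manifold X \<Longrightarrow> w \<in> forms X k \<Longrightarrow> - w \<in> forms X k"
  unfolding forms_def using form_cochain_uminus[of X k] smooth_form_uminus[of X "nat k"]
  by (auto split: if_splits)

lemma forms_additive:
  assumes "w \<in> forms X k"
  shows "a \<in> smooth_chains X k \<Longrightarrow> b \<in> smooth_chains X k \<Longrightarrow> w (a + b) = w a + w b"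
    and "c \<notin> smooth_chains X k \<Longrightarrow> w c = 0"
  using assms unfolding forms_def
  by (auto split: if_splits simp: form_cochain_eq chain_eval_add smooth_chains_add)

text \<open>The two integrands agree pointwise by the chain rule.\<close>

lemma simplex_integral_pullback:
  assumes A: "compact_smooth_manifold A" and M: "compact_smooth_manifold M"
    and \<rho>: "smooth_map A M \<rho>" and \<omega>: "smooth_form M p \<omega>" and \<sigma>: "\<sigma> \<in> smooth_simplices A (int p)"
  shows "simplex_integral A p (pullback_form A M \<rho> \<omega>) \<sigma> = simplex_integral M p \<omega> (simplex_map p \<rho> \<sigma>)"
proof -
  have "integrand A p (pullback_form A M \<rho> \<omega>) \<sigma> t = integrand M p \<omega> (simplex_map p \<rho> \<sigma>) t"
    if t: "t \<in> open_simplex p" for t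
  proof -
    let ?\<tau> = "simplex_map p \<rho> \<sigma>"
    let ?y = "barycentric p t"
    have \<tau>: "?\<tau> \<in> smooth_simplices M (int p)" by (rule smooth_simplex_map[OF A M \<rho> \<sigma>])
    have y: "?y \<in> standard_simplex p" by (rule barycentric_in_simplex[OF t])
    have \<tau>y: "?\<tau> ?y = \<rho> (\<sigma> ?y)" using y by (simp add: simplex_map_def)
    define c where "c = (SOME c. c \<in> matlas A \<and> \<sigma> ?y \<in> fst c)"
    have "\<exists>c. c \<in> matlas A \<and> \<sigma> ?y \<in> fst c" using chart_cover[OF A] smooth_simplex_in_space[OF \<sigma> y] by blast
    from someI_ex[OF this] have c: "c \<in> matlas A" "\<sigma> ?y \<in> fst c" unfolding c_def by auto
    define d where "d = (SOME d. d \<in> matlas M \<and> ?\<tau> ?y \<in> fst d)"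
    have "\<exists>d. d \<in> matlas M \<and> ?\<tau> ?y \<in> fst d" using chart_cover[OF M] smooth_simplex_in_space[OF \<tau> y] by blast
    from someI_ex[OF this] have d: "d \<in> matlas M" "?\<tau> ?y \<in> fst d" unfolding d_def by auto
    have d': "\<rho> (\<sigma> ?y) \<in> fst d" using d \<tau>y by simp
    let ?S = "simplex_domain p \<sigma> c"
    have "\<forall>i. \<exists>L. has_grad (Suc p) ?S (\<lambda>t. snd c (\<sigma> t) i) ?y L"
      using simplex_has_grad[OF A c(1) \<sigma> y c(2)] by blast
    from choice[OF this] obtain L where L: "\<And>i. has_grad (Suc p) ?S (\<lambda>t. snd c (\<sigma> t) i) ?y (L i)" by blast
    have "\<forall>i. \<exists>L. has_grad (Suc p) (simplex_domain p ?\<tau> d) (\<lambda>t. snd d (?\<tau> t) i) ?y L"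
      using simplex_has_grad[OF M d(1) \<tau> y d(2)] by blast
    from choice[OF this] obtain K where
      K: "\<And>i. has_grad (Suc p) (simplex_domain p ?\<tau> d) (\<lambda>t. snd d (?\<tau> t) i) ?y (K i)" by blast
    have r: "restrict (\<sigma> \<circ> (\<lambda>y. y)) (standard_simplex p) = \<sigma>" "restrict (?\<tau> \<circ> (\<lambda>y. y)) (standard_simplex p) = ?\<tau>"
      using \<sigma> \<tau> by (auto simp: smooth_simplices_int singular_simplex_def fun_eq_iff extensional_def)
    have i1: "integrand A p (pullback_form A M \<rho> \<omega>) \<sigma> t =
        pullback_form A M \<rho> \<omega> c (\<sigma> ?y) (map (\<lambda>j i. \<Sum>l<Suc p. L i l * bary_dir j l) [0..<p])"
      using integrand_gradient[OF A \<sigma>, of "\<lambda>y. y" p t bary_dir c L "pullback_form A M \<rho> \<omega>"] t L c_def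
        barycentric_derivative unfolding r by simp
    have i2: "integrand M p \<omega> ?\<tau> t = \<omega> d (?\<tau> ?y) (map (\<lambda>j i. \<Sum>l<Suc p. K i l * bary_dir j l) [0..<p])"
      using integrand_gradient[OF M \<tau>, of "\<lambda>y. y" p t bary_dir d K \<omega>] t K d_def
        barycentric_derivative unfolding r by simp
    have K': "has_grad (Suc p) (simplex_domain p (\<lambda>t. \<rho> (\<sigma> t)) d) (\<lambda>t. snd d (\<rho> (\<sigma> t)) i) ?y (K i)" for i
      by (rule has_grad_cong_on[OF K]) (use y d' in \<open>auto simp: simplex_map_def\<close>)
    have "tangent_map A \<rho> c d (\<sigma> ?y) (\<lambda>i. \<Sum>l<Suc p. L i l * bary_dir j l) = (\<lambda>i. \<Sum>l<Suc p. K i l * bary_dir j l)"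
      if "j < p" for j
      by (rule ext, rule simplex_gradient_map[OF A c(1) M d(1) \<rho> \<sigma> y c(2) d' L K' sum_bary_dir[OF that]])
    then have "map (tangent_map A \<rho> c d (\<sigma> ?y)) (map (\<lambda>j i. \<Sum>l<Suc p. L i l * bary_dir j l) [0..<p]) =
        map (\<lambda>j i. \<Sum>l<Suc p. K i l * bary_dir j l) [0..<p]" by simp
    then show ?thesis unfolding i1 i2 \<tau>y
      by (subst pullback_form_eq[OF A c(1) M d(1) \<rho> \<omega> c(2) d']) (simp_all del: map_map)
  qed
  then show ?thesis unfolding simplex_integral_eq
    using open_simplex_sets by (intro set_lebesgue_integral_cong) auto
qed

lemma forms_pullback:
  assumes A: "compact_smooth_manifold A" and M: "compact_smooth_manifold M"
    and \<rho>: "smooth_map A M \<rho>" and w: "w \<in> forms M k"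
  shows "cochain_pullback A \<rho> k w \<in> forms A k"
proof (cases "k < 0")
  case True
  then have "cochain_pullback A \<rho> k w = 0" using w by (auto simp: cochain_pullback_def forms_def)
  then show ?thesis using True by (simp add: forms_def)
next
  case False
  then obtain \<omega> where \<omega>: "smooth_form M (nat k) \<omega>" "w = form_cochain M k \<omega>" using w by (auto simp: forms_def)
  have "chain_eval (simplex_integral A (nat k) (pullback_form A M \<rho> \<omega>)) c =
      chain_eval (simplex_integral M (nat k) \<omega>) (chain_map (nat k) \<rho> c)" if "c \<in> smooth_chains A k" for c
    using that
  proof (induction rule: smooth_chain_induct)
    case (simplex \<sigma>)
    then show ?case using simplex_integral_pullback[OF A M \<rho> \<omega>(1), of \<sigma>] False by simp
  qed (simp_all add: chain_eval_diff chain_map_diff)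
  then have "cochain_pullback A \<rho> k w = form_cochain A k (pullback_form A M \<rho> \<omega>)"
    using chain_map_smooth[OF A M \<rho>] by (auto simp: cochain_pullback_def \<omega>(2) form_cochain_eq fun_eq_iff)
  then show ?thesis using False smooth_form_pullback[OF A M \<rho> \<omega>(1)] by (auto simp: forms_def)
qed

section \<open>Forms with values in a proper subgroup\<close>

definition add_subgroup :: "'b::ab_group_add set \<Rightarrow> bool" where
  "add_subgroup \<Lambda> \<longleftrightarrow> 0 \<in> \<Lambda> \<and> (\<forall>x\<in>\<Lambda>. \<forall>y\<in>\<Lambda>. x - y \<in> \<Lambda>)"

lemma add_subgroup_zero: "add_subgroup \<Lambda> \<Longrightarrow> 0 \<in> \<Lambda>"
  by (simp add: add_subgroup_def)

lemma add_subgroup_diff: "add_subgroup \<Lambda> \<Longrightarrow> x \<in> \<Lambda> \<Longrightarrow> y \<in> \<Lambda> \<Longrightarrow> x - y \<in> \<Lambda>"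
  by (simp add: add_subgroup_def)

lemma add_subgroup_uminus: "add_subgroup \<Lambda> \<Longrightarrow> x \<in> \<Lambda> \<Longrightarrow> - x \<in> \<Lambda>"
  by (metis add_subgroup_def diff_0)

lemma add_subgroup_add: "add_subgroup \<Lambda> \<Longrightarrow> x \<in> \<Lambda> \<Longrightarrow> y \<in> \<Lambda> \<Longrightarrow> x + y \<in> \<Lambda>"
  by (metis add_subgroup_diff add_subgroup_uminus diff_minus_eq_add)

text \<open>A proper subgroup of the reals contains no interval, so it is totally disconnected.\<close>

lemma proper_subgroup_continuous_zero:
  fixes g :: "real \<Rightarrow> real"
  assumes \<Lambda>: "add_subgroup \<Lambda>" "\<Lambda> \<noteq> UNIV" and g: "continuous_on {0..1} g" "g ` {0..1} \<subseteq> \<Lambda>" "g 0 = 0"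
  shows "g 1 = 0"
proof (rule ccontr)
  assume ne: "g 1 \<noteq> 0"
  have "connected (g ` {0..1})" by (rule connected_continuous_image[OF g(1) connected_Icc])
  then have "convex (g ` {0..1})" by (simp add: is_interval_connected_1[symmetric] is_interval_convex)
  moreover have "0 \<in> g ` {0..1}" using g(3) by (intro image_eqI[where x=0]) auto
  ultimately have seg: "closed_segment 0 (g 1) \<subseteq> g ` {0..1}" by (intro closed_segment_subset) auto
  have "x \<in> \<Lambda>" for x
  proof -
    define y where "y = x / g 1"
    have x: "x = y * g 1" using ne by (simp add: y_def)
    obtain m :: nat where m: "\<bar>y\<bar> < real m" using reals_Archimedean2 by blast
    define n where "n = Suc m"
    define r where "r = \<bar>y\<bar> / real n"
    have "\<bar>y\<bar> \<le> real n" "0 < real n" using m by (auto simp: n_def)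
    then have "0 \<le> r" "r \<le> 1" by (auto simp: r_def)
    then have "r * g 1 \<in> closed_segment 0 (g 1)" unfolding in_segment by (intro exI[where x=r]) auto
    then have z: "r * g 1 \<in> \<Lambda>" using seg g(2) by blast
    have "real i * (r * g 1) \<in> \<Lambda>" for i :: nat
      by (induction i) (auto simp: distrib_right add_subgroup_zero[OF \<Lambda>(1)] intro: add_subgroup_add[OF \<Lambda>(1)] z)
    from this[of n] have "\<bar>y\<bar> * g 1 \<in> \<Lambda>" by (simp add: r_def n_def)
    then have "x \<in> \<Lambda> \<or> - x \<in> \<Lambda>" unfolding x by (cases "y \<ge> 0") auto
    then show ?thesis using add_subgroup_uminus[OF \<Lambda>(1), of "- x"] by auto
  qed
  then show False using \<Lambda>(2) by auto
qed

lemma shrink_restrict_smooth: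
  assumes X: "compact_smooth_manifold X" and \<sigma>: "\<sigma> \<in> smooth_simplices X (int q)" and s: "s \<in> {0..1}"
  shows "restrict (\<sigma> \<circ> shrink s) (standard_simplex q) \<in> smooth_simplices X (int q)"
  using s by (intro smooth_simplex_precompose[OF X \<sigma> shrink_simplex] smooth_on_shrink) auto

lemma shrink_one: "\<sigma> \<in> smooth_simplices X (int q) \<Longrightarrow> restrict (\<sigma> \<circ> shrink 1) (standard_simplex q) = \<sigma>"
  by (auto simp: smooth_simplices_int singular_simplex_def shrink_def fun_eq_iff extensional_def)

text \<open>Shrink a simplex to a point: the integral varies continuously inside \<open>\<Lambda>\<close> down to \<open>0\<close>.\<close>

lemma form_values_in_subgroup_zero:
  assumes X: "compact_smooth_manifold X" and \<Lambda>: "add_subgroup \<Lambda>" "\<Lambda> \<noteq> UNIV" and k: "k \<ge> 1"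
    and w: "w \<in> forms X k" and val: "\<And>c. c \<in> smooth_chains X k \<Longrightarrow> w c \<in> \<Lambda>"
  shows "w = 0"
proof -
  obtain \<omega> where \<omega>: "smooth_form X (nat k) \<omega>" "w = form_cochain X k \<omega>" using w k by (auto simp: forms_def)
  define p where "p = nat k"
  have p: "k = int p" "p > 0" using k by (auto simp: p_def)
  have "simplex_integral X p \<omega> \<sigma> = 0" if \<sigma>: "\<sigma> \<in> smooth_simplices X (int p)" for \<sigma>
  proof -
    define g where "g s = simplex_integral X p \<omega> (restrict (\<sigma> \<circ> shrink s) (standard_simplex p))" for s
    have "continuous_on {0..1} g" "g 0 = 0"
      using simplex_integral_shrink_continuous[OF X \<omega>(1)[folded p_def] \<sigma> affine_simplex_map_id] p(2)
      unfolding g_def by simp_all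
    moreover have "g ` {0..1} \<subseteq> \<Lambda>"
    proof
      fix x assume "x \<in> g ` {0..1}"
      then obtain s where s: "s \<in> {0..1}" "x = g s" by blast
      have "frag_of (restrict (\<sigma> \<circ> shrink s) (standard_simplex p)) \<in> smooth_chains X k"
        unfolding p(1) by (rule smooth_chains_of[OF shrink_restrict_smooth[OF X \<sigma> s(1)]])
      from val[OF this] this show "x \<in> \<Lambda>" by (simp add: \<omega>(2) form_cochain_eq s(2) g_def p_def)
    qed
    ultimately have "g 1 = 0" using proper_subgroup_continuous_zero[OF \<Lambda>, of g] by blast
    then show ?thesis by (simp add: g_def shrink_one[OF \<sigma>])
  qed
  then have "chain_eval (simplex_integral X p \<omega>) c = 0" if "c \<in> smooth_chains X k" for c
    using that unfolding chain_eval_def smooth_chains_iff p(1) by (auto intro!: sum.neutral)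
  then show ?thesis unfolding \<omega>(2) by (simp add: form_cochain_eq fun_eq_iff p_def)
qed

text \<open>The same deformation is applied to a \<open>(k + 1)\<close>-simplex: its boundary stays a cycle, so the integral
  over the boundary stays in \<open>\<Lambda>\<close>. For \<open>k = 0\<close> the value at a point does not tend to \<open>0\<close>, but the two
  faces of a constant edge cancel.\<close>

lemma period_form_closed:
  assumes X: "compact_smooth_manifold X" and \<Lambda>: "add_subgroup \<Lambda>" "\<Lambda> \<noteq> UNIV"
    and w: "w \<in> period_forms X \<Lambda> k" and c: "c \<in> smooth_chains X (k + 1)"
  shows "w (chain_boundary (nat (k + 1)) c) = 0"
proof (cases "k < 0")
  case True
  then show ?thesis using w by (simp add: period_forms_def forms_def)
next
  case False
  define p where "p = nat k"
  have p: "k = int p" "nat (k + 1) = Suc p" "k + 1 = int (Suc p)" using False by (auto simp: p_def)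
  have wf: "w \<in> forms X k" using w by (simp add: period_forms_def)
  then obtain \<omega> where \<omega>: "smooth_form X p \<omega>" "w = form_cochain X k \<omega>" using False by (auto simp: forms_def p_def)
  have bd: "chain_boundary (Suc p) c \<in> smooth_chains X k" if "c \<in> smooth_chains X (int (Suc p))" for c
    using chain_boundary_smooth[OF X, of c "int (Suc p)"] that p by simp
  have val: "w (chain_boundary (Suc p) c) \<in> \<Lambda>" if "c \<in> smooth_chains X (int (Suc p))" for c
  proof -
    have "Poly_Mapping.keys c \<subseteq> singular_simplex_set (Suc p) (mtop X)"
      using that smooth_simplices_int[of _ X "Suc p"] unfolding smooth_chains_iff by blast
    then have "chain_boundary p (chain_boundary (Suc p) c) = 0"
      using chain_boundary_boundary_alt[of p "mtop X" c] by (simp add: singular_chain_def)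
    then have "chain_boundary (Suc p) c \<in> smooth_cycles X k"
      using bd[OF that] by (simp add: smooth_cycles_def p_def)
    then show ?thesis using w by (simp add: period_forms_def)
  qed
  let ?I = "simplex_integral X p \<omega>"
  have w_bd: "w (chain_boundary (Suc p) (frag_of \<sigma>)) = (\<Sum>i\<le>Suc p. (-1) ^ i * ?I (singular_face (Suc p) i \<sigma>))"
    if \<sigma>: "\<sigma> \<in> smooth_simplices X (int (Suc p))" for \<sigma>
  proof -
    have "w (chain_boundary (Suc p) (frag_of \<sigma>)) = chain_eval ?I (chain_boundary (Suc p) (frag_of \<sigma>))"
      using bd[OF smooth_chains_of[OF \<sigma>]] by (simp add: \<omega>(2) form_cochain_eq p_def)
    also have "\<dots> = (\<Sum>i\<le>Suc p. (-1) ^ i * ?I (singular_face (Suc p) i \<sigma>))"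
      unfolding chain_boundary_of by (simp add: chain_eval_sum chain_eval_sign del: sum.atMost_Suc)
    finally show ?thesis .
  qed
  have simp0: "w (chain_boundary (Suc p) (frag_of \<sigma>)) = 0" if \<sigma>: "\<sigma> \<in> smooth_simplices X (int (Suc p))" for \<sigma>
  proof -
    define \<tau> where "\<tau> s = restrict (\<sigma> \<circ> shrink s) (standard_simplex (Suc p))" for s
    define J where "J i s = ?I (restrict (\<sigma> \<circ> (\<lambda>y. shrink s (simplical_face i y))) (standard_simplex p))" for i s
    define g where "g s = (\<Sum>i\<le>Suc p. (-1) ^ i * J i s)" for s
    have face: "singular_face (Suc p) i (\<tau> s) = restrict (\<sigma> \<circ> (\<lambda>y. shrink s (simplical_face i y))) (standard_simplex p)"
      if "i \<le> Suc p" for i s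
      using that unfolding \<tau>_def
      by (subst singular_face_restrict) (auto simp: singular_face_def comp_def)
    have "continuous_on {0..1} g"
      unfolding g_def J_def
      by (intro continuous_on_sum continuous_on_mult continuous_on_const
          simplex_integral_shrink_continuous(1)[OF X \<omega>(1) \<sigma> affine_simplex_map_face]) simp
    moreover have g: "g s = w (chain_boundary (Suc p) (frag_of (\<tau> s)))" if "s \<in> {0..1}" for s
      unfolding g_def J_def \<tau>_def
      by (subst w_bd[OF shrink_restrict_smooth[OF X \<sigma> that]], intro sum.cong refl, subst face[symmetric])
         (auto simp: \<tau>_def)
    moreover have "g ` {0..1} \<subseteq> \<Lambda>"
      using g val smooth_chains_of[OF shrink_restrict_smooth[OF X \<sigma>]] by (auto simp: \<tau>_def)
    moreover have "g 0 = 0"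
    proof (cases "p > 0")
      case True
      have "J i 0 = 0" if "i \<le> Suc p" for i
        unfolding J_def using simplex_integral_shrink_continuous(2)[OF X \<omega>(1) \<sigma> affine_simplex_map_face[OF that] True] .
      then show ?thesis by (simp add: g_def del: sum.atMost_Suc)
    next
      case False
      have "J (Suc 0) 0 = J 0 0" unfolding J_def shrink_def by simp
      then show ?thesis using False by (simp add: g_def)
    qed
    ultimately have "g 1 = 0" using proper_subgroup_continuous_zero[OF \<Lambda>, of g] by blast
    then show ?thesis using g[of 1] shrink_one[OF \<sigma>] by (simp add: \<tau>_def)
  qed
  have w0: "w 0 = 0" using forms_additive(1)[OF wf, of 0 0] by simp
  have wd: "w (a - b) = w a - w b" if "a \<in> smooth_chains X k" "b \<in> smooth_chains X k" for a b
    using forms_additive(1)[OF wf smooth_chains_diff[OF that] that(2)] by simp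
  from c[unfolded p(3)] show ?thesis unfolding p(2)
  proof (induction rule: smooth_chain_induct)
    case (diff a b)
    then show ?case by (simp add: chain_boundary_diff wd bd)
  qed (use simp0 w0 in auto)
qed

section \<open>Quotients of additive groups\<close>

abbreviation coset :: "'b::ab_group_add set \<Rightarrow> 'b \<Rightarrow> 'b set" where
  "coset B x \<equiv> (\<lambda>b. b + x) ` B"

lemma r_coset_additive_group: "B #>\<^bsub>additive_group S\<^esub> x = coset B x"
  by (auto simp: r_coset_def additive_group_def)

lemma reduce_eq_coset: "reduce \<Lambda> r = coset \<Lambda> r"
  unfolding reduce_def r_coset_additive_group ..

lemma coset_eq_iff:
  assumes "add_subgroup B"
  shows "coset B x = coset B y \<longleftrightarrow> x - y \<in> B"
proof
  assume "coset B x = coset B y"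
  moreover have "x \<in> coset B x" using add_subgroup_zero[OF assms] by force
  ultimately obtain b where "b \<in> B" "x = b + y" by auto
  then show "x - y \<in> B" by simp
next
  assume xy: "x - y \<in> B"
  have "b + x \<in> coset B y" if "b \<in> B" for b
    using add_subgroup_add[OF assms that xy] by (intro image_eqI[where x="b + (x - y)"]) auto
  moreover have "b + y \<in> coset B x" if "b \<in> B" for b
    using add_subgroup_diff[OF assms that xy] by (intro image_eqI[where x="b - (x - y)"]) auto
  ultimately show "coset B x = coset B y" by auto
qed

lemma coset_set_mult:
  assumes "add_subgroup B"
  shows "coset B x <#>\<^bsub>additive_group S\<^esub> coset B y = coset B (x + y)"
proof
  show "coset B x <#>\<^bsub>additive_group S\<^esub> coset B y \<subseteq> coset B (x + y)"
  proof
    fix z assume "z \<in> coset B x <#>\<^bsub>additive_group S\<^esub> coset B y"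
    then obtain b b' where "b \<in> B" "b' \<in> B" "z = (b + x) + (b' + y)"
      by (auto simp: set_mult_def additive_group_def)
    then show "z \<in> coset B (x + y)"
      using add_subgroup_add[OF assms, of b b'] by (intro image_eqI[where x="b + b'"]) (auto simp: algebra_simps)
  qed
next
  show "coset B (x + y) \<subseteq> coset B x <#>\<^bsub>additive_group S\<^esub> coset B y"
  proof
    fix z assume "z \<in> coset B (x + y)"
    then obtain b where "b \<in> B" "z = b + (x + y)" by auto
    then have "z = (b + x) + (0 + y)" by (simp add: add.assoc)
    moreover have "b + x \<in> coset B x" using \<open>b \<in> B\<close> by (rule imageI)
    moreover have "0 + y \<in> coset B y" using add_subgroup_zero[OF assms] by (rule imageI)
    moreover have "p + q \<in> P <#>\<^bsub>additive_group S\<^esub> Q" if "p \<in> P" "q \<in> Q" for p q P Q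
      using that by (auto simp: set_mult_def additive_group_def)
    ultimately show "z \<in> coset B x <#>\<^bsub>additive_group S\<^esub> coset B y" by (simp only:)
  qed
qed

lemma carrier_additive_quotient: "carrier (additive_group S Mod B) = coset B ` S"
  unfolding FactGroup_def RCOSETS_def r_coset_additive_group by (auto simp: additive_group_def)

lemma mult_additive_quotient: "(\<otimes>\<^bsub>additive_group S Mod B\<^esub>) = (<#>\<^bsub>additive_group S\<^esub>)"
  by (simp add: FactGroup_def)

lemma one_additive_quotient: "\<one>\<^bsub>additive_group S Mod B\<^esub> = B"
  by (simp add: FactGroup_def)

text \<open>\<open>G\<close> is, through \<open>\<phi>\<close>, the quotient of the subgroup \<open>S\<close> of an ambient additive group by \<open>B\<close>. All groups
  of the sequence have this form, with cocycles for \<open>S\<close> and coboundaries for \<open>B\<close>, which moves every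
  argument to the level of cocycles.\<close>

definition presents ::
    "'b::ab_group_add set \<Rightarrow> 'b set \<Rightarrow> ('g, 'r) monoid_scheme \<Rightarrow> ('b \<Rightarrow> 'g) \<Rightarrow> bool" where
  "presents S B G \<phi> \<longleftrightarrow> add_subgroup S \<and> \<phi> ` S = carrier G \<and>
     (\<forall>x\<in>S. \<forall>y\<in>S. \<phi> (x + y) = \<phi> x \<otimes>\<^bsub>G\<^esub> \<phi> y) \<and> \<phi> 0 = \<one>\<^bsub>G\<^esub> \<and>
     (\<forall>x\<in>S. \<phi> x = \<one>\<^bsub>G\<^esub> \<longleftrightarrow> x \<in> B)"

lemma presents_group:
  assumes "presents S B G \<phi>"
  shows "group G"
proof -
  have S: "add_subgroup S" and im: "carrier G = \<phi> ` S" and one: "\<one>\<^bsub>G\<^esub> = \<phi> 0"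
    and add: "\<And>x y. x \<in> S \<Longrightarrow> y \<in> S \<Longrightarrow> \<phi> x \<otimes>\<^bsub>G\<^esub> \<phi> y = \<phi> (x + y)"
    using assms by (auto simp: presents_def)
  note cl = add_subgroup_zero[OF S] add_subgroup_add[OF S] add_subgroup_uminus[OF S]
  show ?thesis
  proof (rule groupI)
    fix x assume "x \<in> carrier G"
    then obtain a where a: "a \<in> S" "x = \<phi> a" using im by auto
    then have "\<phi> (- a) \<otimes>\<^bsub>G\<^esub> x = \<one>\<^bsub>G\<^esub>" using add[of "- a" a] cl one by simp
    then show "\<exists>y\<in>carrier G. y \<otimes>\<^bsub>G\<^esub> x = \<one>\<^bsub>G\<^esub>" using im cl(3)[OF a(1)] by blast
  qed (auto simp: im one add cl add.assoc)
qed

lemma presents_eq_iff: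
  assumes P: "presents S B G \<phi>" and "x \<in> S" "y \<in> S"
  shows "\<phi> x = \<phi> y \<longleftrightarrow> x - y \<in> B"
proof -
  interpret group G by (rule presents_group[OF P])
  have S: "add_subgroup S" and im: "carrier G = \<phi> ` S"
    and add: "\<And>x y. x \<in> S \<Longrightarrow> y \<in> S \<Longrightarrow> \<phi> (x + y) = \<phi> x \<otimes>\<^bsub>G\<^esub> \<phi> y"
    and B: "\<And>x. x \<in> S \<Longrightarrow> \<phi> x = \<one>\<^bsub>G\<^esub> \<longleftrightarrow> x \<in> B"
    using P by (auto simp: presents_def)
  have d: "x - y \<in> S" by (rule add_subgroup_diff[OF S assms(2,3)])
  have "\<phi> x = \<phi> (x - y) \<otimes>\<^bsub>G\<^esub> \<phi> y" using add[OF d assms(3)] by simp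
  moreover have "\<phi> y \<in> carrier G" "\<phi> (x - y) \<in> carrier G" using im assms(3) d by auto
  ultimately have "\<phi> x = \<phi> y \<longleftrightarrow> \<phi> (x - y) = \<one>\<^bsub>G\<^esub>" by (metis l_one r_cancel_one)
  then show ?thesis using B[OF d] by simp
qed

lemma presents_hom:
  assumes P: "presents S B G \<phi>" and P': "presents S' B' G' \<phi>'"
    and u: "\<And>x. x \<in> S \<Longrightarrow> u x \<in> S'" "\<And>x y. x \<in> S \<Longrightarrow> y \<in> S \<Longrightarrow> u (x + y) = u x + u y"
    and F: "\<And>x. x \<in> S \<Longrightarrow> F (\<phi> x) = \<phi>' (u x)"
  shows "group_hom G G' F"
proof -
  have im: "carrier G = \<phi> ` S" "carrier G' = \<phi>' ` S'" and S: "add_subgroup S"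
    and add: "\<And>x y. x \<in> S \<Longrightarrow> y \<in> S \<Longrightarrow> \<phi> x \<otimes>\<^bsub>G\<^esub> \<phi> y = \<phi> (x + y)"
    and add': "\<And>x y. x \<in> S' \<Longrightarrow> y \<in> S' \<Longrightarrow> \<phi>' (x + y) = \<phi>' x \<otimes>\<^bsub>G'\<^esub> \<phi>' y"
    using P P' by (auto simp: presents_def)
  have "F \<in> hom G G'"
  proof (rule homI)
    fix x assume "x \<in> carrier G"
    then show "F x \<in> carrier G'" using im F u(1) by auto
  next
    fix x y assume "x \<in> carrier G" "y \<in> carrier G"
    then obtain a b where "a \<in> S" "b \<in> S" "x = \<phi> a" "y = \<phi> b" using im by auto
    then show "F (x \<otimes>\<^bsub>G\<^esub> y) = F x \<otimes>\<^bsub>G'\<^esub> F y"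
      using F u add add' add_subgroup_add[OF S] by simp
  qed
  then show ?thesis
    using presents_group[OF P] presents_group[OF P'] by (simp add: group_hom_def group_hom_axioms_def)
qed

lemma presents_exact:
  assumes P1: "presents S1 B1 G1 \<phi>1" and P2: "presents S2 B2 G2 \<phi>2" and P3: "presents S3 B3 G3 \<phi>3"
    and u: "\<And>x. x \<in> S1 \<Longrightarrow> u x \<in> S2" "\<And>x y. x \<in> S1 \<Longrightarrow> y \<in> S1 \<Longrightarrow> u (x + y) = u x + u y"
    and v: "\<And>x. x \<in> S2 \<Longrightarrow> v x \<in> S3" "\<And>x y. x \<in> S2 \<Longrightarrow> y \<in> S2 \<Longrightarrow> v (x + y) = v x + v y"
    and F: "\<And>x. x \<in> S1 \<Longrightarrow> F (\<phi>1 x) = \<phi>2 (u x)" and K: "\<And>x. x \<in> S2 \<Longrightarrow> K (\<phi>2 x) = \<phi>3 (v x)"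
    and exact: "\<And>y. y \<in> S2 \<Longrightarrow> v y \<in> B3 \<longleftrightarrow> (\<exists>x\<in>S1. y - u x \<in> B2)"
  shows "exact_at G1 F G2 K G3"
  unfolding exact_at_def
proof (intro conjI)
  show "group_hom G1 G2 F" by (rule presents_hom[OF P1 P2 u F])
  show "group_hom G2 G3 K" by (rule presents_hom[OF P2 P3 v K])
  have im: "carrier G1 = \<phi>1 ` S1" "carrier G2 = \<phi>2 ` S2" using P1 P2 by (auto simp: presents_def)
  have k: "K (\<phi>2 y) = \<one>\<^bsub>G3\<^esub> \<longleftrightarrow> (\<exists>x\<in>S1. \<phi>2 y = \<phi>2 (u x))" if "y \<in> S2" for y
  proof -
    have "K (\<phi>2 y) = \<one>\<^bsub>G3\<^esub> \<longleftrightarrow> v y \<in> B3" using P3 v(1)[OF that] K[OF that] by (simp add: presents_def)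
    then show ?thesis using exact[OF that] presents_eq_iff[OF P2 that u(1)] by simp
  qed
  show "F ` carrier G1 = kernel G2 G3 K"
  proof
    show "F ` carrier G1 \<subseteq> kernel G2 G3 K"
      using k u(1) by (auto simp: im kernel_def F)
    show "kernel G2 G3 K \<subseteq> F ` carrier G1"
    proof
      fix z assume "z \<in> kernel G2 G3 K"
      then obtain y where "y \<in> S2" "z = \<phi>2 y" "K (\<phi>2 y) = \<one>\<^bsub>G3\<^esub>" by (auto simp: kernel_def im)
      then obtain x where "x \<in> S1" "z = F (\<phi>1 x)" using k F by auto
      then show "z \<in> F ` carrier G1" using im by auto
    qed
  qed
qed

lemma add_subgroup_Times:
  assumes "add_subgroup A" "add_subgroup B"
  shows "add_subgroup (A \<times> B)"
  using assms unfolding add_subgroup_def zero_prod_def by (auto simp: minus_prod_def)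

section \<open>The mapping cone of a chain map\<close>

locale int_complex =
  fixes C :: "int \<Rightarrow> 'b::ab_group_add set" and d :: "int \<Rightarrow> 'b \<Rightarrow> 'b"
  assumes subgroup_C: "add_subgroup (C k)"
    and d_diff: "d k (x - y) = d k x - d k y"
    and d_maps: "x \<in> C k \<Longrightarrow> d k x \<in> C (k + 1)"
    and d_d: "x \<in> C k \<Longrightarrow> d (k + 1) (d k x) = 0"
begin

lemma d_zero: "d k 0 = 0"
  using d_diff[of k 0 0] by simp

lemma d_uminus: "d k (- x) = - d k x"
  using d_diff[of k 0 x] d_zero by simp

abbreviation cocycles :: "int \<Rightarrow> 'b set" where
  "cocycles k \<equiv> {x \<in> C k. d k x = 0}"

abbreviation coboundaries :: "int \<Rightarrow> 'b set" where
  "coboundaries k \<equiv> cohomologous_to_zero C d k"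

lemma add_subgroup_cocycles: "add_subgroup (cocycles k)"
  unfolding add_subgroup_def
  using add_subgroup_zero[OF subgroup_C] add_subgroup_diff[OF subgroup_C] by (auto simp: d_zero d_diff)

lemma coboundariesI: "y \<in> C (k - 1) \<Longrightarrow> x = d (k - 1) y \<Longrightarrow> x \<in> coboundaries k"
  by (simp add: cohomologous_to_zero_def)

lemma add_subgroup_coboundaries: "add_subgroup (coboundaries k)"
  unfolding add_subgroup_def cohomologous_to_zero_def
proof (intro conjI ballI)
  show "0 \<in> d (k - 1) ` C (k - 1)"
    using add_subgroup_zero[OF subgroup_C] d_zero by (intro image_eqI[where x=0]) auto
  fix x y assume "x \<in> d (k - 1) ` C (k - 1)" "y \<in> d (k - 1) ` C (k - 1)"
  then obtain a b where "a \<in> C (k - 1)" "b \<in> C (k - 1)" "x = d (k - 1) a" "y = d (k - 1) b" by auto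
  then show "x - y \<in> d (k - 1) ` C (k - 1)"
    using add_subgroup_diff[OF subgroup_C] d_diff by (intro image_eqI[where x="a - b"]) auto
qed

lemma coboundaries_subset: "coboundaries k \<subseteq> cocycles k"
  unfolding cohomologous_to_zero_def using d_maps[of _ "k - 1"] d_d[of _ "k - 1"] by auto

lemma homology_class_eq: "homology_class C d k x = coset (coboundaries k) x"
  by (simp add: homology_class_def cocycle_group_def r_coset_additive_group)

lemma homology_presents: "presents (cocycles k) (coboundaries k) (homology C d k) (homology_class C d k)"
  unfolding presents_def homology_def cocycle_group_def carrier_additive_quotient mult_additive_quotient
    one_additive_quotient homology_class_eq coset_set_mult[OF add_subgroup_coboundaries]
  using add_subgroup_cocycles coset_eq_iff[OF add_subgroup_coboundaries, of _ _ 0] by auto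

lemma on_classes_eq:
  assumes "x \<in> cocycles k" "\<And>y. y \<in> cocycles k \<Longrightarrow> y - x \<in> coboundaries k \<Longrightarrow> f y = f x"
  shows "on_classes f (homology_class C d k x) = f x"
proof -
  have "f y = f x" if y: "y \<in> coset (coboundaries k) x" for y
  proof -
    obtain b where b: "b \<in> coboundaries k" "y = b + x" using y by auto
    then have "b \<in> cocycles k" using coboundaries_subset by blast
    then have "y \<in> cocycles k" using b(2) assms(1) add_subgroup_add[OF add_subgroup_cocycles] by blast
    moreover have "y - x \<in> coboundaries k" using b by simp
    ultimately show ?thesis using assms(2) by blast
  qed
  moreover have "x \<in> coset (coboundaries k) x" using add_subgroup_zero[OF add_subgroup_coboundaries] by force
  ultimately have "f ` coset (coboundaries k) x = {f x}" by blast
  then show ?thesis by (simp add: on_classes_def homology_class_eq)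
qed

end

locale int_complex_map = M: int_complex C d + A: int_complex C' d'
  for C :: "int \<Rightarrow> 'b::ab_group_add set" and d and C' :: "int \<Rightarrow> 'c::ab_group_add set" and d' +
  fixes r :: "int \<Rightarrow> 'b \<Rightarrow> 'c"
  assumes r_diff: "r k (x - y) = r k x - r k y"
    and r_maps: "x \<in> C k \<Longrightarrow> r k x \<in> C' k"
    and r_d: "r (k + 1) (d k x) = d' k (r k x)"
begin

lemma r_zero: "r k 0 = 0"
  using r_diff[of k 0 0] by simp

lemma r_add: "r k (x + y) = r k x + r k y"
  using r_diff[of k "x + y" y] by simp

definition cone :: "int \<Rightarrow> ('b \<times> 'c) set" where
  "cone k = C k \<times> C' (k - 1)"

definition cone_d :: "int \<Rightarrow> 'b \<times> 'c \<Rightarrow> 'b \<times> 'c" where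
  "cone_d k = (\<lambda>(S, T). (d k S, r k S - d' (k - 1) T))"

sublocale cone: int_complex cone cone_d
proof
  show "add_subgroup (cone k)" for k
    unfolding cone_def by (rule add_subgroup_Times[OF M.subgroup_C A.subgroup_C])
  show "cone_d k (x - y) = cone_d k x - cone_d k y" for k x y
    by (cases x; cases y) (simp add: cone_d_def M.d_diff A.d_diff r_diff)
  show "cone_d k x \<in> cone (k + 1)" if xc: "x \<in> cone k" for x k
  proof -
    obtain S T where x: "x = (S, T)" "S \<in> C k" "T \<in> C' (k - 1)" using xc by (auto simp: cone_def)
    have "r k S - d' (k - 1) T \<in> C' k"
      using r_maps[OF x(2)] A.d_maps[OF x(3)] add_subgroup_diff[OF A.subgroup_C] by simp
    then show ?thesis using M.d_maps[OF x(2)] by (simp add: cone_def cone_d_def x(1))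
  qed
  show "cone_d (k + 1) (cone_d k x) = 0" if xc: "x \<in> cone k" for x k
  proof -
    obtain S T where x: "x = (S, T)" "S \<in> C k" "T \<in> C' (k - 1)" using xc by (auto simp: cone_def)
    have "d' k (d' (k - 1) T) = 0" using A.d_d[OF x(3)] by simp
    then show ?thesis using M.d_d[OF x(2)]
      by (simp add: cone_d_def x(1) r_d A.d_diff zero_prod_def)
  qed
qed

lemma cone_cocycle_iff:
  "(S, T) \<in> cone.cocycles k \<longleftrightarrow> S \<in> M.cocycles k \<and> T \<in> C' (k - 1) \<and> r k S = d' (k - 1) T"
  by (auto simp: cone_def cone_d_def zero_prod_def)

lemma r_cocycle: "S \<in> M.cocycles k \<Longrightarrow> r k S \<in> A.cocycles k"
  using r_maps r_d[of k S] r_zero by auto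

lemma r_coboundary: "S \<in> M.coboundaries k \<Longrightarrow> r k S \<in> A.coboundaries k"
  unfolding cohomologous_to_zero_def using r_maps r_d[of "k - 1"] by auto

lemma inclusion_cocycle: "T \<in> A.cocycles (k - 1) \<Longrightarrow> (0, T) \<in> cone.cocycles k"
  unfolding cone_cocycle_iff using add_subgroup_zero[OF M.subgroup_C] by (simp add: M.d_zero r_zero)

lemma inclusion_coboundary:
  assumes "T \<in> A.coboundaries (k - 1)"
  shows "(0, T) \<in> cone.coboundaries k"
proof -
  obtain T' where T': "T' \<in> C' (k - 1 - 1)" "T = d' (k - 1 - 1) T'" using assms by (auto simp: cohomologous_to_zero_def)
  show ?thesis
    by (rule cone.coboundariesI[of "(0, - T')"])
       (use T' add_subgroup_zero[OF M.subgroup_C] add_subgroup_uminus[OF A.subgroup_C] in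
        \<open>auto simp: cone_def cone_d_def M.d_zero r_zero A.d_uminus\<close>)
qed

lemma projection_coboundary: "(S, T) \<in> cone.coboundaries k \<Longrightarrow> S \<in> M.coboundaries k"
  by (auto simp: cohomologous_to_zero_def cone_def cone_d_def)

text \<open>A cone cocycle over \<open>S\<close> is exactly a cochain on the target whose coboundary is the pullback of \<open>S\<close>.\<close>

lemma exact_at_base:
  assumes S: "S \<in> M.cocycles k"
  shows "r k S \<in> A.coboundaries k \<longleftrightarrow> (\<exists>x\<in>cone.cocycles k. S - fst x \<in> M.coboundaries k)"
proof
  assume "r k S \<in> A.coboundaries k"
  then obtain T where "T \<in> C' (k - 1)" "r k S = d' (k - 1) T" by (auto simp: cohomologous_to_zero_def)
  then have "(S, T) \<in> cone.cocycles k" using S unfolding cone_cocycle_iff by simp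
  then show "\<exists>x\<in>cone.cocycles k. S - fst x \<in> M.coboundaries k"
    using add_subgroup_zero[OF M.add_subgroup_coboundaries] by (intro bexI[of _ "(S, T)"]) auto
next
  assume "\<exists>x\<in>cone.cocycles k. S - fst x \<in> M.coboundaries k"
  then obtain S' T where x: "(S', T) \<in> cone.cocycles k" "S - S' \<in> M.coboundaries k" by auto
  then have "r k S' \<in> A.coboundaries k" unfolding cone_cocycle_iff by (auto intro: A.coboundariesI)
  moreover have "r k (S - S') \<in> A.coboundaries k" by (rule r_coboundary[OF x(2)])
  ultimately have "r k (S - S') + r k S' \<in> A.coboundaries k"
    using add_subgroup_add[OF A.add_subgroup_coboundaries] by blast
  then show "r k S \<in> A.coboundaries k" by (simp add: r_diff)
qed

text \<open>The coboundary of \<open>(S, T')\<close> has first component \<open>0\<close> exactly if \<open>S\<close> is a cocycle, and then its second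
  component is \<open>r k S\<close> up to a coboundary.\<close>

lemma exact_at_target:
  assumes T: "T \<in> A.cocycles k"
  shows "(0, T) \<in> cone.coboundaries (k + 1) \<longleftrightarrow> (\<exists>S\<in>M.cocycles k. T - r k S \<in> A.coboundaries k)"
proof
  assume "(0, T) \<in> cone.coboundaries (k + 1)"
  then obtain S T' where S: "S \<in> C k" "T' \<in> C' (k - 1)" "d k S = 0" "T = r k S - d' (k - 1) T'"
    by (auto simp: cohomologous_to_zero_def cone_def cone_d_def)
  then have "T - r k S = d' (k - 1) (- T')" by (simp add: A.d_uminus)
  then have "T - r k S \<in> A.coboundaries k"
    using add_subgroup_uminus[OF A.subgroup_C S(2)] by (rule A.coboundariesI[rotated])
  with S show "\<exists>S\<in>M.cocycles k. T - r k S \<in> A.coboundaries k" by blast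
next
  assume "\<exists>S\<in>M.cocycles k. T - r k S \<in> A.coboundaries k"
  then obtain S T' where S: "S \<in> C k" "d k S = 0" "T' \<in> C' (k - 1)" "T - r k S = d' (k - 1) T'"
    by (auto simp: cohomologous_to_zero_def)
  then have "T = r k S + d' (k - 1) T'" by (simp add: algebra_simps)
  then show "(0, T) \<in> cone.coboundaries (k + 1)"
    using S add_subgroup_uminus[OF A.subgroup_C S(3)]
    by (intro cone.coboundariesI[of "(S, - T')"]) (auto simp: cone_def cone_d_def A.d_uminus)
qed

text \<open>If \<open>S = d S'\<close>, subtracting the coboundary of \<open>(S', 0)\<close> removes the first component.\<close>

lemma exact_at_cone:
  assumes x: "x \<in> cone.cocycles k"
  shows "fst x \<in> M.coboundaries k \<longleftrightarrow> (\<exists>T\<in>A.cocycles (k - 1). x - (0, T) \<in> cone.coboundaries k)"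
proof
  obtain S T where xx: "x = (S, T)" by (cases x)
  note ST = x[unfolded xx cone_cocycle_iff]
  assume "fst x \<in> M.coboundaries k"
  then obtain S' where S': "S' \<in> C (k - 1)" "S = d (k - 1) S'" by (auto simp: cohomologous_to_zero_def xx)
  let ?T = "T - r (k - 1) S'"
  have "?T \<in> C' (k - 1)" using ST r_maps[OF S'(1)] add_subgroup_diff[OF A.subgroup_C] by blast
  moreover have "d' (k - 1) ?T = 0" using ST S'(2) r_d[of "k - 1" S'] by (simp add: A.d_diff)
  moreover have "x - (0, ?T) \<in> cone.coboundaries k"
    by (rule cone.coboundariesI[of "(S', 0)"])
       (use S' add_subgroup_zero[OF A.subgroup_C] in \<open>auto simp: xx cone_def cone_d_def A.d_zero\<close>)
  ultimately show "\<exists>T\<in>A.cocycles (k - 1). x - (0, T) \<in> cone.coboundaries k" by blast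
next
  obtain S T where xx: "x = (S, T)" by (cases x)
  assume "\<exists>T\<in>A.cocycles (k - 1). x - (0, T) \<in> cone.coboundaries k"
  then show "fst x \<in> M.coboundaries k" using projection_coboundary unfolding xx by fastforce
qed

end

section \<open>Lifting homomorphisms modulo a subgroup of the reals\<close>

lemma add_subgroup_frag_cmul:
  fixes P :: "('a chain \<times> real) set"
  assumes P: "add_subgroup P" "(x, s) \<in> P"
  shows "(frag_cmul n x, of_int n * s) \<in> P"
proof -
  have nat: "(frag_cmul (int m) x, of_int (int m) * s) \<in> P" for m
  proof (induction m)
    case 0
    then show ?case using add_subgroup_zero[OF P(1)] by (simp add: zero_prod_def)
  next
    case (Suc m)
    from add_subgroup_add[OF P(1) Suc P(2)] show ?case by (simp add: frag_cmul_distrib algebra_simps)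
  qed
  show ?thesis
  proof (cases "n \<ge> 0")
    case True
    then show ?thesis using nat[of "nat n"] by simp
  next
    case False
    then have "- (frag_cmul (int (nat (- n))) x, of_int (int (nat (- n))) * s) = (frag_cmul n x, of_int n * s)"
      by simp
    then show ?thesis using add_subgroup_uminus[OF P(1) nat[of "nat (- n)"]] by simp
  qed
qed

text \<open>Since the reals are divisible, so is their quotient by \<open>\<Lambda>\<close>, and a homomorphism into the quotient
  extends to any larger group. Here a homomorphism modulo \<open>\<Lambda>\<close> is represented by its graph, a subgroup
  of the product that meets the second factor in \<open>\<Lambda>\<close> only; Zorn's lemma yields a maximal graph, and a
  graph missing \<open>x\<close> can be enlarged by dividing the value at the least multiple of \<open>x\<close> in its domain.\<close>

lemma maximal_graph:
  fixes P0 :: "('a chain \<times> real) set"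
  assumes P0: "add_subgroup P0" "\<And>q. (0, q) \<in> P0 \<Longrightarrow> q \<in> \<Lambda>"
  obtains P where "add_subgroup P" "P0 \<subseteq> P" "\<And>q. (0, q) \<in> P \<Longrightarrow> q \<in> \<Lambda>" "\<And>x. \<exists>r. (x, r) \<in> P"
proof -
  define \<A> where "\<A> = {P. add_subgroup P \<and> P0 \<subseteq> P \<and> (\<forall>q. (0, q) \<in> P \<longrightarrow> q \<in> \<Lambda>)}"
  have "\<exists>P\<in>\<A>. \<forall>Q\<in>\<A>. P \<subseteq> Q \<longrightarrow> Q = P"
  proof (rule subset_Zorn_nonempty)
    show "\<A> \<noteq> {}" using P0 by (auto simp: \<A>_def)
    fix \<C> assume ne: "\<C> \<noteq> {}" and ch: "subset.chain \<A> \<C>"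
    then have sub: "\<C> \<subseteq> \<A>" and lin: "\<And>P Q. P \<in> \<C> \<Longrightarrow> Q \<in> \<C> \<Longrightarrow> P \<subseteq> Q \<or> Q \<subseteq> P"
      by (auto simp: subset.chain_def)
    have "add_subgroup (\<Union>\<C>)"
      unfolding add_subgroup_def
    proof (intro conjI ballI)
      show "0 \<in> \<Union>\<C>" using ne sub add_subgroup_zero by (fastforce simp: \<A>_def)
      fix x y assume "x \<in> \<Union>\<C>" "y \<in> \<Union>\<C>"
      then obtain P Q where "P \<in> \<C>" "Q \<in> \<C>" "x \<in> P" "y \<in> Q" by blast
      then obtain R where "R \<in> \<C>" "x \<in> R" "y \<in> R" using lin[of P Q] by blast
      moreover from this have "add_subgroup R" using sub by (auto simp: \<A>_def)
      ultimately show "x - y \<in> \<Union>\<C>" using add_subgroup_diff[of R x y] by blast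
    qed
    then show "\<Union>\<C> \<in> \<A>" using ne sub by (auto simp: \<A>_def)
  qed
  then obtain P where P: "P \<in> \<A>" and max: "\<And>Q. Q \<in> \<A> \<Longrightarrow> P \<subseteq> Q \<Longrightarrow> Q = P" by blast
  have PS: "add_subgroup P" and P0P: "P0 \<subseteq> P" and P\<Lambda>: "\<And>q. (0, q) \<in> P \<Longrightarrow> q \<in> \<Lambda>" using P by (auto simp: \<A>_def)
  have "\<exists>r. (x, r) \<in> P" for x
  proof -
    define I where "I = {n::int. \<exists>q. (frag_cmul n x, q) \<in> P}"
    \<comment> \<open>\<open>m\<close> generates the ideal of the integers \<open>n\<close> for which \<open>n\<close> times \<open>x\<close> lies in the domain, and \<open>s\<close> is a
      value at \<open>m\<close> times \<open>x\<close>.\<close>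
    obtain m s where m: "\<And>n. n \<in> I \<Longrightarrow> \<exists>l. n = l * m" "(frag_cmul m x, s) \<in> P" "m = 0 \<Longrightarrow> s = 0"
    proof (cases "I \<subseteq> {0}")
      case True
      have "(frag_cmul 0 x, 0) \<in> P" using add_subgroup_zero[OF PS] by (simp add: zero_prod_def)
      then show ?thesis using that[of 0 0] True by auto
    next
      case False
      then obtain n where n: "n \<in> I" "n \<noteq> 0" by blast
      have neg: "- i \<in> I" if "i \<in> I" for i
        using that add_subgroup_uminus[OF PS] unfolding I_def by fastforce
      have "\<bar>n\<bar> \<in> I" using n neg[of n] by (auto simp: abs_if)
      then have ex: "\<exists>j. j > 0 \<and> int j \<in> I" using n(2) by (intro exI[where x="nat \<bar>n\<bar>"]) auto
      define j where "j = (LEAST j. j > 0 \<and> int j \<in> I)"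
      have j: "j > 0" "int j \<in> I" using LeastI_ex[OF ex] by (auto simp: j_def)
      obtain s where s: "(frag_cmul (int j) x, s) \<in> P" using j(2) by (auto simp: I_def)
      have "\<exists>l. i = l * int j" if i: "i \<in> I" for i
      proof -
        obtain q where "(frag_cmul i x, q) \<in> P" using i by (auto simp: I_def)
        from add_subgroup_diff[OF PS this add_subgroup_frag_cmul[OF PS s, of "i div int j"]]
        have "(frag_cmul (i - i div int j * int j) x, q - of_int (i div int j) * s) \<in> P"
          by (simp add: frag_cmul_diff_distrib)
        then have "i mod int j \<in> I" unfolding I_def by (auto simp: minus_div_mult_eq_mod)
        then have "\<not> 0 < nat (i mod int j)"
          using not_less_Least[of "nat (i mod int j)" "\<lambda>j. j > 0 \<and> int j \<in> I"] j(1) unfolding j_def[symmetric]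
          by (auto simp: nat_less_iff)
        then have "i mod int j = 0" using j(1) by (simp add: order_antisym)
        then show ?thesis by (metis div_mult_mod_eq add.right_neutral)
      qed
      then show ?thesis using that[of "int j" s] s j(1) by auto
    qed
    \<comment> \<open>If \<open>m = 0\<close>, any value at \<open>x\<close> is admissible; the quotient then is \<open>0\<close>.\<close>
    define r where "r = s / of_int m"
    have rm: "of_int m * r = s" using m(3) by (auto simp: r_def)
    define Q where "Q = {p + (frag_cmul n x, of_int n * r) | p n. p \<in> P}"
    have PQ: "p + (frag_cmul n x, of_int n * r) \<in> Q" if "p \<in> P" for p n
      unfolding Q_def using that by blast
    have "P \<subseteq> Q"
    proof
      fix p assume "p \<in> P"
      from PQ[OF this, of 0] show "p \<in> Q" by (simp add: zero_prod_def[symmetric])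
    qed
    moreover have "Q \<in> \<A>"
      unfolding \<A>_def
    proof (intro CollectI conjI allI impI)
      show "add_subgroup Q"
        unfolding add_subgroup_def
      proof (intro conjI ballI)
        show "0 \<in> Q" using \<open>P \<subseteq> Q\<close> add_subgroup_zero[OF PS] by blast
        fix y z assume "y \<in> Q" "z \<in> Q"
        then obtain p q n l where "p \<in> P" "q \<in> P" "y = p + (frag_cmul n x, of_int n * r)" "z = q + (frag_cmul l x, of_int l * r)"
          unfolding Q_def by blast
        moreover from this have "p - q + (frag_cmul (n - l) x, of_int (n - l) * r) \<in> Q"
          using PQ add_subgroup_diff[OF PS] by blast
        moreover have "p + (frag_cmul n x, of_int n * r) - (q + (frag_cmul l x, of_int l * r)) =
            p - q + (frag_cmul (n - l) x, of_int (n - l) * r)"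
          by (cases p; cases q) (simp add: frag_cmul_diff_distrib algebra_simps)
        ultimately show "y - z \<in> Q" by (simp only:)
      qed
      show "P0 \<subseteq> Q" using P0P \<open>P \<subseteq> Q\<close> by blast
      fix q assume "(0, q) \<in> Q"
      then obtain y t n where p: "(y, t) \<in> P" "y + frag_cmul n x = 0" "q = t + of_int n * r" by (auto simp: Q_def)
      then have y: "y = - frag_cmul n x" by (simp only: eq_neg_iff_add_eq_0)
      have "- (y, t) \<in> P" by (rule add_subgroup_uminus[OF PS p(1)])
      then have "n \<in> I" unfolding I_def by (auto simp: y)
      then obtain l where l: "n = l * m" using m(1) by blast
      from add_subgroup_add[OF PS p(1) add_subgroup_frag_cmul[OF PS m(2), of l]]
      have "(y + frag_cmul n x, t + of_int l * s) \<in> P" by (simp add: l)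
      then have "t + of_int l * s \<in> \<Lambda>" using P\<Lambda> p(2) by simp
      moreover have "t + of_int l * s = q" unfolding p(3) l rm[symmetric] by simp
      ultimately show "q \<in> \<Lambda>" by simp
    qed
    ultimately have "Q = P" using max by blast
    moreover have "(x, r) \<in> Q" using PQ[OF add_subgroup_zero[OF PS], of 1] by (simp add: zero_prod_def)
    ultimately show ?thesis by blast
  qed
  then show ?thesis using that[OF PS P0P P\<Lambda>] by blast
qed

text \<open>On the free group of chains, an extension modulo \<open>\<Lambda>\<close> lifts to a real-valued homomorphism: choose
  values on the simplices.\<close>

lemma lift_mod_subgroup:
  fixes H :: "'a chain set"
  assumes \<Lambda>: "add_subgroup \<Lambda>" and H: "add_subgroup H"
    and f: "\<And>x y. x \<in> H \<Longrightarrow> y \<in> H \<Longrightarrow> f (x + y) - f x - f y \<in> \<Lambda>"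
  obtains \<phi> :: "((nat \<Rightarrow> real) \<Rightarrow> 'a) \<Rightarrow> real" where "\<And>x. x \<in> H \<Longrightarrow> chain_eval \<phi> x - f x \<in> \<Lambda>"
proof -
  note cl = add_subgroup_zero[OF \<Lambda>] add_subgroup_diff[OF \<Lambda>] add_subgroup_add[OF \<Lambda>] add_subgroup_uminus[OF \<Lambda>]
  define P0 where "P0 = {(x, r). x \<in> H \<and> r - f x \<in> \<Lambda>}"
  have f0: "f 0 \<in> \<Lambda>" using f[of 0 0] add_subgroup_zero[OF H] cl(4)[of "- f 0"] by simp
  have sub: "add_subgroup P0"
    unfolding add_subgroup_def
  proof (intro conjI ballI)
    show "0 \<in> P0" using add_subgroup_zero[OF H] f0 cl(4) by (simp add: P0_def zero_prod_def)
    fix p q assume "p \<in> P0" "q \<in> P0"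
    then obtain x r y s where p: "p = (x, r)" "q = (y, s)" "x \<in> H" "y \<in> H" "r - f x \<in> \<Lambda>" "s - f y \<in> \<Lambda>"
      by (auto simp: P0_def)
    have d: "x - y \<in> H" by (rule add_subgroup_diff[OF H p(3,4)])
    from f[OF d p(4)] have "f x - f (x - y) - f y \<in> \<Lambda>" by simp
    from cl(3)[OF cl(2)[OF p(5,6)] this] have "r - s - f (x - y) \<in> \<Lambda>" by (simp add: algebra_simps)
    then show "p - q \<in> P0" using d by (simp add: P0_def p)
  qed
  moreover have "q \<in> \<Lambda>" if "(0, q) \<in> P0" for q
    using cl(3)[of "q - f 0" "f 0"] that f0 by (simp add: P0_def)
  ultimately have "\<exists>P. add_subgroup P \<and> P0 \<subseteq> P \<and> (\<forall>q. (0, q) \<in> P \<longrightarrow> q \<in> \<Lambda>) \<and> (\<forall>x. \<exists>r. (x, r) \<in> P)"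
    by (rule maximal_graph) blast+
  then obtain P where P: "add_subgroup P" "P0 \<subseteq> P" "\<And>q. (0, q) \<in> P \<Longrightarrow> q \<in> \<Lambda>" "\<And>x. \<exists>r. (x, r) \<in> P"
    by blast
  define \<phi> where "\<phi> \<sigma> = (SOME r. (frag_of \<sigma>, r) \<in> P)" for \<sigma>
  have \<phi>: "(frag_of \<sigma>, \<phi> \<sigma>) \<in> P" for \<sigma> unfolding \<phi>_def by (rule someI_ex[OF P(4)])
  have eval: "(c, chain_eval \<phi> c) \<in> P" for c
  proof (rule frag_induction[where S=UNIV])
    show "(0, chain_eval \<phi> 0) \<in> P" using add_subgroup_zero[OF P(1)] by (simp add: zero_prod_def)
    show "(a - b, chain_eval \<phi> (a - b)) \<in> P" if "(a, chain_eval \<phi> a) \<in> P" "(b, chain_eval \<phi> b) \<in> P" for a b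
      using add_subgroup_diff[OF P(1) that] by (simp add: chain_eval_diff)
  qed (simp_all add: \<phi>)
  have "chain_eval \<phi> x - f x \<in> \<Lambda>" if "x \<in> H" for x
  proof -
    have "(x, f x) \<in> P" using that cl(1) P(2) by (auto simp: P0_def)
    from add_subgroup_diff[OF P(1) eval[of x] this] show ?thesis using P(3) by simp
  qed
  then show ?thesis using that by blast
qed

section \<open>The Hopkins-Singer complex\<close>

lemma subring_add_subgroup:
  assumes "subring \<Lambda> real_ring"
  shows "add_subgroup \<Lambda>"
proof -
  have sg: "subgroup \<Lambda> (add_monoid real_ring)" using assms by (simp add: subring_def)
  have inv: "inv\<^bsub>add_monoid real_ring\<^esub> x = - x" for x
    unfolding m_inv_def by (rule the_equality) (auto simp: real_ring_def)
  have "0 \<in> \<Lambda>" using subgroup.one_closed[OF sg] by (simp add: real_ring_def)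
  moreover have "x - y \<in> \<Lambda>" if "x \<in> \<Lambda>" "y \<in> \<Lambda>" for x y
    using subgroup.m_closed[OF sg that(1) subgroup.m_inv_closed[OF sg that(2)]] unfolding inv
    by (simp add: real_ring_def)
  ultimately show ?thesis by (simp add: add_subgroup_def)
qed

lemma cochains_iff:
  "f \<in> cochains X G k \<longleftrightarrow> (\<forall>c\<in>smooth_chains X k. f c \<in> G) \<and>
     (\<forall>a\<in>smooth_chains X k. \<forall>b\<in>smooth_chains X k. f (a + b) = f a + f b) \<and>
     (\<forall>c. c \<notin> smooth_chains X k \<longrightarrow> f c = 0)"
  by (auto simp: cochains_def hom_def additive_group_def smooth_chain_group_def)

lemma cochains_subgroup:
  assumes "add_subgroup G"
  shows "add_subgroup (cochains X G k)"
  unfolding add_subgroup_def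
proof (intro conjI ballI)
  show "0 \<in> cochains X G k" using add_subgroup_zero[OF assms] by (simp add: cochains_iff)
  fix f g assume "f \<in> cochains X G k" "g \<in> cochains X G k"
  then show "f - g \<in> cochains X G k" using add_subgroup_diff[OF assms] by (simp add: cochains_iff)
qed

lemma cochains_zero: "f \<in> cochains X G k \<Longrightarrow> f 0 = 0"
  unfolding cochains_iff by (metis add_cancel_right_right smooth_chains_0 add.right_neutral)

lemma cochains_diff:
  assumes "f \<in> cochains X G k" "a \<in> smooth_chains X k" "b \<in> smooth_chains X k"
  shows "f (a - b) = f a - f b"
proof -
  have "f (a - b + b) = f (a - b) + f b"
    using assms smooth_chains_diff unfolding cochains_iff by blast
  then show ?thesis by simp
qed

lemma chain_eval_cochain: "(\<lambda>c. if c \<in> smooth_chains X k then chain_eval \<phi> c else 0) \<in> cochains X UNIV k"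
  by (auto simp: cochains_iff chain_eval_add smooth_chains_add)

lemma forms_cochains: "w \<in> forms X k \<Longrightarrow> w \<in> cochains X UNIV k"
  using forms_additive by (auto simp: cochains_iff)

lemma cochains_mono: "f \<in> cochains X G k \<Longrightarrow> G \<subseteq> H \<Longrightarrow> f \<in> cochains X H k"
  unfolding cochains_iff by blast

lemma period_forms_subgroup:
  assumes X: "compact_smooth_manifold X" and \<Lambda>: "add_subgroup \<Lambda>"
  shows "add_subgroup (period_forms X \<Lambda> k)"
  unfolding add_subgroup_def period_forms_def
  using forms_zero[OF X] forms_add[OF X _ forms_uminus[OF X]] add_subgroup_zero[OF \<Lambda>] add_subgroup_diff[OF \<Lambda>]
  by auto

lemma boundary_boundary:
  assumes "c \<in> smooth_chains X k"
  shows "chain_boundary (nat (k - 1)) (chain_boundary (nat k) c) = 0"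
proof (cases "k \<ge> 1")
  case True
  define p where "p = nat (k - 1)"
  have k: "k = int (Suc p)" using True by (simp add: p_def)
  then have p: "nat k = Suc p" "nat (k - 1) = p" by auto
  have "Poly_Mapping.keys c \<subseteq> singular_simplex_set (Suc p) (mtop X)"
    using assms smooth_simplices_int[of _ X "Suc p"] unfolding smooth_chains_iff k by blast
  then show ?thesis
    unfolding p using chain_boundary_boundary_alt[of p "mtop X" c] by (simp add: singular_chain_def)
qed (simp add: chain_boundary_def)

lemma smooth_cycles_iff: "z \<in> smooth_cycles X k \<longleftrightarrow> z \<in> smooth_chains X k \<and> chain_boundary (nat k) z = 0"
  by (simp add: smooth_cycles_def)

lemma smooth_cycles_subgroup: "add_subgroup (smooth_cycles X k)"
  unfolding add_subgroup_def by (auto simp: smooth_cycles_iff chain_boundary_diff smooth_chains_diff)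

lemma boundary_cycle:
  "compact_smooth_manifold X \<Longrightarrow> c \<in> smooth_chains X k \<Longrightarrow> chain_boundary (nat k) c \<in> smooth_cycles X (k - 1)"
  by (simp add: smooth_cycles_iff chain_boundary_smooth boundary_boundary)

lemma coboundary_diff: "coboundary X k (f - g) = coboundary X k f - coboundary X k g"
  by (auto simp: coboundary_def)

lemma coboundary_uminus: "coboundary X k (- f) = - coboundary X k f"
  by (auto simp: coboundary_def)

lemma coboundary_cochain:
  assumes "compact_smooth_manifold X" "f \<in> cochains X G k" "0 \<in> G"
  shows "coboundary X k f \<in> cochains X G (k + 1)"
proof -
  have "chain_boundary (nat (k + 1)) c \<in> smooth_chains X k" if "c \<in> smooth_chains X (k + 1)" for c
    using chain_boundary_smooth[OF assms(1) that] by simp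
  then show ?thesis
    using assms unfolding cochains_iff
    by (auto simp: coboundary_def chain_boundary_add smooth_chains_add)
qed

lemma coboundary_coboundary:
  assumes X: "compact_smooth_manifold X" and f: "f \<in> cochains X G k"
  shows "coboundary X (k + 1) (coboundary X k f) = 0"
proof
  fix c
  show "coboundary X (k + 1) (coboundary X k f) c = 0 c"
  proof (cases "c \<in> smooth_chains X (k + 1 + 1)")
    case True
    have "chain_boundary (nat (k + 1)) (chain_boundary (nat (k + 1 + 1)) c) = 0"
      using boundary_boundary[OF True] unfolding add_diff_cancel_right' .
    then show ?thesis using cochains_zero[OF f] by (simp add: coboundary_def)
  qed (simp add: coboundary_def)
qed

lemma hs_diff_mem:
  assumes X: "compact_smooth_manifold X" and \<Lambda>: "add_subgroup \<Lambda>" and x: "x \<in> hs_cochains X \<Lambda> k"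
  shows "hs_diff X k x \<in> hs_cochains X \<Lambda> (k + 1)"
proof -
  obtain c h w where x': "x = (c, h, w)" "c \<in> cochains X \<Lambda> k" "h \<in> cochains X UNIV (k - 1)" "w \<in> period_forms X \<Lambda> k"
    using x by (auto simp: hs_cochains_def)
  have U: "add_subgroup (UNIV :: real set)" by (simp add: add_subgroup_def)
  have "w \<in> cochains X UNIV k" using x'(4) by (simp add: period_forms_def forms_cochains)
  moreover have "c \<in> cochains X UNIV k" using cochains_mono[OF x'(2)] by blast
  moreover have "coboundary X (k - 1) h \<in> cochains X UNIV k" using coboundary_cochain[OF X x'(3)] by simp
  ultimately have "w - c - coboundary X (k - 1) h \<in> cochains X UNIV k"
    using add_subgroup_diff[OF cochains_subgroup[OF U]] by blast
  moreover have "coboundary X k c \<in> cochains X \<Lambda> (k + 1)"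
    by (rule coboundary_cochain[OF X x'(2) add_subgroup_zero[OF \<Lambda>]])
  moreover have "0 \<in> period_forms X \<Lambda> (k + 1)"
    by (rule add_subgroup_zero[OF period_forms_subgroup[OF X \<Lambda>]])
  ultimately show ?thesis by (simp add: x'(1) hs_diff_def hs_cochains_def)
qed

text \<open>The square of the differential sends \<open>(c, h, \<omega>)\<close> to \<open>(0, - \<delta>\<omega>, 0)\<close>, so it vanishes because forms with
  \<open>\<Lambda>\<close>-periods are closed.\<close>

lemma hs_complex:
  assumes X: "compact_smooth_manifold X" and \<Lambda>: "add_subgroup \<Lambda>" "\<Lambda> \<noteq> UNIV"
  shows "int_complex (hs_cochains X \<Lambda>) (hs_diff X)"
proof
  show "add_subgroup (hs_cochains X \<Lambda> k)" for k
    unfolding hs_cochains_def using \<Lambda>(1) period_forms_subgroup[OF X \<Lambda>(1)]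
    by (intro add_subgroup_Times cochains_subgroup) (auto simp: add_subgroup_def)
  show "hs_diff X k (x - y) = hs_diff X k x - hs_diff X k y" for k x y
    by (cases x; cases y) (simp add: hs_diff_def coboundary_diff)
  show "hs_diff X k x \<in> hs_cochains X \<Lambda> (k + 1)" if "x \<in> hs_cochains X \<Lambda> k" for k x
    by (rule hs_diff_mem[OF X \<Lambda>(1) that])
  show "hs_diff X (k + 1) (hs_diff X k x) = 0" if xc: "x \<in> hs_cochains X \<Lambda> k" for k x
  proof -
    obtain c h w where x: "x = (c, h, w)" "c \<in> cochains X \<Lambda> k" "h \<in> cochains X UNIV (k - 1)" "w \<in> period_forms X \<Lambda> k"
      using xc by (auto simp: hs_cochains_def)
    have "coboundary X k w = 0"
      using period_form_closed[OF X \<Lambda> x(4)] by (auto simp: coboundary_def)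
    moreover have "coboundary X k (coboundary X (k - 1) h) = 0"
      using coboundary_coboundary[OF X x(3)] by simp
    ultimately show ?thesis
      using coboundary_coboundary[OF X x(2)]
      by (simp add: hs_diff_def x(1) coboundary_diff zero_prod_def)
  qed
qed

lemma cochain_pullback_diff:
  "cochain_pullback A \<rho> k (f - g) = cochain_pullback A \<rho> k f - cochain_pullback A \<rho> k g"
  by (auto simp: cochain_pullback_def)

lemma chain_map_boundary:
  assumes "c \<in> smooth_chains A k"
  shows "chain_boundary (nat k) (chain_map (nat k) \<rho> c) = chain_map (nat (k - 1)) \<rho> (chain_boundary (nat k) c)"
proof (cases "k \<ge> 0")
  case True
  have nat_eq: "nat (k - 1) = nat k - Suc 0" by linarith
  have "Poly_Mapping.keys c \<subseteq> singular_simplex_set (nat k) (mtop A)"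
    using assms smooth_simplices_int[of _ A "nat k"] True unfolding smooth_chains_iff by auto
  then show ?thesis
    using chain_boundary_chain_map[of "nat k" "mtop A" c \<rho>] nat_eq
    by (simp add: singular_chain_def)
qed (simp add: chain_boundary_def)

lemma hs_complex_map:
  assumes A: "compact_smooth_manifold A" and M: "compact_smooth_manifold M" and \<rho>: "smooth_map A M \<rho>"
    and \<Lambda>: "add_subgroup \<Lambda>" "\<Lambda> \<noteq> UNIV"
  shows "int_complex_map (hs_cochains M \<Lambda>) (hs_diff M) (hs_cochains A \<Lambda>) (hs_diff A) (hs_pullback A \<rho>)"
proof (intro int_complex_map.intro int_complex_map_axioms.intro hs_complex A M \<Lambda>)
  show "hs_pullback A \<rho> k (x - y) = hs_pullback A \<rho> k x - hs_pullback A \<rho> k y" for k x y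
    by (cases x; cases y) (simp add: hs_pullback_def cochain_pullback_diff)
  have push: "chain_map (nat k) \<rho> c \<in> smooth_chains M k" if "c \<in> smooth_chains A k" for c k
    by (rule chain_map_smooth[OF A M \<rho> that])
  have pull: "cochain_pullback A \<rho> k f \<in> cochains A G k" if "f \<in> cochains M G k" for f G k
    using that push unfolding cochains_iff
    by (auto simp: cochain_pullback_def chain_map_add smooth_chains_add)
  show "hs_pullback A \<rho> k x \<in> hs_cochains A \<Lambda> k" if xc: "x \<in> hs_cochains M \<Lambda> k" for k x
  proof -
    obtain c h w where x: "x = (c, h, w)" "c \<in> cochains M \<Lambda> k" "h \<in> cochains M UNIV (k - 1)" "w \<in> period_forms M \<Lambda> k"
      using xc by (auto simp: hs_cochains_def)
    have "chain_map (nat k) \<rho> z \<in> smooth_cycles M k" if "z \<in> smooth_cycles A k" for z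
      using that push chain_map_boundary[of z A k \<rho>] by (simp add: smooth_cycles_iff)
    then have "cochain_pullback A \<rho> k w \<in> period_forms A \<Lambda> k"
      using x(4) forms_pullback[OF A M \<rho>] by (auto simp: period_forms_def cochain_pullback_def smooth_cycles_iff)
    then show ?thesis using pull[OF x(2)] pull[OF x(3)] by (simp add: x(1) hs_pullback_def hs_cochains_def)
  qed
  have comm: "cochain_pullback A \<rho> (k + 1) (coboundary M k f) = coboundary A k (cochain_pullback A \<rho> k f)" for k f
  proof
    fix c
    show "cochain_pullback A \<rho> (k + 1) (coboundary M k f) c = coboundary A k (cochain_pullback A \<rho> k f) c"
    proof (cases "c \<in> smooth_chains A (k + 1)")
      case True
      then show ?thesis
        using push[OF True] chain_boundary_smooth[OF A True] chain_map_boundary[OF True, of \<rho>]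
        by (simp add: cochain_pullback_def coboundary_def)
    qed (simp add: cochain_pullback_def coboundary_def)
  qed
  have z: "cochain_pullback A \<rho> k 0 = 0" for k by (auto simp: cochain_pullback_def)
  show "hs_pullback A \<rho> (k + 1) (hs_diff M k x) = hs_diff A k (hs_pullback A \<rho> k x)" for k x
  proof -
    obtain c h w where x: "x = (c, h, w)" by (cases x)
    show ?thesis
      using comm[of k c] comm[of "k - 1" h] by (simp add: x hs_pullback_def hs_diff_def cochain_pullback_diff z)
  qed
qed

section \<open>Cocycles present differential characters\<close>

lemma character_iff:
  "f \<in> carrier (differential_characters X \<Lambda> k) \<longleftrightarrow>
     f \<in> extensional (smooth_cycles X (k - 1)) \<and>
     (\<forall>z\<in>smooth_cycles X (k - 1). \<exists>r. f z = coset \<Lambda> r) \<and>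
     (\<forall>z\<in>smooth_cycles X (k - 1). \<forall>z'\<in>smooth_cycles X (k - 1).
        f (z + z') = f z <#>\<^bsub>additive_group UNIV\<^esub> f z') \<and>
     (\<exists>w\<in>forms X k. \<forall>c\<in>smooth_chains X k. f (chain_boundary (nat k) c) = coset \<Lambda> (w c))"
proof -
  have c: "carrier (smooth_cycle_group X j) = smooth_cycles X j"
    "(\<otimes>\<^bsub>smooth_cycle_group X j\<^esub>) = (+)" for j
    by (auto simp: smooth_cycle_group_def smooth_chain_group_def fun_eq_iff)
  show ?thesis
    unfolding differential_characters_def Let_def hom_group_def hom_def
    by (simp add: c carrier_additive_quotient mult_additive_quotient reduce_eq_coset image_iff Pi_iff) blast
qed

lemma character_mult:
  "f \<otimes>\<^bsub>differential_characters X \<Lambda> k\<^esub> g =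
    (\<lambda>z\<in>smooth_cycles X (k - 1). f z <#>\<^bsub>additive_group UNIV\<^esub> g z)"
  unfolding differential_characters_def Let_def hom_group_def
  by (simp add: smooth_cycle_group_def mult_additive_quotient)

lemma character_one: "\<one>\<^bsub>differential_characters X \<Lambda> k\<^esub> = (\<lambda>z\<in>smooth_cycles X (k - 1). \<Lambda>)"
  unfolding differential_characters_def Let_def hom_group_def
  by (simp add: smooth_cycle_group_def one_additive_quotient)

lemma hs_cocycle_iff:
  "(c, h, w) \<in> hs_cochains X \<Lambda> k \<and> hs_diff X k (c, h, w) = 0 \<longleftrightarrow>
    c \<in> cochains X \<Lambda> k \<and> h \<in> cochains X UNIV (k - 1) \<and> w \<in> period_forms X \<Lambda> k \<and>
    coboundary X k c = 0 \<and> w = c + coboundary X (k - 1) h"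
  by (auto simp: hs_cochains_def hs_diff_def zero_prod_def algebra_simps)

lemma hs_cocycle_value:
  assumes "w = c + coboundary X (k - 1) h" "a \<in> smooth_chains X k"
  shows "w a = c a + h (chain_boundary (nat k) a)"
  using assms by (simp add: coboundary_def)

text \<open>For a cocycle, \<open>h \<circ> \<partial>\<close> is \<open>\<omega> - c\<close>, which is \<open>\<omega>\<close> modulo \<open>\<Lambda>\<close>.\<close>

lemma cocycle_character_mem:
  assumes X: "compact_smooth_manifold X" and \<Lambda>: "add_subgroup \<Lambda>"
    and x: "(c, h, w) \<in> hs_cochains X \<Lambda> k" "hs_diff X k (c, h, w) = 0"
  shows "cocycle_character X \<Lambda> k (c, h, w) \<in> carrier (differential_characters X \<Lambda> k)"
proof -
  have c: "c \<in> cochains X \<Lambda> k" and h: "h \<in> cochains X UNIV (k - 1)" and w: "w \<in> period_forms X \<Lambda> k"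
    and ch: "w = c + coboundary X (k - 1) h"
    using x hs_cocycle_iff[of c h w X \<Lambda> k] by auto
  have hadd: "h (z + z') = h z + h z'" if "z \<in> smooth_cycles X (k - 1)" "z' \<in> smooth_cycles X (k - 1)" for z z'
    using h that by (simp add: cochains_iff smooth_cycles_iff)
  have "coset \<Lambda> (h (chain_boundary (nat k) a)) = coset \<Lambda> (w a)" if a: "a \<in> smooth_chains X k" for a
  proof -
    have "c a \<in> \<Lambda>" using c a by (simp add: cochains_iff)
    then show ?thesis
      unfolding coset_eq_iff[OF \<Lambda>] hs_cocycle_value[OF ch a] using add_subgroup_uminus[OF \<Lambda>] by simp
  qed
  moreover have "w \<in> forms X k" using w by (simp add: period_forms_def)
  moreover have "z + z' \<in> smooth_cycles X (k - 1)" if "z \<in> smooth_cycles X (k - 1)" "z' \<in> smooth_cycles X (k - 1)" for z z'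
    using add_subgroup_add[OF smooth_cycles_subgroup that] .
  ultimately show ?thesis
    unfolding character_iff cocycle_character_def reduce_eq_coset
    using hadd boundary_cycle[OF X]
    by (intro conjI ballI bexI[of _ w]) (simp_all add: coset_set_mult[OF \<Lambda>], blast)
qed

text \<open>A real cochain \<open>h\<close> lifting the character has \<open>\<omega> - \<delta>h\<close> with values in \<open>\<Lambda>\<close>; this is \<open>c\<close>, and it is a cocycle
  because \<open>\<omega>\<close> is closed.\<close>

lemma cocycle_character_surj:
  assumes X: "compact_smooth_manifold X" and \<Lambda>: "add_subgroup \<Lambda>" "\<Lambda> \<noteq> UNIV"
    and f: "f \<in> carrier (differential_characters X \<Lambda> k)"
  shows "\<exists>x. x \<in> hs_cochains X \<Lambda> k \<and> hs_diff X k x = 0 \<and> cocycle_character X \<Lambda> k x = f"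
proof -
  let ?Z = "smooth_cycles X (k - 1)"
  have ext: "f \<in> extensional ?Z" and val: "\<forall>z\<in>?Z. \<exists>r. f z = coset \<Lambda> r"
    and add: "\<And>z z'. z \<in> ?Z \<Longrightarrow> z' \<in> ?Z \<Longrightarrow> f (z + z') = f z <#>\<^bsub>additive_group UNIV\<^esub> f z'"
    using f by (auto simp: character_iff)
  obtain w where w: "w \<in> forms X k" "\<And>c. c \<in> smooth_chains X k \<Longrightarrow> f (chain_boundary (nat k) c) = coset \<Lambda> (w c)"
    using f by (auto simp: character_iff)
  obtain r where r: "\<And>z. z \<in> ?Z \<Longrightarrow> f z = coset \<Lambda> (r z)" using bchoice[OF val] by blast
  have "r (z + z') - r z - r z' \<in> \<Lambda>" if "z \<in> ?Z" "z' \<in> ?Z" for z z'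
  proof -
    have "coset \<Lambda> (r (z + z')) = coset \<Lambda> (r z + r z')"
      using add[OF that] r that add_subgroup_add[OF smooth_cycles_subgroup that] by (simp add: coset_set_mult[OF \<Lambda>(1)])
    then show ?thesis unfolding coset_eq_iff[OF \<Lambda>(1)] by (simp add: algebra_simps)
  qed
  then obtain \<phi> where \<phi>: "\<And>z. z \<in> ?Z \<Longrightarrow> chain_eval \<phi> z - r z \<in> \<Lambda>"
    by (rule lift_mod_subgroup[OF \<Lambda>(1) smooth_cycles_subgroup]) auto
  define h where "h c = (if c \<in> smooth_chains X (k - 1) then chain_eval \<phi> c else 0)" for c
  have h: "h \<in> cochains X UNIV (k - 1)" unfolding h_def by (rule chain_eval_cochain)
  have fh: "f z = coset \<Lambda> (h z)" if "z \<in> ?Z" for z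
  proof -
    have "coset \<Lambda> (h z) = coset \<Lambda> (r z)"
      unfolding coset_eq_iff[OF \<Lambda>(1)] using \<phi>[OF that] that by (simp add: h_def smooth_cycles_iff)
    then show ?thesis using r[OF that] by simp
  qed
  have hw: "w a - h (chain_boundary (nat k) a) \<in> \<Lambda>" if "a \<in> smooth_chains X k" for a
    using w(2)[OF that] fh[OF boundary_cycle[OF X that]] coset_eq_iff[OF \<Lambda>(1)] by metis
  have wp: "w \<in> period_forms X \<Lambda> k"
    using w(1) hw cochains_zero[OF h] by (force simp: period_forms_def smooth_cycles_iff)
  define c where "c = w - coboundary X (k - 1) h"
  have dh: "coboundary X (k - 1) h \<in> cochains X UNIV k" using coboundary_cochain[OF X h] by simp
  have "c \<in> cochains X UNIV k"
    unfolding c_def using add_subgroup_diff[OF cochains_subgroup forms_cochains[OF w(1)] dh] by (simp add: add_subgroup_def)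
  moreover have "c a \<in> \<Lambda>" if "a \<in> smooth_chains X k" for a
    using hw[OF that] that by (simp add: c_def coboundary_def)
  ultimately have c: "c \<in> cochains X \<Lambda> k" unfolding cochains_iff by blast
  have "coboundary X k w = 0" using period_form_closed[OF X \<Lambda> wp] by (auto simp: coboundary_def)
  then have "coboundary X k c = 0"
    using coboundary_coboundary[OF X h] by (simp add: c_def coboundary_diff)
  then have "(c, h, w) \<in> hs_cochains X \<Lambda> k \<and> hs_diff X k (c, h, w) = 0"
    unfolding hs_cocycle_iff using c h wp by (simp add: c_def)
  moreover have "cocycle_character X \<Lambda> k (c, h, w) = f"
    using ext fh by (auto simp: cocycle_character_def reduce_eq_coset fun_eq_iff extensional_def)
  ultimately show ?thesis by blast
qed

text \<open>If \<open>h\<close> takes values in \<open>\<Lambda>\<close> on cycles, then so does \<open>\<omega>\<close> on all chains, and \<open>\<omega> = 0\<close>. The class of \<open>h\<close>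
  modulo \<open>\<Lambda>\<close> factors through the boundary; a real lift \<open>h'\<close> of the induced map makes \<open>h - \<delta>h'\<close> a
  \<open>\<Lambda>\<close>-cochain, and its negative together with \<open>- h'\<close> bounds the cocycle.\<close>

lemma cocycle_character_trivial_iff:
  assumes X: "compact_smooth_manifold X" and \<Lambda>: "add_subgroup \<Lambda>" "\<Lambda> \<noteq> UNIV" and k: "k \<ge> 1"
    and x: "(c, h, w) \<in> hs_cochains X \<Lambda> k" "hs_diff X k (c, h, w) = 0"
  shows "(\<forall>z\<in>smooth_cycles X (k - 1). h z \<in> \<Lambda>) \<longleftrightarrow>
    (c, h, w) \<in> cohomologous_to_zero (hs_cochains X \<Lambda>) (hs_diff X) k"
proof
  have c: "c \<in> cochains X \<Lambda> k" and h: "h \<in> cochains X UNIV (k - 1)" and w: "w \<in> period_forms X \<Lambda> k"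
    and ch: "w = c + coboundary X (k - 1) h"
    using x hs_cocycle_iff[of c h w X \<Lambda> k] by auto
  assume hZ: "\<forall>z\<in>smooth_cycles X (k - 1). h z \<in> \<Lambda>"
  have "w a \<in> \<Lambda>" if a: "a \<in> smooth_chains X k" for a
    unfolding hs_cocycle_value[OF ch a] using c a hZ boundary_cycle[OF X a] add_subgroup_add[OF \<Lambda>(1)]
    by (simp add: cochains_iff)
  then have w0: "w = 0" using form_values_in_subgroup_zero[OF X \<Lambda> k] w by (simp add: period_forms_def)
  define H where "H = chain_boundary (nat (k - 1)) ` smooth_chains X (k - 1)"
  have H: "add_subgroup H"
    unfolding add_subgroup_def
  proof (intro conjI ballI)
    show "0 \<in> H" unfolding H_def by (intro image_eqI[where x=0]) auto
    fix a b assume "a \<in> H" "b \<in> H"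
    then obtain a' b' where "a' \<in> smooth_chains X (k - 1)" "b' \<in> smooth_chains X (k - 1)"
      "a = chain_boundary (nat (k - 1)) a'" "b = chain_boundary (nat (k - 1)) b'" by (auto simp: H_def)
    then show "a - b \<in> H" unfolding H_def
      by (intro image_eqI[where x="a' - b'"]) (auto simp: chain_boundary_diff smooth_chains_diff)
  qed
  define s where "s b = (SOME a. a \<in> smooth_chains X (k - 1) \<and> chain_boundary (nat (k - 1)) a = b)" for b
  have s: "s b \<in> smooth_chains X (k - 1)" "chain_boundary (nat (k - 1)) (s b) = b" if "b \<in> H" for b
    using someI_ex[of "\<lambda>a. a \<in> smooth_chains X (k - 1) \<and> chain_boundary (nat (k - 1)) a = b"] that
    unfolding s_def H_def by auto
  have hdiff: "h a - h a' \<in> \<Lambda>" if "a \<in> smooth_chains X (k - 1)" "a' \<in> smooth_chains X (k - 1)"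
    "chain_boundary (nat (k - 1)) a = chain_boundary (nat (k - 1)) a'" for a a'
  proof -
    have "a - a' \<in> smooth_cycles X (k - 1)"
      using that by (simp add: smooth_cycles_iff smooth_chains_diff chain_boundary_diff)
    then show ?thesis using hZ cochains_diff[OF h that(1,2)] by metis
  qed
  have "h (s (a + b)) - h (s a) - h (s b) \<in> \<Lambda>" if "a \<in> H" "b \<in> H" for a b
  proof -
    have "h (s (a + b)) - h (s a + s b) \<in> \<Lambda>"
      using s[OF that(1)] s[OF that(2)] s[OF add_subgroup_add[OF H that]]
      by (intro hdiff) (auto simp: chain_boundary_add smooth_chains_add)
    moreover have "h (s a + s b) = h (s a) + h (s b)" using h s(1)[OF that(1)] s(1)[OF that(2)] by (simp add: cochains_iff)
    ultimately show ?thesis by (simp add: algebra_simps)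
  qed
  then obtain \<phi> where \<phi>: "\<And>b. b \<in> H \<Longrightarrow> chain_eval \<phi> b - h (s b) \<in> \<Lambda>"
    by (rule lift_mod_subgroup[OF \<Lambda>(1) H]) auto
  define h' where "h' c = (if c \<in> smooth_chains X (k - 1 - 1) then chain_eval \<phi> c else 0)" for c
  have h': "h' \<in> cochains X UNIV (k - 1 - 1)" unfolding h'_def by (rule chain_eval_cochain)
  define c' where "c' = coboundary X (k - 1 - 1) h' - h"
  have "c' \<in> cochains X UNIV (k - 1)"
    unfolding c'_def using add_subgroup_diff[OF cochains_subgroup _ h] coboundary_cochain[OF X h'] by (simp add: add_subgroup_def)
  moreover have "c' a \<in> \<Lambda>" if a: "a \<in> smooth_chains X (k - 1)" for a
  proof -
    let ?b = "chain_boundary (nat (k - 1)) a"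
    have b: "?b \<in> H" using a by (auto simp: H_def)
    have "chain_eval \<phi> ?b - h (s ?b) + (h (s ?b) - h a) \<in> \<Lambda>"
      using \<phi>[OF b] hdiff[OF s(1)[OF b] a] s(2)[OF b] add_subgroup_add[OF \<Lambda>(1)] by blast
    then show ?thesis using a chain_boundary_smooth[OF X a] by (simp add: c'_def coboundary_def h'_def)
  qed
  ultimately have c': "c' \<in> cochains X \<Lambda> (k - 1)" unfolding cochains_iff by blast
  have "coboundary X (k - 1) (coboundary X (k - 1 - 1) h') = 0" using coboundary_coboundary[OF X h'] by simp
  moreover have "c = - coboundary X (k - 1) h"
    using ch w0 by (simp only: eq_neg_iff_add_eq_0)
  ultimately have "coboundary X (k - 1) c' = c" by (simp add: c'_def coboundary_diff)
  then have "hs_diff X (k - 1) (c', - h', 0) = (c, h, w)"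
    by (simp add: hs_diff_def w0 c'_def coboundary_uminus)
  moreover have "- h' \<in> cochains X UNIV (k - 1 - 1)"
    using add_subgroup_uminus[OF cochains_subgroup h'] by (simp add: add_subgroup_def)
  then have "(c', - h', 0) \<in> hs_cochains X \<Lambda> (k - 1)"
    using c' add_subgroup_zero[OF period_forms_subgroup[OF X \<Lambda>(1)]] by (simp add: hs_cochains_def)
  ultimately show "(c, h, w) \<in> cohomologous_to_zero (hs_cochains X \<Lambda>) (hs_diff X) k"
    unfolding cohomologous_to_zero_def by (metis image_eqI)
next
  assume "(c, h, w) \<in> cohomologous_to_zero (hs_cochains X \<Lambda>) (hs_diff X) k"
  then obtain c' h' w' where *: "c' \<in> cochains X \<Lambda> (k - 1)" "h' \<in> cochains X UNIV (k - 1 - 1)"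
    "w' \<in> period_forms X \<Lambda> (k - 1)" "h = w' - c' - coboundary X (k - 1 - 1) h'"
    by (auto simp: cohomologous_to_zero_def hs_cochains_def hs_diff_def)
  show "\<forall>z\<in>smooth_cycles X (k - 1). h z \<in> \<Lambda>"
  proof
    fix z assume z: "z \<in> smooth_cycles X (k - 1)"
    then have "h z = w' z - c' z" using cochains_zero[OF *(2)] by (simp add: *(4) coboundary_def smooth_cycles_iff)
    moreover have "w' z \<in> \<Lambda>" "c' z \<in> \<Lambda>" using z * by (auto simp: period_forms_def cochains_iff smooth_cycles_iff)
    ultimately show "h z \<in> \<Lambda>" using add_subgroup_diff[OF \<Lambda>(1)] by simp
  qed
qed

lemma coset_trivial_iff:
  assumes "add_subgroup B"
  shows "coset B x = B \<longleftrightarrow> x \<in> B"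
  using coset_eq_iff[OF assms, of x 0] by simp

text \<open>This is the isomorphism of Hopkins and Singer. In degree \<open>0\<close> injectivity can fail: a nonzero
  constant function with value in \<open>\<Lambda>\<close> is a cocycle that has the trivial character.\<close>

lemma characters_presented:
  assumes X: "compact_smooth_manifold X" and \<Lambda>: "add_subgroup \<Lambda>" "\<Lambda> \<noteq> UNIV" and k: "k \<ge> 1"
  shows "presents {x \<in> hs_cochains X \<Lambda> k. hs_diff X k x = 0}
    (cohomologous_to_zero (hs_cochains X \<Lambda>) (hs_diff X) k)
    (differential_characters X \<Lambda> k) (cocycle_character X \<Lambda> k)"
proof -
  interpret int_complex "hs_cochains X \<Lambda>" "hs_diff X" by (rule hs_complex[OF X \<Lambda>])
  show ?thesis
    unfolding presents_def
  proof (intro conjI ballI)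
    show "add_subgroup (cocycles k)" by (rule add_subgroup_cocycles)
    show "cocycle_character X \<Lambda> k ` cocycles k = carrier (differential_characters X \<Lambda> k)"
    proof
      show "cocycle_character X \<Lambda> k ` cocycles k \<subseteq> carrier (differential_characters X \<Lambda> k)"
        using cocycle_character_mem[OF X \<Lambda>(1)] by auto
      show "carrier (differential_characters X \<Lambda> k) \<subseteq> cocycle_character X \<Lambda> k ` cocycles k"
        using cocycle_character_surj[OF X \<Lambda>, of _ k] by blast
    qed
    show "cocycle_character X \<Lambda> k (x + y) =
        cocycle_character X \<Lambda> k x \<otimes>\<^bsub>differential_characters X \<Lambda> k\<^esub> cocycle_character X \<Lambda> k y" for x y
      by (cases x; cases y)
         (simp add: character_mult cocycle_character_def reduce_eq_coset coset_set_mult[OF \<Lambda>(1)] cong: restrict_cong)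
    show "cocycle_character X \<Lambda> k 0 = \<one>\<^bsub>differential_characters X \<Lambda> k\<^esub>"
      by (auto simp: character_one cocycle_character_def reduce_eq_coset zero_prod_def)
    show "cocycle_character X \<Lambda> k x = \<one>\<^bsub>differential_characters X \<Lambda> k\<^esub> \<longleftrightarrow> x \<in> coboundaries k"
      if "x \<in> cocycles k" for x
    proof -
      obtain c h w where x: "x = (c, h, w)" by (cases x)
      have "cocycle_character X \<Lambda> k x = \<one>\<^bsub>differential_characters X \<Lambda> k\<^esub> \<longleftrightarrow>
          (\<forall>z\<in>smooth_cycles X (k - 1). coset \<Lambda> (h z) = \<Lambda>)"
        unfolding x character_one cocycle_character_def reduce_eq_coset
        by (auto simp: fun_eq_iff restrict_def)
      then show ?thesis
        using cocycle_character_trivial_iff[OF X \<Lambda> k, of c h w] that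
        unfolding x coset_trivial_iff[OF \<Lambda>(1)] by simp
    qed
  qed
qed

lemma hs_iso_class:
  assumes X: "compact_smooth_manifold X" and \<Lambda>: "add_subgroup \<Lambda>" "\<Lambda> \<noteq> UNIV" and k: "k \<ge> 1"
    and x: "x \<in> hs_cochains X \<Lambda> k" "hs_diff X k x = 0"
  shows "hs_iso X \<Lambda> k (homology_class (hs_cochains X \<Lambda>) (hs_diff X) k x) = cocycle_character X \<Lambda> k x"
proof -
  interpret int_complex "hs_cochains X \<Lambda>" "hs_diff X" by (rule hs_complex[OF X \<Lambda>])
  show ?thesis
    unfolding hs_iso_def
    using presents_eq_iff[OF characters_presented[OF X \<Lambda> k]] x by (intro on_classes_eq) auto
qed

text \<open>Every character comes from a cocycle, so this evaluates the inverse of the identification, and with it the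
  map \<open>l\<close>, everywhere.\<close>

lemma hs_iso_inverse:
  assumes X: "compact_smooth_manifold X" and \<Lambda>: "add_subgroup \<Lambda>" "\<Lambda> \<noteq> UNIV" and k: "k \<ge> 1"
    and x: "x \<in> hs_cochains X \<Lambda> k" "hs_diff X k x = 0"
  shows "inv_into (carrier (hs_homology X \<Lambda> k)) (hs_iso X \<Lambda> k) (cocycle_character X \<Lambda> k x) =
    homology_class (hs_cochains X \<Lambda>) (hs_diff X) k x"
proof -
  interpret int_complex "hs_cochains X \<Lambda>" "hs_diff X" by (rule hs_complex[OF X \<Lambda>])
  have car: "carrier (hs_homology X \<Lambda> k) = homology_class (hs_cochains X \<Lambda>) (hs_diff X) k ` cocycles k"
    using homology_presents[of k] by (simp add: presents_def hs_homology_def)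
  have "inj_on (hs_iso X \<Lambda> k) (carrier (hs_homology X \<Lambda> k))"
  proof (rule inj_onI)
    fix y z assume "y \<in> carrier (hs_homology X \<Lambda> k)" "z \<in> carrier (hs_homology X \<Lambda> k)"
      and eq: "hs_iso X \<Lambda> k y = hs_iso X \<Lambda> k z"
    then obtain a b where ab: "a \<in> cocycles k" "b \<in> cocycles k"
      "y = homology_class (hs_cochains X \<Lambda>) (hs_diff X) k a" "z = homology_class (hs_cochains X \<Lambda>) (hs_diff X) k b"
      unfolding car by blast
    then have "cocycle_character X \<Lambda> k a = cocycle_character X \<Lambda> k b"
      using eq hs_iso_class[OF X \<Lambda> k] by simp
    then show "y = z"
      using ab presents_eq_iff[OF characters_presented[OF X \<Lambda> k]] presents_eq_iff[OF homology_presents] by simp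
  qed
  then have "inv_into (carrier (hs_homology X \<Lambda> k)) (hs_iso X \<Lambda> k)
      (hs_iso X \<Lambda> k (homology_class (hs_cochains X \<Lambda>) (hs_diff X) k x)) =
      homology_class (hs_cochains X \<Lambda>) (hs_diff X) k x"
    by (rule inv_into_f_f) (use x car in blast)
  then show ?thesis unfolding hs_iso_class[OF X \<Lambda> k x] .
qed

section \<open>The exact sequence\<close>

text \<open>Under the identification with cocycles, the pullback of characters is the chain map whose cone is taken.\<close>

lemma character_pullback_cocycle:
  assumes A: "compact_smooth_manifold A" and M: "compact_smooth_manifold M" and \<rho>: "smooth_map A M \<rho>"
  shows "character_pullback A \<rho> k (cocycle_character M \<Lambda> k x) = cocycle_character A \<Lambda> k (hs_pullback A \<rho> k x)"
proof -
  obtain c h w where x: "x = (c, h, w)" by (cases x)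
  have "chain_map (nat (k - 1)) \<rho> z \<in> smooth_cycles M (k - 1)" if "z \<in> smooth_cycles A (k - 1)" for z
    using that chain_map_smooth[OF A M \<rho>, of z "k - 1"] chain_map_boundary[of z A "k - 1" \<rho>]
    by (simp add: smooth_cycles_iff)
  then show ?thesis
    by (auto simp: x character_pullback_def cocycle_character_def hs_pullback_def cochain_pullback_def
        smooth_cycles_iff intro!: restrict_ext)
qed

theorem theorem3p2:
  fixes M :: "'m smooth_manifold" and A :: "'a smooth_manifold"
    and \<rho> :: "'a \<Rightarrow> 'm" and \<Lambda> :: "real set"
  assumes "compact_smooth_manifold A"
    and "compact_smooth_manifold M"
    and "smooth_map A M \<rho>"
    and "subring \<Lambda> real_ring"
    and "\<Lambda> \<noteq> UNIV"
  shows "(\<forall>k::int. k \<ge> 1 \<longrightarrow>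
           exact_at (rel_hs_homology M A \<rho> \<Lambda> k) (q_map M \<Lambda> k)
             (differential_characters M \<Lambda> k) (character_pullback A \<rho> k)
             (differential_characters A \<Lambda> k)) \<and>
         (\<forall>k::int. k \<ge> 1 \<longrightarrow>
           exact_at (differential_characters M \<Lambda> k) (character_pullback A \<rho> k)
             (differential_characters A \<Lambda> k) (l_map M A \<rho> \<Lambda> (k + 1))
             (rel_hs_homology M A \<rho> \<Lambda> (k + 1))) \<and>
         (\<forall>k::int. k \<ge> 2 \<longrightarrow>
           exact_at (differential_characters A \<Lambda> (k - 1)) (l_map M A \<rho> \<Lambda> k)
             (rel_hs_homology M A \<rho> \<Lambda> k) (q_map M \<Lambda> k)
             (differential_characters M \<Lambda> k))"
proof -
  note A = assms(1) and M = assms(2) and \<rho> = assms(3)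
  have \<Lambda>: "add_subgroup \<Lambda>" "\<Lambda> \<noteq> UNIV" using subring_add_subgroup[OF assms(4)] assms(5) by auto
  interpret int_complex_map "hs_cochains M \<Lambda>" "hs_diff M" "hs_cochains A \<Lambda>" "hs_diff A" "hs_pullback A \<rho>"
    by (rule hs_complex_map[OF A M \<rho> \<Lambda>])
  have cone_eq: "rel_cochains M A \<Lambda> = cone" "rel_diff M A \<rho> = cone_d"
    by (auto simp: rel_cochains_def cone_def rel_diff_def cone_d_def fun_eq_iff)
  let ?cls = "\<lambda>k. homology_class cone cone_d k"
  have PR: "presents (cone.cocycles k) (cone.coboundaries k) (rel_hs_homology M A \<rho> \<Lambda> k) (?cls k)" for k
    using cone.homology_presents by (simp add: rel_hs_homology_def cone_eq)
  have PM: "presents (M.cocycles k) (M.coboundaries k) (differential_characters M \<Lambda> k) (cocycle_character M \<Lambda> k)"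
    if "k \<ge> 1" for k by (rule characters_presented[OF M \<Lambda> that])
  have PA: "presents (A.cocycles k) (A.coboundaries k) (differential_characters A \<Lambda> k) (cocycle_character A \<Lambda> k)"
    if "k \<ge> 1" for k by (rule characters_presented[OF A \<Lambda> that])
  have q: "q_map M \<Lambda> k (?cls k x) = cocycle_character M \<Lambda> k (fst x)" if k: "k \<ge> 1" and x: "x \<in> cone.cocycles k" for k x
  proof -
    have fx: "fst x \<in> M.cocycles k" using x cone_cocycle_iff[of "fst x" "snd x" k] by simp
    have "on_classes (\<lambda>(S, T). homology_class (hs_cochains M \<Lambda>) (hs_diff M) k S) (?cls k x) =
        (\<lambda>(S, T). homology_class (hs_cochains M \<Lambda>) (hs_diff M) k S) x"
    proof (rule cone.on_classes_eq[OF x])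
      fix y assume y: "y \<in> cone.cocycles k" and d: "y - x \<in> cone.coboundaries k"
      have fy: "fst y \<in> M.cocycles k" using y cone_cocycle_iff[of "fst y" "snd y" k] by simp
      have "fst y - fst x \<in> M.coboundaries k"
        using projection_coboundary[of "fst y - fst x" "snd y - snd x" k] d by (simp add: minus_prod_def)
      then show "(\<lambda>(S, T). homology_class (hs_cochains M \<Lambda>) (hs_diff M) k S) y =
          (\<lambda>(S, T). homology_class (hs_cochains M \<Lambda>) (hs_diff M) k S) x"
        using presents_eq_iff[OF M.homology_presents fy fx] by (simp add: case_prod_beta)
    qed
    then show ?thesis using hs_iso_class[OF M \<Lambda> k, of "fst x"] fx by (simp add: q_map_def case_prod_beta)
  qed
  have l: "l_map M A \<rho> \<Lambda> (k + 1) (cocycle_character A \<Lambda> k T) = ?cls (k + 1) (0, T)"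
    if k: "k \<ge> 1" and T: "T \<in> A.cocycles k" for k T
  proof -
    have "on_classes (\<lambda>T. ?cls (k + 1) (0, T)) (homology_class (hs_cochains A \<Lambda>) (hs_diff A) k T) = ?cls (k + 1) (0, T)"
    proof (rule A.on_classes_eq[OF T])
      fix T' assume T': "T' \<in> A.cocycles k" and d: "T' - T \<in> A.coboundaries k"
      have "(0, T') \<in> cone.cocycles (k + 1)" "(0, T) \<in> cone.cocycles (k + 1)"
        using inclusion_cocycle[of _ "k + 1"] T T' by auto
      moreover have "(0, T') - (0, T) \<in> cone.coboundaries (k + 1)"
        using inclusion_coboundary[of "T' - T" "k + 1"] d by simp
      ultimately show "?cls (k + 1) (0, T') = ?cls (k + 1) (0, T)"
        using presents_eq_iff[OF cone.homology_presents] by blast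
    qed
    then show ?thesis
      using hs_iso_inverse[OF A \<Lambda> k, of T] T by (simp add: l_map_def cone_eq)
  qed
  show ?thesis
  proof (intro conjI allI impI)
    fix k :: int assume k: "k \<ge> 1"
    show "exact_at (rel_hs_homology M A \<rho> \<Lambda> k) (q_map M \<Lambda> k) (differential_characters M \<Lambda> k)
        (character_pullback A \<rho> k) (differential_characters A \<Lambda> k)"
    proof (rule presents_exact[OF PR PM[OF k] PA[OF k], where u=fst and v="hs_pullback A \<rho> k"])
      show "fst x \<in> M.cocycles k" if "x \<in> cone.cocycles k" for x
        using that cone_cocycle_iff[of "fst x" "snd x" k] by simp
    qed (use q[OF k] r_cocycle r_add exact_at_base character_pullback_cocycle[OF A M \<rho>] in auto)
    show "exact_at (differential_characters M \<Lambda> k) (character_pullback A \<rho> k)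
        (differential_characters A \<Lambda> k) (l_map M A \<rho> \<Lambda> (k + 1)) (rel_hs_homology M A \<rho> \<Lambda> (k + 1))"
    proof (rule presents_exact[OF PM[OF k] PA[OF k] PR, where u="hs_pullback A \<rho> k" and v="\<lambda>T. (0, T)"])
      show "(0, T) \<in> cone.cocycles (k + 1)" if "T \<in> A.cocycles k" for T
        using inclusion_cocycle[of T "k + 1"] that by simp
    qed (use l[OF k] r_cocycle r_add exact_at_target character_pullback_cocycle[OF A M \<rho>] in auto)
  next
    fix k :: int assume "k \<ge> 2"
    then have k: "k \<ge> 1" "k - 1 \<ge> 1" by auto
    show "exact_at (differential_characters A \<Lambda> (k - 1)) (l_map M A \<rho> \<Lambda> k)
        (rel_hs_homology M A \<rho> \<Lambda> k) (q_map M \<Lambda> k) (differential_characters M \<Lambda> k)"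
    proof (rule presents_exact[OF PA[OF k(2)] PR PM[OF k(1)], where u="\<lambda>T. (0, T)" and v=fst])
      show "(0, T) \<in> cone.cocycles k" if "T \<in> A.cocycles (k - 1)" for T
        by (rule inclusion_cocycle[OF that])
      show "fst x \<in> M.cocycles k" if "x \<in> cone.cocycles k" for x
        using that cone_cocycle_iff[of "fst x" "snd x" k] by simp
    qed (use l[OF k(2)] q[OF k(1)] exact_at_cone in auto)
  qed
qed

end
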